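(* Let $\Bbbk$ be a commutative ring, $\mathcal{K}$ a $\Bbbk$-linear abelian category, $(\mathbb{X},\Gamma/{\sim})$ a triple whose set $\mathscr{P}$ of screens is nonempty, $\mathcal{C}$ its $\Bbbk$-linear path category, $\mathcal{I}$ a path based ideal of $\mathcal{C}$, and $\mathcal{A}=\mathcal{C}/\mathcal{I}$. Let $\mathscr{L}\subseteq\mathscr{P}$ be a nonempty set of screens such that for any finite collection $\{\mathfrak{P}_i\}_{i=1}^n\subset\mathscr{L}$ there exists $\mathfrak{P}\in\mathscr{L}$ that refines each $\mathfrak{P}_i$. Let $\mathrm{Rep}^{\mathscr{L}}_{\mathcal{K}}(\mathcal{A})$ be the full subcategory of $\mathrm{Rep}_{\mathcal{K}}(\mathcal{A})$ of those representations $M$ for which some screen in $\mathscr{L}$ pixelates $M$. Then $\mathrm{Rep}^{\mathscr{L}}_{\mathcal{K}}(\mathcal{A})$ is a wide subcategory of $\mathrm{Rep}_{\mathcal{K}}(\mathcal{A})$; that is, $\mathrm{Rep}^{\mathscr{L}}_{\mathcal{K}}(\mathcal{A})$ is abelian and the embedding $\mathrm{Rep}^{\mathscr{L}}_{\mathcal{K}}(\mathcal{A})\to\mathrm{Rep}_{\mathcal{K}}(\mathcal{A})$ is exact. Moreover, any exact structure $\mathbb{E}$ on $\mathrm{Rep}_{\mathcal{K}}(\mathcal{A})$ restricts to an exact structure on $\mathrm{Rep}^{\mathscr{L}}_{\mathcal{K}}(\mathcal{A})$.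
   Context: TRIPLES. A path in a nonempty set $\mathbb{X}$ is any function $\gamma:[0,1]\to\mathbb{X}$; $\mathrm{im}(\gamma)$ is its image. If $\gamma(1)=\gamma'(0)$, then $\gamma\cdot\gamma'$ is the path equal to $\gamma(2t)$ for $0\le t\le\frac12$ and to $\gamma'(2t-1)$ for $\frac12\le t\le1$. A triple $(\mathbb{X},\Gamma/{\sim})$ consists of a nonempty set $\mathbb{X}$, a set $\Gamma$ of paths in $\mathbb{X}$, and an equivalence relation $\sim$ on $\Gamma$ (equivalent paths have the same endpoints) such that: (a) $\gamma,\gamma'\in\Gamma$ with $\gamma(1)=\gamma'(0)$ implies $\gamma\cdot\gamma'\in\Gamma$; (b) if $\gamma\in\Gamma$ and $\phi:[0,1]\to[0,1]$ is weakly order preserving and sends intervals to intervals, then $\gamma\circ\phi\in\Gamma$; (c) all constant paths are in $\Gamma$; (d) a path equivalent to a constant path is constant; (e) if in (b) also $\phi(0)=0$, $\phi(1)=1$, then $\gamma\sim\gamma\circ\phi$; (f) if $\gamma,\gamma',\rho,\rho'\in\Gamma$ and $\rho\cdot\gamma\cdot\rho'$, $\rho\cdot\gamma'\cdot\rho'$ are defined and in $\Gamma$, then $\gamma\sim\gamma'$ if and only if $\rho\cdot\gamma\cdot\rho'\sim\rho\cdot\gamma'\cdot\rho'$. The class of $\gamma$ is $[\gamma]$. SCREENS. A screen of $(\mathbb{X},\Gamma/{\sim})$ is a partition $\mathfrak{P}$ of $\mathbb{X}$, whose elements are called pixels, such that: (S1) if $\gamma,\gamma'\in\Gamma$ have the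 same start and the same end and $\mathrm{im}(\gamma)\subset\mathsf{X}\in\mathfrak{P}$, then $\gamma\sim\gamma'$ if and only if $\mathrm{im}(\gamma')\subset\mathsf{X}$; (S2) any two points $x,y$ of a pixel $\mathsf{X}$ are joined by a finite walk $\gamma_0\cdot\gamma_1^{-1}\cdot\gamma_2\cdots\gamma_{2n-1}^{-1}\cdot\gamma_{2n}$ from $x$ to $y$ (where $\gamma^{-1}$ is $\gamma$ run backwards) with all $\gamma_i\in\Gamma$ and $\mathrm{im}(\gamma_i)\subset\mathsf{X}$; (S3) if $\rho,\gamma\in\Gamma$, $\rho(0)=\gamma(0)$ and $\mathrm{im}(\rho)$ lies in a pixel, then there are $\rho',\gamma'\in\Gamma$ with $\mathrm{im}(\rho')$ in a pixel and $\gamma\cdot\rho'\sim\rho\cdot\gamma'$; dually, if $\rho',\gamma'\in\Gamma$, $\rho'(1)=\gamma'(1)$ and $\mathrm{im}(\rho')$ lies in a pixel, then there are $\rho,\gamma\in\Gamma$ with $\mathrm{im}(\rho)$ in a pixel and $\gamma\cdot\rho'\sim\rho\cdot\gamma'$; (S4) for every $\gamma\in\Gamma$ there are a finite partition $\{I_i\}_{i=1}^n$ of $[0,1]$ into subintervals (listed in increasing order) and pixels $(\mathsf{X}_1,\dots,\mathsf{X}_n)$ with $\gamma(I_i)\subset\mathsf{X}_i$, where for $i\ne j$ the equality $\mathsf{X}_i=\mathsf{X}_j$ is allowed only if $|i-j|>1$; (S5) if $\gamma,\gamma'\in\Gamma$ have the same start and the same end and admit the same partition $\{I_i\}$ and the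 same list of pixels as in (S4), then $\gamma\sim\gamma'$. LINEAR PATH CATEGORY. $\mathcal{C}$ has objects $\mathbb{X}\sqcup\{0\}$ with $0$ a zero object; for $x,y\in\mathbb{X}$, $\mathrm{Hom}_{\mathcal{C}}(x,y)$ is the free $\Bbbk$-module on $\{[\gamma]\mid\gamma\in\Gamma,\gamma(0)=x,\gamma(1)=y\}$, with composition extending $[\gamma']\circ[\gamma]=[\gamma\cdot\gamma']$ bilinearly. An ideal $\mathcal{I}$ of $\mathcal{C}$ is path based if it is generated by finite sums $\sum_i\lambda_i[\gamma_i]$ with $\gamma_i\in\Gamma$ and each $\lambda_i\in\Bbbk$ not a zero divisor ($\mathcal{I}=0$ is allowed). COMPLETION AND $\Sigma_{\mathfrak{P}}$. Paths $\gamma,\gamma'\in\Gamma$ are $\mathfrak{P}$-equivalent if there are $\rho_1,\rho_2,\rho_3,\rho_4\in\Gamma$ with $\mathrm{im}(\rho_1)\cup\mathrm{im}(\rho_2)$ in one pixel, $\mathrm{im}(\rho_3)\cup\mathrm{im}(\rho_4)$ in one pixel, and $\rho_1\cdot\gamma\cdot\rho_3\sim\rho_2\cdot\gamma'\cdot\rho_4$. Morphisms $\sum_{i=1}^m\lambda_i[\gamma_i]$ and $\sum_{i=1}^m\lambda'_i[\gamma'_i]$ are $\mathfrak{P}$-equivalent if, up to permutation, $\lambda_i=\lambda_i'$ and $\gamma_i,\gamma'_i$ are $\mathfrak{P}$-equivalent for all $i$. $\overline{\mathcal{I}}^{\mathfrak{P}}$ is the ideal generated by all $f$ that are $\mathfrak{P}$-equivalent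 to some $g\in\mathcal{I}$, and $\overline{\mathcal{A}}^{\mathfrak{P}}=\mathcal{C}/\overline{\mathcal{I}}^{\mathfrak{P}}$ (a quotient of $\mathcal{A}$). A pixel $\mathsf{X}$ is pre-dead if there is $\rho\in\Gamma$ with $\mathrm{im}(\rho)\subset\mathsf{X}$ and $[\rho]=0$ in $\mathcal{A}$. $\Sigma_{\mathfrak{P}}$ consists of the $[\rho]\neq0$ in $\overline{\mathcal{A}}^{\mathfrak{P}}$ with $\mathrm{im}(\rho)$ in a pixel, and of the zero morphisms $x\to y$ with $x,y$ in a common pre-dead pixel. REPRESENTATIONS. $\mathrm{Rep}_{\mathcal{K}}(\mathcal{A})$ is the category of ($\Bbbk$-linear, additive) functors $\mathcal{A}\to\mathcal{K}$. A screen $\mathfrak{P}$ pixelates $M$ if $M(\sigma)$ is an isomorphism for all $\sigma\in\Sigma_{\mathfrak{P}}$; explicitly, $M([\rho])$ is an isomorphism whenever $\mathrm{im}(\rho)$ lies in a pixel and $[\rho]\ne0$ in $\overline{\mathcal{A}}^{\mathfrak{P}}$, and $M(0:x\to y)$ is an isomorphism for $x,y$ in a common pre-dead pixel. EXACT STRUCTURES. An exact structure on an abelian category $\mathcal{D}$ here means an additive subfunctor $\mathbb{E}\subset\mathrm{Ext}^1_{\mathcal{D}}$, where $\mathrm{Ext}^1_{\mathcal{D}}:\mathcal{D}^{op}\times\mathcal{D}\to\mathrm{Ab}$ sends $(A,B)$ to the group of extensions $0\to B\to E\to A\to0$. Restriction to an exactly embedded abelian subcategory means restricting $\mathbb{E}$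 to extensions in that subcategory. *)

theory Defs
  imports "HOL-Analysis.Analysis" "HOL-Library.Poly_Mapping"
begin

section \<open>Linear categories\<close>

text \<open>The coefficient ring is a type of sort \<open>{comm_ring, comm_monoid_mult}\<close>: a commutative ring with
  unit, the zero ring being allowed (unlike in \<^class>\<open>comm_ring_1\<close>).

  Hom sets need not be disjoint, so every operation carries the objects it refers to:
  \<open>Cmp D x y z g f\<close> is the composite of \<open>f : x \<rightarrow> y\<close> and \<open>g : y \<rightarrow> z\<close>.\<close>

record ('o, 'm, 'k) lcat =
  Ob :: "'o set"
  Hom :: "'o \<Rightarrow> 'o \<Rightarrow> 'm set"
  Cmp :: "'o \<Rightarrow> 'o \<Rightarrow> 'o \<Rightarrow> 'm \<Rightarrow> 'm \<Rightarrow> 'm"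
  Idn :: "'o \<Rightarrow> 'm"
  Add :: "'o \<Rightarrow> 'o \<Rightarrow> 'm \<Rightarrow> 'm \<Rightarrow> 'm"
  Zero :: "'o \<Rightarrow> 'o \<Rightarrow> 'm"
  Scale :: "'o \<Rightarrow> 'o \<Rightarrow> 'k \<Rightarrow> 'm \<Rightarrow> 'm"

locale linear_category =
  fixes D :: "('o, 'm, 'k::{comm_ring,comm_monoid_mult}) lcat"
  assumes Idn_in: "x \<in> Ob D \<Longrightarrow> Idn D x \<in> Hom D x x"
    and Cmp_in: "\<lbrakk>x \<in> Ob D; y \<in> Ob D; z \<in> Ob D; f \<in> Hom D x y; g \<in> Hom D y z\<rbrakk>
      \<Longrightarrow> Cmp D x y z g f \<in> Hom D x z"
    and Cmp_Idn: "\<lbrakk>x \<in> Ob D; y \<in> Ob D; f \<in> Hom D x y\<rbrakk> \<Longrightarrow> Cmp D x x y f (Idn D x) = f"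
    and Idn_Cmp: "\<lbrakk>x \<in> Ob D; y \<in> Ob D; f \<in> Hom D x y\<rbrakk> \<Longrightarrow> Cmp D x y y (Idn D y) f = f"
    and Cmp_assoc: "\<lbrakk>w \<in> Ob D; x \<in> Ob D; y \<in> Ob D; z \<in> Ob D;
        f \<in> Hom D w x; g \<in> Hom D x y; h \<in> Hom D y z\<rbrakk>
      \<Longrightarrow> Cmp D w y z h (Cmp D w x y g f) = Cmp D w x z (Cmp D x y z h g) f"
    and Zero_in: "\<lbrakk>x \<in> Ob D; y \<in> Ob D\<rbrakk> \<Longrightarrow> Zero D x y \<in> Hom D x y"
    and Add_in: "\<lbrakk>x \<in> Ob D; y \<in> Ob D; f \<in> Hom D x y; g \<in> Hom D x y\<rbrakk> \<Longrightarrow> Add D x y f g \<in> Hom D x y"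
    and Add_assoc: "\<lbrakk>x \<in> Ob D; y \<in> Ob D; f \<in> Hom D x y; g \<in> Hom D x y; h \<in> Hom D x y\<rbrakk>
      \<Longrightarrow> Add D x y (Add D x y f g) h = Add D x y f (Add D x y g h)"
    and Add_commute: "\<lbrakk>x \<in> Ob D; y \<in> Ob D; f \<in> Hom D x y; g \<in> Hom D x y\<rbrakk>
      \<Longrightarrow> Add D x y f g = Add D x y g f"
    and Add_Zero: "\<lbrakk>x \<in> Ob D; y \<in> Ob D; f \<in> Hom D x y\<rbrakk> \<Longrightarrow> Add D x y f (Zero D x y) = f"
    and Add_inverse: "\<lbrakk>x \<in> Ob D; y \<in> Ob D; f \<in> Hom D x y\<rbrakk>
      \<Longrightarrow> \<exists>g\<in>Hom D x y. Add D x y f g = Zero D x y"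
    and Scale_in: "\<lbrakk>x \<in> Ob D; y \<in> Ob D; f \<in> Hom D x y\<rbrakk> \<Longrightarrow> Scale D x y c f \<in> Hom D x y"
    and Scale_one: "\<lbrakk>x \<in> Ob D; y \<in> Ob D; f \<in> Hom D x y\<rbrakk> \<Longrightarrow> Scale D x y 1 f = f"
    and Scale_mult: "\<lbrakk>x \<in> Ob D; y \<in> Ob D; f \<in> Hom D x y\<rbrakk>
      \<Longrightarrow> Scale D x y (c * d) f = Scale D x y c (Scale D x y d f)"
    and Scale_add_left: "\<lbrakk>x \<in> Ob D; y \<in> Ob D; f \<in> Hom D x y\<rbrakk>
      \<Longrightarrow> Scale D x y (c + d) f = Add D x y (Scale D x y c f) (Scale D x y d f)"
    and Scale_add_right: "\<lbrakk>x \<in> Ob D; y \<in> Ob D; f \<in> Hom D x y; g \<in> Hom D x y\<rbrakk>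
      \<Longrightarrow> Scale D x y c (Add D x y f g) = Add D x y (Scale D x y c f) (Scale D x y c g)"
    and Cmp_Add_left: "\<lbrakk>x \<in> Ob D; y \<in> Ob D; z \<in> Ob D; f \<in> Hom D x y; g \<in> Hom D y z; h \<in> Hom D y z\<rbrakk>
      \<Longrightarrow> Cmp D x y z (Add D y z g h) f = Add D x z (Cmp D x y z g f) (Cmp D x y z h f)"
    and Cmp_Add_right: "\<lbrakk>x \<in> Ob D; y \<in> Ob D; z \<in> Ob D; f \<in> Hom D x y; g \<in> Hom D x y; h \<in> Hom D y z\<rbrakk>
      \<Longrightarrow> Cmp D x y z h (Add D x y f g) = Add D x z (Cmp D x y z h f) (Cmp D x y z h g)"
    and Cmp_Scale_left: "\<lbrakk>x \<in> Ob D; y \<in> Ob D; z \<in> Ob D; f \<in> Hom D x y; g \<in> Hom D y z\<rbrakk>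
      \<Longrightarrow> Cmp D x y z (Scale D y z c g) f = Scale D x z c (Cmp D x y z g f)"
    and Cmp_Scale_right: "\<lbrakk>x \<in> Ob D; y \<in> Ob D; z \<in> Ob D; f \<in> Hom D x y; g \<in> Hom D y z\<rbrakk>
      \<Longrightarrow> Cmp D x y z g (Scale D x y c f) = Scale D x z c (Cmp D x y z g f)"

definition is_iso :: "('o, 'm, 'k) lcat \<Rightarrow> 'o \<Rightarrow> 'o \<Rightarrow> 'm \<Rightarrow> bool" where
  "is_iso D x y f \<longleftrightarrow> f \<in> Hom D x y \<and>
    (\<exists>g\<in>Hom D y x. Cmp D x y x g f = Idn D x \<and> Cmp D y x y f g = Idn D y)"

definition is_mono :: "('o, 'm, 'k) lcat \<Rightarrow> 'o \<Rightarrow> 'o \<Rightarrow> 'm \<Rightarrow> bool" where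
  "is_mono D x y f \<longleftrightarrow> f \<in> Hom D x y \<and>
    (\<forall>w\<in>Ob D. \<forall>g\<in>Hom D w x. \<forall>h\<in>Hom D w x. Cmp D w x y f g = Cmp D w x y f h \<longrightarrow> g = h)"

definition is_epi :: "('o, 'm, 'k) lcat \<Rightarrow> 'o \<Rightarrow> 'o \<Rightarrow> 'm \<Rightarrow> bool" where
  "is_epi D x y f \<longleftrightarrow> f \<in> Hom D x y \<and>
    (\<forall>z\<in>Ob D. \<forall>g\<in>Hom D y z. \<forall>h\<in>Hom D y z. Cmp D x y z g f = Cmp D x y z h f \<longrightarrow> g = h)"

definition is_kernel :: "('o, 'm, 'k) lcat \<Rightarrow> 'o \<Rightarrow> 'o \<Rightarrow> 'm \<Rightarrow> 'o \<Rightarrow> 'm \<Rightarrow> bool" where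
  "is_kernel D x y f w k \<longleftrightarrow> w \<in> Ob D \<and> k \<in> Hom D w x \<and> Cmp D w x y f k = Zero D w y \<and>
    (\<forall>v\<in>Ob D. \<forall>g\<in>Hom D v x. Cmp D v x y f g = Zero D v y \<longrightarrow>
      (\<exists>!u. u \<in> Hom D v w \<and> Cmp D v w x k u = g))"

definition is_cokernel :: "('o, 'm, 'k) lcat \<Rightarrow> 'o \<Rightarrow> 'o \<Rightarrow> 'm \<Rightarrow> 'o \<Rightarrow> 'm \<Rightarrow> bool" where
  "is_cokernel D x y f w c \<longleftrightarrow> w \<in> Ob D \<and> c \<in> Hom D y w \<and> Cmp D x y w c f = Zero D x w \<and>
    (\<forall>v\<in>Ob D. \<forall>g\<in>Hom D y v. Cmp D x y v g f = Zero D x v \<longrightarrow>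
      (\<exists>!u. u \<in> Hom D w v \<and> Cmp D y w v u c = g))"

definition is_zero_object :: "('o, 'm, 'k) lcat \<Rightarrow> 'o \<Rightarrow> bool" where
  "is_zero_object D z \<longleftrightarrow> z \<in> Ob D \<and>
    (\<forall>x\<in>Ob D. (\<exists>!f. f \<in> Hom D x z) \<and> (\<exists>!f. f \<in> Hom D z x))"

definition is_biproduct ::
  "('o, 'm, 'k) lcat \<Rightarrow> 'o \<Rightarrow> 'o \<Rightarrow> 'o \<Rightarrow> 'm \<Rightarrow> 'm \<Rightarrow> 'm \<Rightarrow> 'm \<Rightarrow> bool" where
  "is_biproduct D a b s i1 i2 p1 p2 \<longleftrightarrow> s \<in> Ob D \<and>
    i1 \<in> Hom D a s \<and> i2 \<in> Hom D b s \<and> p1 \<in> Hom D s a \<and> p2 \<in> Hom D s b \<and>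
    Cmp D a s a p1 i1 = Idn D a \<and> Cmp D b s b p2 i2 = Idn D b \<and>
    Cmp D a s b p2 i1 = Zero D a b \<and> Cmp D b s a p1 i2 = Zero D b a \<and>
    Add D s s (Cmp D s a s i1 p1) (Cmp D s b s i2 p2) = Idn D s"

locale abelian_category = linear_category D
  for D :: "('o, 'm, 'k::{comm_ring,comm_monoid_mult}) lcat" +
  assumes zero_object: "\<exists>z. is_zero_object D z"
    and biproducts: "\<lbrakk>a \<in> Ob D; b \<in> Ob D\<rbrakk> \<Longrightarrow> \<exists>s i1 i2 p1 p2. is_biproduct D a b s i1 i2 p1 p2"
    and kernels: "\<lbrakk>x \<in> Ob D; y \<in> Ob D; f \<in> Hom D x y\<rbrakk> \<Longrightarrow> \<exists>w k. is_kernel D x y f w k"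
    and cokernels: "\<lbrakk>x \<in> Ob D; y \<in> Ob D; f \<in> Hom D x y\<rbrakk> \<Longrightarrow> \<exists>w c. is_cokernel D x y f w c"
    and mono_is_kernel: "\<lbrakk>x \<in> Ob D; y \<in> Ob D; is_mono D x y f\<rbrakk>
      \<Longrightarrow> \<exists>z\<in>Ob D. \<exists>g\<in>Hom D y z. is_kernel D y z g x f"
    and epi_is_cokernel: "\<lbrakk>x \<in> Ob D; y \<in> Ob D; is_epi D x y f\<rbrakk>
      \<Longrightarrow> \<exists>z\<in>Ob D. \<exists>g\<in>Hom D z x. is_cokernel D z x g y f"


section \<open>Ideals and quotients\<close>

definition is_ideal :: "('o, 'm, 'k) lcat \<Rightarrow> ('o \<Rightarrow> 'o \<Rightarrow> 'm set) \<Rightarrow> bool" where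
  "is_ideal D I \<longleftrightarrow>
    (\<forall>x\<in>Ob D. \<forall>y\<in>Ob D. I x y \<subseteq> Hom D x y \<and> Zero D x y \<in> I x y \<and>
      (\<forall>f\<in>I x y. \<forall>g\<in>I x y. Add D x y f g \<in> I x y) \<and>
      (\<forall>c. \<forall>f\<in>I x y. Scale D x y c f \<in> I x y)) \<and>
    (\<forall>x\<in>Ob D. \<forall>y\<in>Ob D. \<forall>z\<in>Ob D.
      (\<forall>f\<in>I x y. \<forall>g\<in>Hom D y z. Cmp D x y z g f \<in> I x z) \<and>
      (\<forall>f\<in>Hom D x y. \<forall>g\<in>I y z. Cmp D x y z g f \<in> I x z))"

definition ideal_gen ::
  "('o, 'm, 'k) lcat \<Rightarrow> ('o \<Rightarrow> 'o \<Rightarrow> 'm set) \<Rightarrow> 'o \<Rightarrow> 'o \<Rightarrow> 'm set" where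
  "ideal_gen D G x y =
    \<Inter> {J x y | J. is_ideal D J \<and> (\<forall>a\<in>Ob D. \<forall>b\<in>Ob D. G a b \<subseteq> J a b)}"

definition coset ::
  "('o, 'm, 'k) lcat \<Rightarrow> ('o \<Rightarrow> 'o \<Rightarrow> 'm set) \<Rightarrow> 'o \<Rightarrow> 'o \<Rightarrow> 'm \<Rightarrow> 'm set" where
  "coset D I x y f = Add D x y f ` I x y"

definition quotient_category ::
  "('o, 'm, 'k) lcat \<Rightarrow> ('o \<Rightarrow> 'o \<Rightarrow> 'm set) \<Rightarrow> ('o, 'm set, 'k) lcat" where
  "quotient_category D I =
    \<lparr> Ob = Ob D,
      Hom = (\<lambda>x y. coset D I x y ` Hom D x y),
      Cmp = (\<lambda>x y z G F. \<Union>g\<in>G. \<Union>f\<in>F. coset D I x z (Cmp D x y z g f)),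
      Idn = (\<lambda>x. coset D I x x (Idn D x)),
      Add = (\<lambda>x y F G. \<Union>f\<in>F. \<Union>g\<in>G. coset D I x y (Add D x y f g)),
      Zero = (\<lambda>x y. coset D I x y (Zero D x y)),
      Scale = (\<lambda>x y c F. \<Union>f\<in>F. coset D I x y (Scale D x y c f)) \<rparr>"


section \<open>Functors\<close>

record ('a, 'q, 'o, 'n) lfun =
  FOb :: "'a \<Rightarrow> 'o"
  FMor :: "'a \<Rightarrow> 'a \<Rightarrow> 'q \<Rightarrow> 'n"

text \<open>Functors and natural transformations are extensional (\<open>undefined\<close> off their domains), so that
  HOL equality is equality of functors and of natural transformations.\<close>

definition linear_functor ::
  "('a, 'q, 'k) lcat \<Rightarrow> ('o, 'n, 'k) lcat \<Rightarrow> ('a, 'q, 'o, 'n) lfun \<Rightarrow> bool" where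
  "linear_functor A D M \<longleftrightarrow>
    FOb M \<in> Ob A \<rightarrow>\<^sub>E Ob D \<and>
    (\<forall>x y. (x \<in> Ob A \<and> y \<in> Ob A \<longrightarrow> FMor M x y \<in> Hom A x y \<rightarrow>\<^sub>E Hom D (FOb M x) (FOb M y)) \<and>
           (\<not> (x \<in> Ob A \<and> y \<in> Ob A) \<longrightarrow> FMor M x y = (\<lambda>_. undefined))) \<and>
    (\<forall>x\<in>Ob A. FMor M x x (Idn A x) = Idn D (FOb M x)) \<and>
    (\<forall>x\<in>Ob A. \<forall>y\<in>Ob A. \<forall>z\<in>Ob A. \<forall>f\<in>Hom A x y. \<forall>g\<in>Hom A y z.
      FMor M x z (Cmp A x y z g f) =
        Cmp D (FOb M x) (FOb M y) (FOb M z) (FMor M y z g) (FMor M x y f)) \<and>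
    (\<forall>x\<in>Ob A. \<forall>y\<in>Ob A. \<forall>f\<in>Hom A x y. \<forall>g\<in>Hom A x y.
      FMor M x y (Add A x y f g) = Add D (FOb M x) (FOb M y) (FMor M x y f) (FMor M x y g)) \<and>
    (\<forall>x\<in>Ob A. \<forall>y\<in>Ob A. \<forall>f\<in>Hom A x y. \<forall>c.
      FMor M x y (Scale A x y c f) = Scale D (FOb M x) (FOb M y) c (FMor M x y f))"

definition nat_trans ::
  "('a, 'q, 'k) lcat \<Rightarrow> ('o, 'n, 'k) lcat \<Rightarrow> ('a, 'q, 'o, 'n) lfun \<Rightarrow> ('a, 'q, 'o, 'n) lfun
    \<Rightarrow> ('a \<Rightarrow> 'n) set" where
  "nat_trans A D M N = {\<eta>. \<eta> \<in> (\<Pi>\<^sub>E x\<in>Ob A. Hom D (FOb M x) (FOb N x)) \<and>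
    (\<forall>x\<in>Ob A. \<forall>y\<in>Ob A. \<forall>f\<in>Hom A x y.
      Cmp D (FOb M x) (FOb M y) (FOb N y) (\<eta> y) (FMor M x y f) =
      Cmp D (FOb M x) (FOb N x) (FOb N y) (FMor N x y f) (\<eta> x))}"

definition functor_category ::
  "('a, 'q, 'k) lcat \<Rightarrow> ('o, 'n, 'k) lcat \<Rightarrow> (('a, 'q, 'o, 'n) lfun, 'a \<Rightarrow> 'n, 'k) lcat" where
  "functor_category A D =
    \<lparr> Ob = {M. linear_functor A D M},
      Hom = nat_trans A D,
      Cmp = (\<lambda>L M N \<theta> \<eta>. \<lambda>x\<in>Ob A. Cmp D (FOb L x) (FOb M x) (FOb N x) (\<theta> x) (\<eta> x)),
      Idn = (\<lambda>M. \<lambda>x\<in>Ob A. Idn D (FOb M x)),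
      Add = (\<lambda>M N \<eta> \<theta>. \<lambda>x\<in>Ob A. Add D (FOb M x) (FOb N x) (\<eta> x) (\<theta> x)),
      Zero = (\<lambda>M N. \<lambda>x\<in>Ob A. Zero D (FOb M x) (FOb N x)),
      Scale = (\<lambda>M N c \<eta>. \<lambda>x\<in>Ob A. Scale D (FOb M x) (FOb N x) c (\<eta> x)) \<rparr>"

definition full_subcategory :: "('o, 'm, 'k) lcat \<Rightarrow> 'o set \<Rightarrow> ('o, 'm, 'k) lcat" where
  "full_subcategory D S = D\<lparr>Ob := Ob D \<inter> S\<rparr>"

definition short_exact ::
  "('o, 'm, 'k) lcat \<Rightarrow> 'o \<Rightarrow> 'o \<Rightarrow> 'o \<Rightarrow> 'm \<Rightarrow> 'm \<Rightarrow> bool" where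
  "short_exact D b e a i p \<longleftrightarrow> b \<in> Ob D \<and> e \<in> Ob D \<and> a \<in> Ob D \<and>
    i \<in> Hom D b e \<and> p \<in> Hom D e a \<and> is_kernel D e a p b i \<and> is_cokernel D b e i a p"

definition exact_functor ::
  "('a, 'q, 'k) lcat \<Rightarrow> ('o, 'n, 'k) lcat \<Rightarrow> ('a, 'q, 'o, 'n) lfun \<Rightarrow> bool" where
  "exact_functor A D F \<longleftrightarrow> linear_functor A D F \<and>
    (\<forall>b e a i p. short_exact A b e a i p \<longrightarrow>
      short_exact D (FOb F b) (FOb F e) (FOb F a) (FMor F b e i) (FMor F e a p))"

definition embedding :: "('o, 'm, 'k) lcat \<Rightarrow> ('o, 'm, 'o, 'm) lfun" where
  "embedding D = \<lparr> FOb = (\<lambda>x\<in>Ob D. x),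
     FMor = (\<lambda>x y. if x \<in> Ob D \<and> y \<in> Ob D then (\<lambda>f\<in>Hom D x y. f) else (\<lambda>_. undefined)) \<rparr>"

definition wide_subcategory :: "('o, 'm, 'k::{comm_ring,comm_monoid_mult}) lcat \<Rightarrow> 'o set \<Rightarrow> bool" where
  "wide_subcategory D S \<longleftrightarrow> abelian_category (full_subcategory D S) \<and>
    exact_functor (full_subcategory D S) D (embedding (full_subcategory D S))"


section \<open>Extensions and exact structures\<close>

text \<open>An extension of \<open>a\<close> by \<open>b\<close> is a triple \<open>(e, i, p)\<close> with \<open>0 \<rightarrow> b \<rightarrow> e \<rightarrow> a \<rightarrow> 0\<close> short exact.\<close>

definition extensions :: "('o, 'm, 'k) lcat \<Rightarrow> 'o \<Rightarrow> 'o \<Rightarrow> ('o \<times> 'm \<times> 'm) set" where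
  "extensions D a b = {(e, i, p). short_exact D b e a i p}"

text \<open>\<open>ext_mor D a b a' b' \<alpha> \<beta> \<xi> \<xi>'\<close>: there is a morphism of short exact sequences from \<open>\<xi>\<close> (an extension
  of \<open>a\<close> by \<open>b\<close>) to \<open>\<xi>'\<close> (of \<open>a'\<close> by \<open>b'\<close>) with outer components \<open>\<beta> : b \<rightarrow> b'\<close> and \<open>\<alpha> : a \<rightarrow> a'\<close>.\<close>

definition ext_mor ::
  "('o, 'm, 'k) lcat \<Rightarrow> 'o \<Rightarrow> 'o \<Rightarrow> 'o \<Rightarrow> 'o \<Rightarrow> 'm \<Rightarrow> 'm \<Rightarrow> 'o \<times> 'm \<times> 'm \<Rightarrow> 'o \<times> 'm \<times> 'm \<Rightarrow> bool" where
  "ext_mor D a b a' b' \<alpha> \<beta> = (\<lambda>(e, i, p) (e', i', p').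
    \<exists>h\<in>Hom D e e'. Cmp D b e e' h i = Cmp D b b' e' i' \<beta> \<and> Cmp D e e' a' p' h = Cmp D e a a' \<alpha> p)"

definition ext_equiv :: "('o, 'm, 'k) lcat \<Rightarrow> 'o \<Rightarrow> 'o \<Rightarrow> (('o \<times> 'm \<times> 'm) \<times> ('o \<times> 'm \<times> 'm)) set" where
  "ext_equiv D a b = {(\<xi>, \<xi>'). \<xi> \<in> extensions D a b \<and> \<xi>' \<in> extensions D a b \<and>
    ext_mor D a b a b (Idn D a) (Idn D b) \<xi> \<xi>'}"

definition Ext1 :: "('o, 'm, 'k) lcat \<Rightarrow> 'o \<Rightarrow> 'o \<Rightarrow> ('o \<times> 'm \<times> 'm) set set" where
  "Ext1 D a b = extensions D a b // ext_equiv D a b"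

text \<open>The maps \<open>Ext1 D a b \<rightarrow> Ext1 D a' b\<close> (pull back along \<open>\<alpha> : a' \<rightarrow> a\<close>) and
  \<open>Ext1 D a b \<rightarrow> Ext1 D a b'\<close> (push out along \<open>\<beta> : b \<rightarrow> b'\<close>). In an abelian category the pulled back
  extension is, up to equivalence, the only one with a morphism to the given extension whose outer
  components are \<open>\<alpha>\<close> and the identity, and dually for the push out.\<close>

definition ext_pull ::
  "('o, 'm, 'k) lcat \<Rightarrow> 'o \<Rightarrow> 'o \<Rightarrow> 'o \<Rightarrow> 'm \<Rightarrow> ('o \<times> 'm \<times> 'm) set \<Rightarrow> ('o \<times> 'm \<times> 'm) set" where
  "ext_pull D a b a' \<alpha> c = {\<xi>' \<in> extensions D a' b. \<exists>\<xi>\<in>c. ext_mor D a' b a b \<alpha> (Idn D b) \<xi>' \<xi>}"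

definition ext_push ::
  "('o, 'm, 'k) lcat \<Rightarrow> 'o \<Rightarrow> 'o \<Rightarrow> 'o \<Rightarrow> 'm \<Rightarrow> ('o \<times> 'm \<times> 'm) set \<Rightarrow> ('o \<times> 'm \<times> 'm) set" where
  "ext_push D a b b' \<beta> c = {\<xi>' \<in> extensions D a b'. \<exists>\<xi>\<in>c. ext_mor D a b a b' (Idn D a) \<beta> \<xi> \<xi>'}"

text \<open>The Baer sum of \<open>\<xi>1\<close> and \<open>\<xi>2\<close> is \<open>\<nabla>\<^sub>* \<Delta>\<^sup>* (\<xi>1 \<oplus> \<xi>2)\<close>: here \<open>\<eta>\<close> is the pull back of \<open>\<xi>1 \<oplus> \<xi>2\<close> (an extension of
  \<open>aa = a \<oplus> a\<close> by \<open>bb = b \<oplus> b\<close>) along the diagonal \<open>\<Delta> = j1 + j2\<close>, and \<open>\<xi>\<close> is the push out of \<open>\<eta>\<close> along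
  the codiagonal \<open>\<nabla> = q1 + q2\<close>.\<close>

definition ext_sum ::
  "('o, 'm, 'k) lcat \<Rightarrow> 'o \<Rightarrow> 'o \<Rightarrow> ('o \<times> 'm \<times> 'm) set \<Rightarrow> ('o \<times> 'm \<times> 'm) set \<Rightarrow> ('o \<times> 'm \<times> 'm) set" where
  "ext_sum D a b c1 c2 = {\<xi> \<in> extensions D a b.
    \<exists>e1 i1 p1 e2 i2 p2 aa j1 j2 s1 s2 bb k1 k2 q1 q2 ee l1 l2 r1 r2 \<eta>.
      (e1, i1, p1) \<in> c1 \<and> (e2, i2, p2) \<in> c2 \<and>
      is_biproduct D a a aa j1 j2 s1 s2 \<and>
      is_biproduct D b b bb k1 k2 q1 q2 \<and>
      is_biproduct D e1 e2 ee l1 l2 r1 r2 \<and>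
      \<eta> \<in> extensions D a bb \<and>
      ext_mor D a bb aa bb (Add D a aa j1 j2) (Idn D bb) \<eta>
        (ee,
         Add D bb ee (Cmp D bb e1 ee l1 (Cmp D bb b e1 i1 q1)) (Cmp D bb e2 ee l2 (Cmp D bb b e2 i2 q2)),
         Add D ee aa (Cmp D ee a aa j1 (Cmp D ee e1 a p1 r1)) (Cmp D ee a aa j2 (Cmp D ee e2 a p2 r2))) \<and>
      ext_mor D a bb a b (Idn D a) (Add D bb b q1 q2) \<eta> \<xi>}"

definition ext_zero :: "('o, 'm, 'k) lcat \<Rightarrow> 'o \<Rightarrow> 'o \<Rightarrow> ('o \<times> 'm \<times> 'm) set" where
  "ext_zero D a b = {(e, i, p) \<in> extensions D a b. \<exists>s\<in>Hom D a e. Cmp D a e a p s = Idn D a}"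

text \<open>An additive subfunctor of \<open>Ext1\<close>: a subgroup of every \<open>Ext1 D a b\<close> (contains the neutral element,
  closed under Baer sum and under inverses) such that the subgroups are stable under all pull backs
  and push outs.\<close>

definition exact_structure ::
  "('o, 'm, 'k) lcat \<Rightarrow> ('o \<Rightarrow> 'o \<Rightarrow> ('o \<times> 'm \<times> 'm) set set) \<Rightarrow> bool" where
  "exact_structure D E \<longleftrightarrow>
    (\<forall>a\<in>Ob D. \<forall>b\<in>Ob D. E a b \<subseteq> Ext1 D a b \<and>
      ext_zero D a b \<in> E a b \<and>
      (\<forall>c\<in>E a b. \<forall>d\<in>E a b. ext_sum D a b c d \<in> E a b) \<and>
      (\<forall>c\<in>E a b. \<forall>d\<in>Ext1 D a b. ext_sum D a b c d = ext_zero D a b \<longrightarrow> d \<in> E a b)) \<and>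
    (\<forall>a\<in>Ob D. \<forall>b\<in>Ob D. \<forall>a'\<in>Ob D. \<forall>\<alpha>\<in>Hom D a' a. \<forall>c\<in>E a b. ext_pull D a b a' \<alpha> c \<in> E a' b) \<and>
    (\<forall>a\<in>Ob D. \<forall>b\<in>Ob D. \<forall>b'\<in>Ob D. \<forall>\<beta>\<in>Hom D b b'. \<forall>c\<in>E a b. ext_push D a b b' \<beta> c \<in> E a b')"

text \<open>A class of extensions in the full subcategory is contained in a unique class of the ambient
  category; it is kept if that class belongs to \<open>E\<close>.\<close>

definition restrict_structure ::
  "('o, 'm, 'k) lcat \<Rightarrow> 'o set \<Rightarrow> ('o \<Rightarrow> 'o \<Rightarrow> ('o \<times> 'm \<times> 'm) set set)
    \<Rightarrow> 'o \<Rightarrow> 'o \<Rightarrow> ('o \<times> 'm \<times> 'm) set set" where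
  "restrict_structure D S E a b = {c \<in> Ext1 (full_subcategory D S) a b. \<exists>d\<in>E a b. c \<subseteq> d}"


section \<open>Triples\<close>

text \<open>A path is a function on \<open>{0..1}\<close>, extended by \<open>undefined\<close>.\<close>

type_synonym 'x path = "real \<Rightarrow> 'x"

definition im :: "'x path \<Rightarrow> 'x set" where
  "im \<gamma> = \<gamma> ` {0..1}"

definition pconcat :: "'x path \<Rightarrow> 'x path \<Rightarrow> 'x path"  (infixl "\<cdot>" 70) where
  "\<gamma> \<cdot> \<gamma>' = (\<lambda>t\<in>{0..1}. if t \<le> 1/2 then \<gamma> (2 * t) else \<gamma>' (2 * t - 1))"

definition const_path :: "'x \<Rightarrow> 'x path" where
  "const_path x = (\<lambda>t\<in>{0..1}. x)"

definition reparam :: "(real \<Rightarrow> real) \<Rightarrow> bool" where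
  "reparam \<phi> \<longleftrightarrow> \<phi> \<in> {0..1} \<rightarrow> {0..1} \<and> mono_on {0..1} \<phi> \<and>
    (\<forall>J\<subseteq>{0..1}. is_interval J \<longrightarrow> is_interval (\<phi> ` J))"

record 'x triple =
  Pts :: "'x set"
  Paths :: "'x path set"
  Eqv :: "('x path \<times> 'x path) set"

text \<open>Threefold concatenations are bracketed to the left; by \<open>triple_reparam_eqv\<close> the other bracketing
  gives an equivalent path.\<close>

locale path_triple =
  fixes T :: "'x triple"
  assumes triple_nonempty: "Pts T \<noteq> {}"
    and triple_paths: "Paths T \<subseteq> {0..1} \<rightarrow>\<^sub>E Pts T"
    and triple_equiv: "equiv (Paths T) (Eqv T)"
    and triple_endpoints: "(\<gamma>, \<gamma>') \<in> Eqv T \<Longrightarrow> \<gamma> 0 = \<gamma>' 0 \<and> \<gamma> 1 = \<gamma>' 1"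
    and triple_concat: "\<lbrakk>\<gamma> \<in> Paths T; \<gamma>' \<in> Paths T; \<gamma> 1 = \<gamma>' 0\<rbrakk> \<Longrightarrow> \<gamma> \<cdot> \<gamma>' \<in> Paths T"
    and triple_reparam: "\<lbrakk>\<gamma> \<in> Paths T; reparam \<phi>\<rbrakk> \<Longrightarrow> compose {0..1} \<gamma> \<phi> \<in> Paths T"
    and triple_const: "x \<in> Pts T \<Longrightarrow> const_path x \<in> Paths T"
    and triple_eqv_const: "(\<gamma>, const_path x) \<in> Eqv T \<Longrightarrow> \<exists>y. \<gamma> = const_path y"
    and triple_reparam_eqv: "\<lbrakk>\<gamma> \<in> Paths T; reparam \<phi>; \<phi> 0 = 0; \<phi> 1 = 1\<rbrakk>
      \<Longrightarrow> (\<gamma>, compose {0..1} \<gamma> \<phi>) \<in> Eqv T"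
    and triple_cancel: "\<lbrakk>\<gamma> \<in> Paths T; \<gamma>' \<in> Paths T; \<rho> \<in> Paths T; \<rho>' \<in> Paths T;
        \<rho> 1 = \<gamma> 0; \<gamma> 1 = \<rho>' 0; \<rho> 1 = \<gamma>' 0; \<gamma>' 1 = \<rho>' 0\<rbrakk>
      \<Longrightarrow> (\<gamma>, \<gamma>') \<in> Eqv T \<longleftrightarrow> (\<rho> \<cdot> \<gamma> \<cdot> \<rho>', \<rho> \<cdot> \<gamma>' \<cdot> \<rho>') \<in> Eqv T"

definition path_class :: "'x triple \<Rightarrow> 'x path \<Rightarrow> 'x path set" where
  "path_class T \<gamma> = Eqv T `` {\<gamma>}"


section \<open>Screens\<close>

definition in_pixel :: "'x set set \<Rightarrow> 'x path \<Rightarrow> bool" where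
  "in_pixel P \<gamma> \<longleftrightarrow> (\<exists>Y\<in>P. im \<gamma> \<subseteq> Y)"

text \<open>\<open>subdivides P \<gamma> Is Ys\<close>: the intervals \<open>Is\<close>, in increasing order, partition \<open>{0..1}\<close>, and \<open>\<gamma>\<close> maps the
  \<open>i\<close>-th interval into the \<open>i\<close>-th pixel in \<open>Ys\<close>.\<close>

definition subdivides :: "'x set set \<Rightarrow> 'x path \<Rightarrow> real set list \<Rightarrow> 'x set list \<Rightarrow> bool" where
  "subdivides P \<gamma> Is Ys \<longleftrightarrow> length Ys = length Is \<and>
    partition_on {0..1} (set Is) \<and> (\<forall>J\<in>set Is. is_interval J) \<and>
    (\<forall>i j. i < j \<and> j < length Is \<longrightarrow> (\<forall>s\<in>Is ! i. \<forall>t\<in>Is ! j. s < t)) \<and>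
    set Ys \<subseteq> P \<and> (\<forall>i<length Is. \<gamma> ` (Is ! i) \<subseteq> Ys ! i) \<and>
    (\<forall>i<length Is. \<forall>j<length Is. i \<noteq> j \<and> Ys ! i = Ys ! j \<longrightarrow> \<bar>int i - int j\<bar> > 1)"

locale screen = path_triple T
  for T :: "'x triple" +
  fixes P :: "'x set set"
  assumes screen_partition: "partition_on (Pts T) P"
    and S1: "\<lbrakk>\<gamma> \<in> Paths T; \<gamma>' \<in> Paths T; \<gamma> 0 = \<gamma>' 0; \<gamma> 1 = \<gamma>' 1; Y \<in> P; im \<gamma> \<subseteq> Y\<rbrakk>
      \<Longrightarrow> (\<gamma>, \<gamma>') \<in> Eqv T \<longleftrightarrow> im \<gamma>' \<subseteq> Y"
    \<comment> \<open>the even-numbered paths of the walk are run forwards, the odd-numbered ones backwards\<close>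
    and S2: "\<lbrakk>Y \<in> P; x \<in> Y; y \<in> Y\<rbrakk> \<Longrightarrow>
      \<exists>(n::nat) \<gamma>. (\<forall>i\<le>2*n. \<gamma> i \<in> Paths T \<and> im (\<gamma> i) \<subseteq> Y) \<and> \<gamma> 0 0 = x \<and> \<gamma> (2*n) 1 = y \<and>
        (\<forall>i<n. \<gamma> (2*i) 1 = \<gamma> (2*i+1) 1 \<and> \<gamma> (2*i+1) 0 = \<gamma> (2*i+2) 0)"
    and S3: "\<lbrakk>\<rho> \<in> Paths T; \<gamma> \<in> Paths T; \<rho> 0 = \<gamma> 0; in_pixel P \<rho>\<rbrakk> \<Longrightarrow>
      \<exists>\<rho>'\<in>Paths T. \<exists>\<gamma>'\<in>Paths T. in_pixel P \<rho>' \<and> \<gamma> 1 = \<rho>' 0 \<and> \<rho> 1 = \<gamma>' 0 \<and>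
        (\<gamma> \<cdot> \<rho>', \<rho> \<cdot> \<gamma>') \<in> Eqv T"
    and S3_dual: "\<lbrakk>\<rho>' \<in> Paths T; \<gamma>' \<in> Paths T; \<rho>' 1 = \<gamma>' 1; in_pixel P \<rho>'\<rbrakk> \<Longrightarrow>
      \<exists>\<rho>\<in>Paths T. \<exists>\<gamma>\<in>Paths T. in_pixel P \<rho> \<and> \<gamma> 1 = \<rho>' 0 \<and> \<rho> 1 = \<gamma>' 0 \<and>
        (\<gamma> \<cdot> \<rho>', \<rho> \<cdot> \<gamma>') \<in> Eqv T"
    and S4: "\<gamma> \<in> Paths T \<Longrightarrow> \<exists>Is Ys. subdivides P \<gamma> Is Ys"
    and S5: "\<lbrakk>\<gamma> \<in> Paths T; \<gamma>' \<in> Paths T; \<gamma> 0 = \<gamma>' 0; \<gamma> 1 = \<gamma>' 1;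
        subdivides P \<gamma> Is Ys; subdivides P \<gamma>' Is Ys\<rbrakk> \<Longrightarrow> (\<gamma>, \<gamma>') \<in> Eqv T"

definition screens :: "'x triple \<Rightarrow> 'x set set set" where
  "screens T = {P. screen T P}"


section \<open>The linear path category\<close>

text \<open>Objects are \<open>Some x\<close> for points \<open>x\<close>, and the zero object \<open>None\<close>. The free module on a set of path
  classes consists of the finitely supported functions (\<^typ>\<open>'a \<Rightarrow>\<^sub>0 'k\<close>) supported on it.\<close>

type_synonym ('x, 'k) path_mor = "'x path set \<Rightarrow>\<^sub>0 'k"

definition path_hom :: "'x triple \<Rightarrow> 'x option \<Rightarrow> 'x option \<Rightarrow> ('x, 'k::zero) path_mor set" where
  "path_hom T x y = {f. Poly_Mapping.keys f \<subseteq>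
    {path_class T \<gamma> | \<gamma>. \<gamma> \<in> Paths T \<and> x = Some (\<gamma> 0) \<and> y = Some (\<gamma> 1)}}"

definition class_concat :: "'x triple \<Rightarrow> 'x path set \<Rightarrow> 'x path set \<Rightarrow> 'x path set" where
  "class_concat T p q = (\<Union>\<gamma>\<in>p. \<Union>\<gamma>'\<in>q. path_class T (\<gamma> \<cdot> \<gamma>'))"

definition path_category ::
  "'x triple \<Rightarrow> ('x option, ('x, 'k::{comm_ring,comm_monoid_mult}) path_mor, 'k) lcat" where
  "path_category T =
    \<lparr> Ob = insert None (Some ` Pts T),
      Hom = path_hom T,
      Cmp = (\<lambda>x y z g f. \<Sum>p\<in>Poly_Mapping.keys f. \<Sum>q\<in>Poly_Mapping.keys g.
        Poly_Mapping.single (class_concat T p q) (Poly_Mapping.lookup g q * Poly_Mapping.lookup f p)),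
      Idn = (\<lambda>x. case x of None \<Rightarrow> 0 | Some a \<Rightarrow> Poly_Mapping.single (path_class T (const_path a)) 1),
      Add = (\<lambda>x y. (+)),
      Zero = (\<lambda>x y. 0),
      Scale = (\<lambda>x y c. Poly_Mapping.map ((*) c)) \<rparr>"

definition path_morphism :: "'x triple \<Rightarrow> 'x path \<Rightarrow> ('x, 'k::{comm_ring,comm_monoid_mult}) path_mor" where
  "path_morphism T \<gamma> = Poly_Mapping.single (path_class T \<gamma>) 1"

text \<open>A formal presentation \<open>\<Sum>\<^sub>i \<lambda>\<^sub>i [\<gamma>\<^sub>i]\<close> of a morphism \<open>x \<rightarrow> y\<close> is a list of pairs \<open>(\<lambda>\<^sub>i, \<gamma>\<^sub>i)\<close>.\<close>

definition presentations :: "'x triple \<Rightarrow> 'x option \<Rightarrow> 'x option \<Rightarrow> ('k \<times> 'x path) list set" where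
  "presentations T x y =
    {ts. \<forall>(c, \<gamma>)\<in>set ts. \<gamma> \<in> Paths T \<and> x = Some (\<gamma> 0) \<and> y = Some (\<gamma> 1)}"

definition path_sum ::
  "'x triple \<Rightarrow> ('k::{comm_ring,comm_monoid_mult} \<times> 'x path) list \<Rightarrow> ('x, 'k) path_mor" where
  "path_sum T ts = (\<Sum>(c, \<gamma>)\<leftarrow>ts. Poly_Mapping.single (path_class T \<gamma>) c)"

definition non_zero_divisor :: "'k::comm_ring \<Rightarrow> bool" where
  "non_zero_divisor c \<longleftrightarrow> (\<forall>d. c * d = 0 \<longrightarrow> d = 0)"

definition path_based ::
  "'x triple \<Rightarrow> ('x option \<Rightarrow> 'x option \<Rightarrow> ('x, 'k::{comm_ring,comm_monoid_mult}) path_mor set) \<Rightarrow> bool" where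
  "path_based T I \<longleftrightarrow> is_ideal (path_category T) I \<and>
    (\<exists>G. (\<forall>x y. G x y \<subseteq> {path_sum T ts | ts. ts \<in> presentations T x y \<and>
                              (\<forall>(c, \<gamma>)\<in>set ts. non_zero_divisor c)}) \<and>
      (\<forall>x\<in>Ob (path_category T :: (_, ('x, 'k) path_mor, 'k) lcat).
       \<forall>y\<in>Ob (path_category T :: (_, ('x, 'k) path_mor, 'k) lcat).
         I x y = ideal_gen (path_category T) G x y))"


section \<open>Completion and pixelation\<close>

definition path_pequiv :: "'x triple \<Rightarrow> 'x set set \<Rightarrow> 'x path \<Rightarrow> 'x path \<Rightarrow> bool" where
  "path_pequiv T P \<gamma> \<gamma>' \<longleftrightarrow> \<gamma> \<in> Paths T \<and> \<gamma>' \<in> Paths T \<and>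
    (\<exists>\<rho>1\<in>Paths T. \<exists>\<rho>2\<in>Paths T. \<exists>\<rho>3\<in>Paths T. \<exists>\<rho>4\<in>Paths T.
      (\<exists>Y\<in>P. im \<rho>1 \<union> im \<rho>2 \<subseteq> Y) \<and> (\<exists>Z\<in>P. im \<rho>3 \<union> im \<rho>4 \<subseteq> Z) \<and>
      \<rho>1 1 = \<gamma> 0 \<and> \<gamma> 1 = \<rho>3 0 \<and> \<rho>2 1 = \<gamma>' 0 \<and> \<gamma>' 1 = \<rho>4 0 \<and>
      (\<rho>1 \<cdot> \<gamma> \<cdot> \<rho>3, \<rho>2 \<cdot> \<gamma>' \<cdot> \<rho>4) \<in> Eqv T)"

definition mor_pequiv ::
  "'x triple \<Rightarrow> 'x set set \<Rightarrow> 'x option \<Rightarrow> 'x option \<Rightarrow> ('x, 'k::{comm_ring,comm_monoid_mult}) path_mor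
    \<Rightarrow> 'x option \<Rightarrow> 'x option \<Rightarrow> ('x, 'k) path_mor \<Rightarrow> bool" where
  "mor_pequiv T P x y f x' y' g \<longleftrightarrow>
    (\<exists>ts\<in>presentations T x y. \<exists>ts'\<in>presentations T x' y'. f = path_sum T ts \<and> g = path_sum T ts' \<and>
      list_all2 (\<lambda>(c, \<gamma>) (c', \<gamma>'). c = c' \<and> path_pequiv T P \<gamma> \<gamma>') ts ts')"

definition completion ::
  "'x triple \<Rightarrow> 'x set set \<Rightarrow> ('x option \<Rightarrow> 'x option \<Rightarrow> ('x, 'k::{comm_ring,comm_monoid_mult}) path_mor set)
    \<Rightarrow> 'x option \<Rightarrow> 'x option \<Rightarrow> ('x, 'k) path_mor set" where
  "completion T P I = ideal_gen (path_category T)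
    (\<lambda>x y. {f \<in> Hom (path_category T) x y.
      \<exists>x'\<in>Ob (path_category T :: (_, ('x, 'k) path_mor, 'k) lcat).
      \<exists>y'\<in>Ob (path_category T :: (_, ('x, 'k) path_mor, 'k) lcat).
      \<exists>g\<in>I x' y'. mor_pequiv T P x y f x' y' g})"

text \<open>The morphism \<open>[\<rho>]\<close> of the quotient of the path category by \<open>J\<close>.\<close>

definition path_coset ::
  "'x triple \<Rightarrow> ('x option \<Rightarrow> 'x option \<Rightarrow> ('x, 'k::{comm_ring,comm_monoid_mult}) path_mor set)
    \<Rightarrow> 'x path \<Rightarrow> ('x, 'k) path_mor set" where
  "path_coset T J \<rho> = coset (path_category T) J (Some (\<rho> 0)) (Some (\<rho> 1)) (path_morphism T \<rho>)"

definition vanishes ::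
  "'x triple \<Rightarrow> ('x option \<Rightarrow> 'x option \<Rightarrow> ('x, 'k::{comm_ring,comm_monoid_mult}) path_mor set)
    \<Rightarrow> 'x path \<Rightarrow> bool" where
  "vanishes T J \<rho> \<longleftrightarrow>
    path_coset T J \<rho> = Zero (quotient_category (path_category T) J) (Some (\<rho> 0)) (Some (\<rho> 1))"

definition pre_dead ::
  "'x triple \<Rightarrow> ('x option \<Rightarrow> 'x option \<Rightarrow> ('x, 'k::{comm_ring,comm_monoid_mult}) path_mor set)
    \<Rightarrow> 'x set \<Rightarrow> bool" where
  "pre_dead T I Y \<longleftrightarrow> (\<exists>\<rho>\<in>Paths T. im \<rho> \<subseteq> Y \<and> vanishes T I \<rho>)"

text \<open>The elements of \<open>\<Sigma>\<close> are listed as morphisms of \<open>\<A> = \<C>/\<I>\<close> together with source and target.\<close>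

definition Sigma_screen ::
  "'x triple \<Rightarrow> ('x option \<Rightarrow> 'x option \<Rightarrow> ('x, 'k::{comm_ring,comm_monoid_mult}) path_mor set)
    \<Rightarrow> 'x set set \<Rightarrow> ('x option \<times> 'x option \<times> ('x, 'k) path_mor set) set" where
  "Sigma_screen T I P =
    {(Some (\<rho> 0), Some (\<rho> 1), path_coset T I \<rho>) | \<rho>.
       \<rho> \<in> Paths T \<and> in_pixel P \<rho> \<and> \<not> vanishes T (completion T P I) \<rho>} \<union>
    {(Some x, Some y, Zero (quotient_category (path_category T) I) (Some x) (Some y)) | x y.
       \<exists>Y\<in>P. pre_dead T I Y \<and> x \<in> Y \<and> y \<in> Y}"

definition Rep ::
  "'x triple \<Rightarrow> ('x option \<Rightarrow> 'x option \<Rightarrow> ('x, 'k::{comm_ring,comm_monoid_mult}) path_mor set)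
    \<Rightarrow> ('o, 'n, 'k) lcat
    \<Rightarrow> (('x option, ('x, 'k) path_mor set, 'o, 'n) lfun, 'x option \<Rightarrow> 'n, 'k) lcat" where
  "Rep T I K = functor_category (quotient_category (path_category T) I) K"

definition pixelates ::
  "'x triple \<Rightarrow> ('x option \<Rightarrow> 'x option \<Rightarrow> ('x, 'k::{comm_ring,comm_monoid_mult}) path_mor set)
    \<Rightarrow> ('o, 'n, 'k) lcat \<Rightarrow> 'x set set
    \<Rightarrow> ('x option, ('x, 'k) path_mor set, 'o, 'n) lfun \<Rightarrow> bool" where
  "pixelates T I K P M \<longleftrightarrow>
    (\<forall>(x, y, \<sigma>)\<in>Sigma_screen T I P. is_iso K (FOb M x) (FOb M y) (FMor M x y \<sigma>))"

definition pixelated_by ::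
  "'x triple \<Rightarrow> ('x option \<Rightarrow> 'x option \<Rightarrow> ('x, 'k::{comm_ring,comm_monoid_mult}) path_mor set)
    \<Rightarrow> ('o, 'n, 'k) lcat \<Rightarrow> 'x set set set
    \<Rightarrow> ('x option, ('x, 'k) path_mor set, 'o, 'n) lfun set" where
  "pixelated_by T I K L = {M \<in> Ob (Rep T I K). \<exists>P\<in>L. pixelates T I K P M}"

end

theory Submission
  imports Defs
begin

text \<open>A screen pixelates a representation \<open>M\<close> iff \<open>M\<close> inverts every path that stays inside a pixel. The point is
  that \<open>[\<rho>]\<close>, for a path \<open>\<rho>\<close> in a pixel, vanishes in the completed quotient only if the pixel is pre-dead: by S1 and
  S3 the in-pixel paths form a two-sided Ore system with unique parallel arrows, so the morphisms \<open>f\<close> with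
  \<open>v f u \<in> I\<close> for some in-pixel \<open>u\<close>, \<open>v\<close> form an ideal, which contains the completion. Conversely, on a pre-dead pixel
  an inverted zero morphism forces \<open>M\<close> to be zero, first at one point and then by S2 on the whole pixel.

  Inverting all in-pixel paths is inherited by refinements, so two representations are pixelated by a
  common screen, and it passes to pointwise kernels, cokernels and biproducts. Hence the
  subcategory is wide. Pull backs, push outs and Baer sums of extensions can then be formed inside it, and
  this restricts exact structures.\<close>

section \<open>Linear categories\<close>

text \<open>The obstacle is that \<open>Sigma_screen\<close> is not visibly monotone in the screen:
  refining shrinks the pixels, but it also changes the completion, hence which paths vanish and
  which pixels are pre-dead. The set \<open>pixel_arrows\<close> of all in-pixel arrows does shrink,
  so common refinements are taken only after passing to it. Pre-deadness is read off from
  denominators: if \<open>v \<rho> u\<close> lies in \<open>I\<close>, with \<open>u\<close> and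
  \<open>v\<close> in-pixel paths that meet \<rho> at its ends, then the concatenation of the three
  still stays in the pixel of \<rho> and vanishes in the quotient by \<open>I\<close>. Uniqueness of
  parallel arrows serves to compare sums. Each summand brings its own four auxiliary paths; those
  around one morphism are brought to common ends by Ore squares, and those around the other then
  agree automatically. For exact structures, the operations on extension classes are sets of all
  possible results. They must be shown to be single classes: in the subcategory for every closure
  condition, and in the ambient category for inverses.\<close>

context linear_category
begin

lemmas closed [simp] = Idn_in Cmp_in Zero_in Add_in Scale_in
lemmas unit [simp] = Cmp_Idn Idn_Cmp Add_Zero

lemma Add_Zero_left [simp]:
  "\<lbrakk>x \<in> Ob D; y \<in> Ob D; f \<in> Hom D x y\<rbrakk> \<Longrightarrow> Add D x y (Zero D x y) f = f"
  by (metis Add_commute Add_Zero Zero_in)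

lemma Add_left_cancel:
  assumes "x \<in> Ob D" "y \<in> Ob D" "f \<in> Hom D x y" "g \<in> Hom D x y" "h \<in> Hom D x y"
    and "Add D x y f g = Add D x y f h"
  shows "g = h"
proof -
  obtain f' where f': "f' \<in> Hom D x y" "Add D x y f f' = Zero D x y"
    using Add_inverse assms by blast
  have "Add D x y f' (Add D x y f k) = k" if k: "k \<in> Hom D x y" for k
  proof -
    have "Add D x y f' (Add D x y f k) = Add D x y (Add D x y f' f) k"
      using Add_assoc f'(1) k assms(1-3) by simp
    also have "Add D x y f' f = Zero D x y"
      using Add_commute [OF assms(1,2) f'(1) assms(3)] f'(2) by (rule trans)
    finally show ?thesis
      using k assms(1,2) by simp
  qed
  from this [OF assms(4)] this [OF assms(5)] show ?thesis
    using assms(6) by metis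
qed

text \<open>Additive maps preserve the equation \<open>f + f = f\<close>, so this criterion yields
  at once that composition and scaling send zero to zero.\<close>

lemma Add_idem_Zero:
  assumes "x \<in> Ob D" "y \<in> Ob D" "f \<in> Hom D x y" "Add D x y f f = f"
  shows "f = Zero D x y"
  using Add_left_cancel [of x y f f "Zero D x y"] assms by simp

lemma Cmp_Zero_left [simp]:
  assumes "x \<in> Ob D" "y \<in> Ob D" "z \<in> Ob D" "f \<in> Hom D x y"
  shows "Cmp D x y z (Zero D y z) f = Zero D x z"
  by (rule Add_idem_Zero) (use assms Cmp_Add_left [of x y z f "Zero D y z" "Zero D y z"] in simp_all)

lemma Cmp_Zero_right [simp]:
  assumes "x \<in> Ob D" "y \<in> Ob D" "z \<in> Ob D" "f \<in> Hom D y z"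
  shows "Cmp D x y z f (Zero D x y) = Zero D x z"
  by (rule Add_idem_Zero) (use assms Cmp_Add_right [of x y z "Zero D x y" "Zero D x y" f] in simp_all)

lemma Scale_0 [simp]:
  assumes "x \<in> Ob D" "y \<in> Ob D" "f \<in> Hom D x y"
  shows "Scale D x y 0 f = Zero D x y"
  by (rule Add_idem_Zero) (use assms Scale_add_left [of x y f 0 0] in simp_all)

lemma Scale_Zero [simp]:
  assumes "x \<in> Ob D" "y \<in> Ob D"
  shows "Scale D x y c (Zero D x y) = Zero D x y"
  by (rule Add_idem_Zero) (use assms Scale_add_right [of x y "Zero D x y" "Zero D x y" c] in simp_all)

text \<open>\<open>Add_inverse\<close> only asserts that an inverse exists. Scaling by
  \<open>- 1\<close> names it, so that differences can be written as terms.\<close>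

lemma Add_neg [simp]:
  assumes "x \<in> Ob D" "y \<in> Ob D" "f \<in> Hom D x y"
  shows "Add D x y f (Scale D x y (- 1) f) = Zero D x y"
  using assms Scale_add_left [of x y f 1 "- 1"] by (simp add: Scale_one)

lemma diff_eq_ZeroD:
  assumes "x \<in> Ob D" "y \<in> Ob D" "f \<in> Hom D x y" "g \<in> Hom D x y"
    and "Add D x y f (Scale D x y (- 1) g) = Zero D x y"
  shows "f = g"
proof (rule Add_left_cancel)
  show "Add D x y (Scale D x y (- 1) g) f = Add D x y (Scale D x y (- 1) g) g"
    using assms Add_commute [of x y "Scale D x y (- 1) g"] by simp
qed (use assms in simp_all)

text \<open>Once composites are associated to the right, the factor \<open>g f\<close> is visible
  only at the inner end of a composite. This form lets a known value of \<open>g f\<close> be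
  substituted when further morphisms precede it.\<close>

lemma Cmp_assoc_eq:
  assumes "Cmp D x y z g f = r" "f \<in> Hom D x y" "g \<in> Hom D y z" "v \<in> Hom D w x"
    "w \<in> Ob D" "x \<in> Ob D" "y \<in> Ob D" "z \<in> Ob D"
  shows "Cmp D w y z g (Cmp D w x y f v) = Cmp D w x z r v"
  using assms by (simp add: Cmp_assoc)

lemmas Cmp_assoc_right = Cmp_assoc [symmetric]

lemma Add_left_commute:
  "\<lbrakk>x \<in> Ob D; y \<in> Ob D; f \<in> Hom D x y; g \<in> Hom D x y; h \<in> Hom D x y\<rbrakk>
    \<Longrightarrow> Add D x y f (Add D x y g h) = Add D x y g (Add D x y f h)"
  by (metis Add_assoc Add_commute)

lemmas Add_ac = Add_assoc Add_commute Add_left_commute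
lemmas bilinear = Cmp_Add_left Cmp_Add_right Cmp_Scale_left Cmp_Scale_right

section \<open>Monomorphisms, kernels, biproducts and isomorphisms\<close>

lemma is_monoI:
  assumes "x \<in> Ob D" "y \<in> Ob D" "f \<in> Hom D x y"
    and "\<And>w g. \<lbrakk>w \<in> Ob D; g \<in> Hom D w x; Cmp D w x y f g = Zero D w y\<rbrakk> \<Longrightarrow> g = Zero D w x"
  shows "is_mono D x y f"
  unfolding is_mono_def
proof (intro conjI ballI impI)
  fix w g h
  assume *: "w \<in> Ob D" "g \<in> Hom D w x" "h \<in> Hom D w x" "Cmp D w x y f g = Cmp D w x y f h"
  \<comment> \<open>Cancellation is tested on the difference of \<open>g\<close> and
    \<open>h\<close>, which \<open>f\<close> sends to zero.\<close>
  have "Add D w x g (Scale D w x (- 1) h) = Zero D w x"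
    by (rule assms(4)) (use * assms(1-3) in \<open>simp_all add: bilinear\<close>)
  then show "g = h"
    using diff_eq_ZeroD * assms(1) by blast
qed fact

lemma is_monoD:
  assumes "is_mono D x y f" "w \<in> Ob D" "g \<in> Hom D w x" "h \<in> Hom D w x"
    and "Cmp D w x y f g = Cmp D w x y f h"
  shows "g = h"
  using assms unfolding is_mono_def by blast

lemma is_mono_ZeroD:
  assumes "is_mono D x y f" "w \<in> Ob D" "x \<in> Ob D" "y \<in> Ob D" "g \<in> Hom D w x"
    and "Cmp D w x y f g = Zero D w y"
  shows "g = Zero D w x"
  using is_monoD [OF assms(1,2,5), of "Zero D w x"] assms by (simp add: is_mono_def)

lemma is_kernel_mono: "\<lbrakk>is_kernel D x y f w k; x \<in> Ob D; y \<in> Ob D; f \<in> Hom D x y\<rbrakk> \<Longrightarrow> is_mono D w x k"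
  unfolding is_kernel_def
  by (rule is_monoI; (elim conjE)?) (metis Cmp_Zero_right Zero_in)+

lemma is_kernel_lift:
  assumes "is_kernel D x y f w k" "v \<in> Ob D" "g \<in> Hom D v x" "Cmp D v x y f g = Zero D v y"
  obtains u where "u \<in> Hom D v w" "Cmp D v w x k u = g"
  using assms unfolding is_kernel_def by metis

text \<open>The uniqueness half of the universal property is traded for \<open>k\<close> being
  monic, which can be tested against zero.\<close>

lemma is_kernelI:
  assumes "w \<in> Ob D" "k \<in> Hom D w x" "Cmp D w x y f k = Zero D w y" "is_mono D w x k"
    and "\<And>v g. \<lbrakk>v \<in> Ob D; g \<in> Hom D v x; Cmp D v x y f g = Zero D v y\<rbrakk>
      \<Longrightarrow> \<exists>u\<in>Hom D v w. Cmp D v w x k u = g"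
  shows "is_kernel D x y f w k"
  unfolding is_kernel_def using assms(1-3) assms(5) is_monoD [OF assms(4)] by metis

text \<open>The two factorisations are inverse to each other because kernels are monic. It serves
  later to compare a kernel formed in a full subcategory with one formed in the ambient
  category.\<close>

lemma is_kernel_cong:
  assumes "is_kernel D x y f w k" "is_kernel D x y f w' k'" "x \<in> Ob D" "y \<in> Ob D" "f \<in> Hom D x y"
  obtains u where "is_iso D w w' u" "Cmp D w w' x k' u = k"
proof -
  have w: "w \<in> Ob D" "k \<in> Hom D w x" "w' \<in> Ob D" "k' \<in> Hom D w' x"
    "Cmp D w x y f k = Zero D w y" "Cmp D w' x y f k' = Zero D w' y"
    using assms by (auto simp: is_kernel_def)
  obtain u where u: "u \<in> Hom D w w'" "Cmp D w w' x k' u = k"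
    using is_kernel_lift [OF assms(2)] w by metis
  obtain v where v: "v \<in> Hom D w' w" "Cmp D w' w x k v = k'"
    using is_kernel_lift [OF assms(1)] w by metis
  have "Cmp D w w' w v u = Idn D w"
    by (rule is_monoD [OF is_kernel_mono [OF assms(1,3-5)] w(1)]) (simp_all add: Cmp_assoc u v w assms(3-5))
  moreover have "Cmp D w' w w' u v = Idn D w'"
    by (rule is_monoD [OF is_kernel_mono [OF assms(2-5)] w(3)]) (simp_all add: Cmp_assoc u v w assms(3-5))
  ultimately have "is_iso D w w' u"
    using u v by (auto simp: is_iso_def)
  then show ?thesis
    using that u by blast
qed

lemma biproduct_simps:
  assumes "is_biproduct D a b s i1 i2 p1 p2" "a \<in> Ob D" "b \<in> Ob D"
  shows "s \<in> Ob D" "i1 \<in> Hom D a s" "i2 \<in> Hom D b s" "p1 \<in> Hom D s a" "p2 \<in> Hom D s b"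
    "Cmp D a s a p1 i1 = Idn D a" "Cmp D b s b p2 i2 = Idn D b"
    "Cmp D a s b p2 i1 = Zero D a b" "Cmp D b s a p1 i2 = Zero D b a"
    "\<lbrakk>v \<in> Ob D; f \<in> Hom D v a\<rbrakk> \<Longrightarrow> Cmp D v s a p1 (Cmp D v a s i1 f) = f"
    "\<lbrakk>v \<in> Ob D; g \<in> Hom D v b\<rbrakk> \<Longrightarrow> Cmp D v s b p2 (Cmp D v b s i2 g) = g"
    "\<lbrakk>v \<in> Ob D; f \<in> Hom D v a\<rbrakk> \<Longrightarrow> Cmp D v s b p2 (Cmp D v a s i1 f) = Zero D v b"
    "\<lbrakk>v \<in> Ob D; g \<in> Hom D v b\<rbrakk> \<Longrightarrow> Cmp D v s a p1 (Cmp D v b s i2 g) = Zero D v a"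
  using assms by (simp_all add: is_biproduct_def Cmp_assoc)

lemma biproduct_decomp:
  assumes "is_biproduct D a b s i1 i2 p1 p2" "a \<in> Ob D" "b \<in> Ob D" "v \<in> Ob D" "f \<in> Hom D v s"
  shows "Add D v s (Cmp D v a s i1 (Cmp D v s a p1 f)) (Cmp D v b s i2 (Cmp D v s b p2 f)) = f"
proof -
  have *: "Add D s s (Cmp D s a s i1 p1) (Cmp D s b s i2 p2) = Idn D s"
    using assms(1) by (simp add: is_biproduct_def)
  show ?thesis
    using Cmp_Add_left [of v s s f "Cmp D s a s i1 p1" "Cmp D s b s i2 p2"] biproduct_simps(1-5) [OF assms(1-3)]
      assms(2-5) by (simp add: * Cmp_assoc_right)
qed

lemma biproduct_jointly_mono:
  assumes "is_biproduct D a b s i1 i2 p1 p2" "a \<in> Ob D" "b \<in> Ob D" "v \<in> Ob D"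
    and "f \<in> Hom D v s" "g \<in> Hom D v s"
    and "Cmp D v s a p1 f = Cmp D v s a p1 g" "Cmp D v s b p2 f = Cmp D v s b p2 g"
  shows "f = g"
  using biproduct_decomp [OF assms(1-5)] biproduct_decomp [OF assms(1-4,6)] assms(7,8) by metis

lemma is_iso_in: "is_iso D x y f \<Longrightarrow> f \<in> Hom D x y"
  by (simp add: is_iso_def)

lemma is_isoE:
  assumes "is_iso D x y f"
  obtains g where "g \<in> Hom D y x" "Cmp D x y x g f = Idn D x" "Cmp D y x y f g = Idn D y"
  using assms by (auto simp: is_iso_def)

lemma is_iso_mono:
  assumes "is_iso D x y f" "x \<in> Ob D" "y \<in> Ob D"
  shows "is_mono D x y f"
proof (rule is_monoI)
  obtain h where h: "h \<in> Hom D y x" "Cmp D x y x h f = Idn D x"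
    using is_isoE [OF assms(1)] by metis
  fix w g assume g: "w \<in> Ob D" "g \<in> Hom D w x" "Cmp D w x y f g = Zero D w y"
  have "g = Cmp D w y x h (Cmp D w x y f g)"
    using Cmp_assoc_eq [OF h(2)] h(1) g(1,2) assms is_iso_in by simp
  also have "\<dots> = Zero D w x"
    using g h assms by simp
  finally show "g = Zero D w x" .
qed (use assms is_iso_in in auto)

end

section \<open>Duality\<close>

text \<open>Composition and all hom data swap their end objects while the types stay the same, so
  each notion becomes literally its dual and a dual lemma is an instance of the original
  one.\<close>

definition op_cat :: "('o, 'm, 'k) lcat \<Rightarrow> ('o, 'm, 'k) lcat" where
  "op_cat D = \<lparr> Ob = Ob D, Hom = (\<lambda>x y. Hom D y x), Cmp = (\<lambda>x y z g f. Cmp D z y x f g), Idn = Idn D,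
     Add = (\<lambda>x y. Add D y x), Zero = (\<lambda>x y. Zero D y x), Scale = (\<lambda>x y. Scale D y x) \<rparr>"

lemma op_cat_simps [simp]:
  "Ob (op_cat D) = Ob D" "Hom (op_cat D) x y = Hom D y x"
  "Cmp (op_cat D) x y z g f = Cmp D z y x f g" "Idn (op_cat D) = Idn D"
  "Add (op_cat D) x y = Add D y x" "Zero (op_cat D) x y = Zero D y x"
  "Scale (op_cat D) x y = Scale D y x"
  by (simp_all add: op_cat_def)

lemma is_mono_op [simp]: "is_mono (op_cat D) x y = is_epi D y x"
  and is_epi_op [simp]: "is_epi (op_cat D) x y = is_mono D y x"
  and is_iso_op [simp]: "is_iso (op_cat D) x y = is_iso D y x"
  and is_kernel_op [simp]: "is_kernel (op_cat D) x y = is_cokernel D y x"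
  and is_cokernel_op [simp]: "is_cokernel (op_cat D) x y = is_kernel D y x"
  and is_biproduct_op [simp]:
    "is_biproduct (op_cat D) a b s i1 i2 p1 p2 = is_biproduct D a b s p1 p2 i1 i2"
  and is_zero_object_op [simp]: "is_zero_object (op_cat D) = is_zero_object D"
  by (auto simp: fun_eq_iff is_mono_def is_epi_def is_iso_def is_kernel_def is_cokernel_def is_biproduct_def
      is_zero_object_def)

lemma (in linear_category) linear_category_op: "linear_category (op_cat D)"
  by unfold_locales
    (simp_all add: Cmp_assoc Add_assoc Add_commute Add_inverse Scale_one Scale_mult Scale_add_left
      Scale_add_right bilinear Add_left_commute)

lemma (in abelian_category) abelian_category_op: "abelian_category (op_cat D)"
proof -
  interpret op: linear_category "op_cat D"
    by (rule linear_category_op)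
  show ?thesis
  proof unfold_locales
    fix a b assume "a \<in> Ob (op_cat D)" "b \<in> Ob (op_cat D)"
    then show "\<exists>s i1 i2 p1 p2. is_biproduct (op_cat D) a b s i1 i2 p1 p2"
      using biproducts [of a b] by simp blast
  qed (use zero_object kernels cokernels mono_is_kernel epi_is_cokernel in auto)
qed

section \<open>Epimorphisms and cokernels by duality\<close>

context linear_category
begin

interpretation op: linear_category "op_cat D"
  by (rule linear_category_op)

lemma is_epiI:
  assumes "x \<in> Ob D" "y \<in> Ob D" "f \<in> Hom D x y"
    and "\<And>z g. \<lbrakk>z \<in> Ob D; g \<in> Hom D y z; Cmp D x y z g f = Zero D x z\<rbrakk> \<Longrightarrow> g = Zero D y z"
  shows "is_epi D x y f"
  by (rule op.is_monoI [unfolded op_cat_simps is_mono_op]) (use assms in blast)+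

lemma is_epi_ZeroD:
  assumes "is_epi D x y f" "z \<in> Ob D" "x \<in> Ob D" "y \<in> Ob D" "g \<in> Hom D y z"
    and "Cmp D x y z g f = Zero D x z"
  shows "g = Zero D y z"
  using op.is_mono_ZeroD [of y x f z g] assms by simp

lemma is_cokernel_epi: "\<lbrakk>is_cokernel D x y f w c; x \<in> Ob D; y \<in> Ob D; f \<in> Hom D x y\<rbrakk> \<Longrightarrow> is_epi D y w c"
  using op.is_kernel_mono [of y x f w c] by simp

lemma is_cokernel_desc:
  assumes "is_cokernel D x y f w c" "v \<in> Ob D" "g \<in> Hom D y v" "Cmp D x y v g f = Zero D x v"
  obtains u where "u \<in> Hom D w v" "Cmp D y w v u c = g"
  by (rule op.is_kernel_lift [of y x f w c v g]) (use assms that in auto)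

end

section \<open>Abelian categories\<close>

context abelian_category
begin

text \<open>\<open>f\<close> is the kernel of some \<open>g\<close>, and \<open>g = 0\<close>
  because \<open>f\<close> is epic. Hence the identity of \<open>y\<close> factors through
  \<open>f\<close>, and this one-sided inverse is two-sided because \<open>f\<close> is
  monic.\<close>

lemma mono_epi_iso:
  assumes "x \<in> Ob D" "y \<in> Ob D" "is_mono D x y f" "is_epi D x y f"
  shows "is_iso D x y f"
proof -
  have f: "f \<in> Hom D x y"
    using assms by (simp add: is_mono_def)
  obtain z g where z: "z \<in> Ob D" "g \<in> Hom D y z" and ker: "is_kernel D y z g x f"
    using mono_is_kernel assms(1-3) by blast
  have "g = Zero D y z"
    using is_epi_ZeroD [OF assms(4) z(1) assms(1,2) z(2)] ker by (simp add: is_kernel_def)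
  then obtain u where u: "u \<in> Hom D y x" "Cmp D y x y f u = Idn D y"
    using is_kernel_lift [OF ker, of y "Idn D y"] assms z by auto
  have "Cmp D x y x u f = Idn D x"
    by (rule is_monoD [OF assms(3,1)]) (use assms f u in \<open>simp_all add: Cmp_assoc\<close>)
  then show ?thesis
    using f u by (auto simp: is_iso_def)
qed

text \<open>\<open>f\<close> is the kernel of some \<open>g\<close>, and \<open>g\<close> factors
  through the cokernel \<open>c\<close>. Whatever \<open>c\<close> sends to zero is thus sent to
  zero by \<open>g\<close> and so factors through \<open>f\<close>.\<close>

lemma mono_kernel_of_cokernel:
  assumes "x \<in> Ob D" "y \<in> Ob D" "is_mono D x y f" "is_cokernel D x y f w c"
  shows "is_kernel D y w c x f"
proof -
  have f: "f \<in> Hom D x y"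
    using assms by (simp add: is_mono_def)
  have c: "w \<in> Ob D" "c \<in> Hom D y w" "Cmp D x y w c f = Zero D x w"
    using assms(4) by (auto simp: is_cokernel_def)
  obtain z g where z: "z \<in> Ob D" "g \<in> Hom D y z" and ker: "is_kernel D y z g x f"
    using mono_is_kernel assms(1-3) by blast
  obtain t where t: "t \<in> Hom D w z" "Cmp D y w z t c = g"
    using is_cokernel_desc [OF assms(4) z] ker by (auto simp: is_kernel_def)
  show ?thesis
  proof (rule is_kernelI)
    fix v h assume h: "v \<in> Ob D" "h \<in> Hom D v y" "Cmp D v y w c h = Zero D v w"
    have "Cmp D v y z g h = Cmp D v w z t (Cmp D v y w c h)"
      using t c z h(1,2) assms by (simp add: Cmp_assoc)
    also have "\<dots> = Zero D v z"
      using t c z h by simp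
    finally show "\<exists>u\<in>Hom D v x. Cmp D v x y f u = h"
      using is_kernel_lift [OF ker] h by metis
  qed (use assms f c in auto)
qed

end

context abelian_category
begin

interpretation op: abelian_category "op_cat D"
  by (rule abelian_category_op)

lemma epi_cokernel_of_kernel:
  assumes "x \<in> Ob D" "y \<in> Ob D" "is_epi D x y f" "is_kernel D x y f w k"
  shows "is_cokernel D w x k y f"
  using op.mono_kernel_of_cokernel [of y x f w k] assms by simp

end

subsection \<open>Morphisms of extensions\<close>

lemma short_exact_op [simp]: "short_exact (op_cat D) a e b p i = short_exact D b e a i p"
  by (auto simp: short_exact_def)

text \<open>Reversal exchanges the sub and the quotient as well as the source and the target, so a
  pullback of extensions in the opposite category is a pushout here.\<close>

lemma ext_mor_op:
  "ext_mor (op_cat D) b' a' b a \<beta> \<alpha> (e', p', i') (e, p, i) = ext_mor D a b a' b' \<alpha> \<beta> (e, i, p) (e', i', p')"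
  by (auto simp: ext_mor_def)

context linear_category
begin

lemma short_exactD:
  assumes "short_exact D b e a i p"
  shows "b \<in> Ob D" "e \<in> Ob D" "a \<in> Ob D" "i \<in> Hom D b e" "p \<in> Hom D e a"
    "Cmp D b e a p i = Zero D b a" "is_kernel D e a p b i" "is_cokernel D b e i a p"
    "is_mono D b e i" "is_epi D e a p"
    "\<lbrakk>v \<in> Ob D; f \<in> Hom D v b\<rbrakk> \<Longrightarrow> Cmp D v e a p (Cmp D v b e i f) = Zero D v a"
proof -
  note s = assms [unfolded short_exact_def]
  show "b \<in> Ob D" "e \<in> Ob D" "a \<in> Ob D" "i \<in> Hom D b e" "p \<in> Hom D e a"
    "is_kernel D e a p b i" "is_cokernel D b e i a p"
    using s by auto
  then show *: "Cmp D b e a p i = Zero D b a"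
    by (simp add: is_kernel_def)
  show "is_mono D b e i" "is_epi D e a p"
    using s is_kernel_mono is_cokernel_epi by blast+
  show "Cmp D v e a p (Cmp D v b e i f) = Zero D v a" if "v \<in> Ob D" "f \<in> Hom D v b"
    using Cmp_assoc_eq [OF *] s that by simp
qed

lemma ext_mor_Idn: "\<xi> \<in> extensions D a b \<Longrightarrow> ext_mor D a b a b (Idn D a) (Idn D b) \<xi> \<xi>"
  by (fastforce simp: extensions_def ext_mor_def short_exact_def intro: bexI [of _ "Idn D (fst \<xi>)"])

lemma ext_mor_comp:
  assumes "\<xi> \<in> extensions D a b" "\<xi>' \<in> extensions D a' b'" "\<xi>'' \<in> extensions D a'' b''"
    and "ext_mor D a b a' b' \<alpha> \<beta> \<xi> \<xi>'" "ext_mor D a' b' a'' b'' \<alpha>' \<beta>' \<xi>' \<xi>''"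
    and "\<alpha> \<in> Hom D a a'" "\<beta> \<in> Hom D b b'" "\<alpha>' \<in> Hom D a' a''" "\<beta>' \<in> Hom D b' b''"
  shows "ext_mor D a b a'' b'' (Cmp D a a' a'' \<alpha>' \<alpha>) (Cmp D b b' b'' \<beta>' \<beta>) \<xi> \<xi>''"
proof -
  obtain e i p e' i' p' e'' i'' p'' where \<xi>: "\<xi> = (e, i, p)" "\<xi>' = (e', i', p')" "\<xi>'' = (e'', i'', p'')"
    by (metis prod_cases3)
  have se: "short_exact D b e a i p" "short_exact D b' e' a' i' p'" "short_exact D b'' e'' a'' i'' p''"
    using assms(1-3) by (auto simp: extensions_def \<xi>)
  note * = short_exactD(1-5) [OF se(1)] short_exactD(1-5) [OF se(2)] short_exactD(1-5) [OF se(3)] assms(6-)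
  obtain h where h: "h \<in> Hom D e e'" "Cmp D b e e' h i = Cmp D b b' e' i' \<beta>"
      "Cmp D e e' a' p' h = Cmp D e a a' \<alpha> p"
    using assms(4) by (auto simp: ext_mor_def \<xi>)
  obtain h' where h': "h' \<in> Hom D e' e''" "Cmp D b' e' e'' h' i' = Cmp D b' b'' e'' i'' \<beta>'"
      "Cmp D e' e'' a'' p'' h' = Cmp D e' a' a'' \<alpha>' p'"
    using assms(5) by (auto simp: ext_mor_def \<xi>)
  have "Cmp D b e e'' (Cmp D e e' e'' h' h) i = Cmp D b b'' e'' i'' (Cmp D b b' b'' \<beta>' \<beta>)"
    using * h(1) h'(1) Cmp_assoc_eq [OF h'(2)] by (simp add: Cmp_assoc_right h)
  moreover have "Cmp D e e'' a'' p'' (Cmp D e e' e'' h' h) = Cmp D e a a'' (Cmp D a a' a'' \<alpha>' \<alpha>) p"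
    using * h(1) h'(1) Cmp_assoc_eq [OF h'(3)] by (simp add: Cmp_assoc_right h)
  moreover have "Cmp D e e' e'' h' h \<in> Hom D e e''"
    using * h(1) h'(1) by simp
  ultimately show ?thesis
    unfolding ext_mor_def \<xi> by auto
qed

end

section \<open>The short five lemma and pullbacks of extensions\<close>

context abelian_category
begin

text \<open>If \<open>h g = 0\<close>, then \<open>p g = p' h g = 0\<close>, so
  \<open>g = i u\<close>; now \<open>i' u = h g = 0\<close> forces \<open>u = 0\<close>. The dual
  chase shows that \<open>h\<close> is epic, and monic epimorphisms are invertible.\<close>

lemma short_five:
  assumes se: "short_exact D b e a i p" "short_exact D b e' a i' p'"
    and h: "h \<in> Hom D e e'" "Cmp D b e e' h i = i'" "Cmp D e e' a p' h = p"
  shows "is_iso D e e' h"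
proof -
  note * = short_exactD(1-5) [OF se(1)] short_exactD(1-5) [OF se(2)]
  have "is_mono D e e' h"
  proof (rule is_monoI)
    fix w g assume g: "w \<in> Ob D" "g \<in> Hom D w e" "Cmp D w e e' h g = Zero D w e'"
    have "Cmp D w e a p g = Cmp D w e' a p' (Cmp D w e e' h g)"
      using * h(1) g(1,2) Cmp_assoc_eq [OF h(3)] by simp
    then have "Cmp D w e a p g = Zero D w a"
      using g * by simp
    then obtain u where u: "u \<in> Hom D w b" "Cmp D w b e i u = g"
      using is_kernel_lift [OF short_exactD(7) [OF se(1)]] g by metis
    have "Cmp D w b e' i' u = Cmp D w e e' h g"
      using * h(1) g(1) u Cmp_assoc_eq [OF h(2)] by metis
    then have "u = Zero D w b"
      using is_mono_ZeroD [OF short_exactD(9) [OF se(2)]] * g u by simp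
    then show "g = Zero D w e"
      using u * g by auto
  qed (use * h in auto)
  moreover have "is_epi D e e' h"
  proof (rule is_epiI)
    fix z g assume g: "z \<in> Ob D" "g \<in> Hom D e' z" "Cmp D e e' z g h = Zero D e z"
    have "Cmp D b e' z g i' = Cmp D b e z (Cmp D e e' z g h) i"
      using * h(1) g(1,2) h(2) by (simp add: Cmp_assoc_right)
    then have "Cmp D b e' z g i' = Zero D b z"
      using g * by simp
    then obtain u where u: "u \<in> Hom D a z" "Cmp D e' a z u p' = g"
      using is_cokernel_desc [OF short_exactD(8) [OF se(2)]] g by metis
    have "Cmp D e a z u p = Cmp D e e' z g h"
      using * h g(1) u(1) by (simp add: u(2) [symmetric] Cmp_assoc_right)
    then have "u = Zero D a z"
      using is_epi_ZeroD [OF short_exactD(10) [OF se(1)]] * g u by simp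
    then show "g = Zero D e' z"
      using u * g by auto
  qed (use * h in auto)
  ultimately show ?thesis
    using mono_epi_iso * by blast
qed

text \<open>The middle component is invertible by the short five lemma. This is why
  \<open>ext_equiv\<close>, although defined by the existence of a morphism in one direction, is
  symmetric.\<close>

lemma ext_mor_sym:
  assumes "\<xi> \<in> extensions D a b" "\<xi>' \<in> extensions D a b"
    and "ext_mor D a b a b (Idn D a) (Idn D b) \<xi> \<xi>'"
  shows "ext_mor D a b a b (Idn D a) (Idn D b) \<xi>' \<xi>"
proof -
  obtain e i p e' i' p' where \<xi>: "\<xi> = (e, i, p)" "\<xi>' = (e', i', p')"
    by (metis prod_cases3)
  have se: "short_exact D b e a i p" "short_exact D b e' a i' p'"
    using assms(1,2) by (auto simp: extensions_def \<xi>)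
  note * = short_exactD(1-5) [OF se(1)] short_exactD(1-5) [OF se(2)]
  obtain h where h: "h \<in> Hom D e e'" "Cmp D b e e' h i = i'" "Cmp D e e' a p' h = p"
    using assms(3) * by (auto simp: ext_mor_def \<xi>)
  then obtain g where g: "g \<in> Hom D e' e" "Cmp D e e' e g h = Idn D e" "Cmp D e' e e' h g = Idn D e'"
    using is_isoE [OF short_five [OF se]] by metis
  have "Cmp D b e' e g i' = Cmp D b e e (Cmp D e e' e g h) i"
    using * h(1) g(1) by (simp add: h(2) [symmetric] Cmp_assoc)
  moreover have "Cmp D e' e a p g = Cmp D e' e' a p' (Cmp D e' e e' h g)"
    using * h(1) g(1) by (simp add: h(3) [symmetric] Cmp_assoc)
  ultimately show ?thesis
    using * g by (auto simp: ext_mor_def \<xi>)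
qed

lemma equiv_ext_equiv: "equiv (extensions D a b) (ext_equiv D a b)"
proof (rule equivI)
  show "ext_equiv D a b \<subseteq> extensions D a b \<times> extensions D a b"
    by (auto simp: ext_equiv_def)
  show "refl_on (extensions D a b) (ext_equiv D a b)"
    using ext_mor_Idn by (auto simp: ext_equiv_def refl_on_def)
  show "sym (ext_equiv D a b)"
    using ext_mor_sym by (auto simp: ext_equiv_def sym_def)
  show "trans (ext_equiv D a b)"
  proof (rule transI)
    fix \<xi> \<xi>' \<xi>''
    assume *: "(\<xi>, \<xi>') \<in> ext_equiv D a b" "(\<xi>', \<xi>'') \<in> ext_equiv D a b"
    then have "a \<in> Ob D" "b \<in> Ob D"
      by (auto simp: ext_equiv_def extensions_def short_exact_def)
    then show "(\<xi>, \<xi>'') \<in> ext_equiv D a b"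
      using * ext_mor_comp [of \<xi> a b \<xi>' a b \<xi>'' a b "Idn D a" "Idn D b" "Idn D a" "Idn D b"]
      by (simp add: ext_equiv_def)
  qed
qed

text \<open>The pullback of \<open>p\<close> and \<alpha> is realised as the kernel of
  \<open>q = p r1 - \<alpha> r2\<close> on the biproduct of \<open>e\<close> and \<open>a'\<close>.
  The last conclusion is its universal property, phrased for whole morphisms of extensions: a right
  component that factors through \<alpha> lets the morphism factor through the pulled back
  extension.\<close>

lemma pullback_extension:
  assumes "\<zeta> \<in> extensions D a b" "a' \<in> Ob D" "\<alpha> \<in> Hom D a' a"
  obtains \<zeta>' where "\<zeta>' \<in> extensions D a' b" "ext_mor D a' b a b \<alpha> (Idn D b) \<zeta>' \<zeta>"
    and "\<And>a0 b0 \<gamma> \<beta> \<eta>. \<lbrakk>\<eta> \<in> extensions D a0 b0; \<gamma> \<in> Hom D a0 a'; \<beta> \<in> Hom D b0 b;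
        ext_mor D a0 b0 a b (Cmp D a0 a' a \<alpha> \<gamma>) \<beta> \<eta> \<zeta>\<rbrakk> \<Longrightarrow> ext_mor D a0 b0 a' b \<gamma> \<beta> \<eta> \<zeta>'"
proof -
  obtain e i p where \<zeta>: "\<zeta> = (e, i, p)"
    by (metis prod_cases3)
  have se: "short_exact D b e a i p"
    using assms(1) by (simp add: extensions_def \<zeta>)
  note [simp] = short_exactD(1-6,11) [OF se] assms(2,3)
  obtain s l1 l2 r1 r2 where bip: "is_biproduct D e a' s l1 l2 r1 r2"
    using biproducts by (metis \<open>e \<in> Ob D\<close> \<open>a' \<in> Ob D\<close>)
  note [simp] = biproduct_simps [OF bip \<open>e \<in> Ob D\<close> \<open>a' \<in> Ob D\<close>]
  define q where "q = Add D s a (Cmp D s e a p r1) (Scale D s a (- 1) (Cmp D s a' a \<alpha> r2))"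
  have [simp]: "q \<in> Hom D s a"
    by (simp add: q_def)
  have q: "Cmp D v s a q t = Add D v a (Cmp D v e a p (Cmp D v s e r1 t))
      (Scale D v a (- 1) (Cmp D v a' a \<alpha> (Cmp D v s a' r2 t)))" if "v \<in> Ob D" "t \<in> Hom D v s" for v t
    using that by (simp add: q_def bilinear Cmp_assoc_right)
  obtain e' k where ker: "is_kernel D s a q e' k"
    using kernels by (metis \<open>q \<in> Hom D s a\<close> \<open>s \<in> Ob D\<close> \<open>a \<in> Ob D\<close>)
  then have [simp]: "e' \<in> Ob D" "k \<in> Hom D e' s" and qk: "Cmp D e' s a q k = Zero D e' a"
    by (auto simp: is_kernel_def)
  have mono_k: "is_mono D e' s k"
    using is_kernel_mono [OF ker] by simp
  define h where "h = Cmp D e' s e r1 k"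
  define p' where "p' = Cmp D e' s a' r2 k"
  have [simp]: "h \<in> Hom D e' e" "p' \<in> Hom D e' a'"
    by (simp_all add: h_def p'_def)
  have square: "Cmp D e' e a p h = Cmp D e' a' a \<alpha> p'"
    by (rule diff_eq_ZeroD) (use qk in \<open>simp_all add: q h_def p'_def\<close>)
  have square': "Cmp D v e a p (Cmp D v e' e h t) = Cmp D v a' a \<alpha> (Cmp D v e' a' p' t)"
    if "v \<in> Ob D" "t \<in> Hom D v e'" for v t
    using Cmp_assoc_eq [OF square] that by (simp add: Cmp_assoc_right)
  \<comment> \<open>A compatible pair is assembled into one morphism to the biproduct; compatibility
    says exactly that \<open>q\<close> sends it to zero.\<close>
  have univ: "\<exists>t\<in>Hom D v e'. Cmp D v e' e h t = f \<and> Cmp D v e' a' p' t = g"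
    if v: "v \<in> Ob D" "f \<in> Hom D v e" "g \<in> Hom D v a'" and eq: "Cmp D v e a p f = Cmp D v a' a \<alpha> g" for v f g
  proof -
    let ?m = "Add D v s (Cmp D v e s l1 f) (Cmp D v a' s l2 g)"
    have "Cmp D v s a q ?m = Zero D v a"
      using v by (simp add: q bilinear eq)
    then obtain t where "t \<in> Hom D v e'" "Cmp D v e' s k t = ?m"
      using is_kernel_lift [OF ker, of v ?m] v by auto
    then show ?thesis
      using v by (intro bexI [of _ t]) (simp_all add: h_def p'_def Cmp_assoc_right bilinear)
  qed
  have uniq: "t = t'" if "v \<in> Ob D" "t \<in> Hom D v e'" "t' \<in> Hom D v e'"
    "Cmp D v e' e h t = Cmp D v e' e h t'" "Cmp D v e' a' p' t = Cmp D v e' a' p' t'" for v t t'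
  proof (rule is_monoD [OF mono_k])
    show "Cmp D v e' s k t = Cmp D v e' s k t'"
      by (rule biproduct_jointly_mono [OF bip]) (use that in \<open>simp_all add: h_def p'_def Cmp_assoc_right\<close>)
  qed (use that in auto)
  \<comment> \<open>The pair \<open>(i, 0)\<close> is compatible because \<open>p i = 0\<close>; it
    induces the inclusion of \<open>b\<close> into the pullback.\<close>
  obtain i' where i'[simp]: "i' \<in> Hom D b e'" "Cmp D b e' e h i' = i" "Cmp D b e' a' p' i' = Zero D b a'"
    using univ [of b i "Zero D b a'"] by auto
  note [simp] = Cmp_assoc_eq [OF i'(2)] Cmp_assoc_eq [OF i'(3)]
  have ker_p': "is_kernel D e' a' p' b i'"
  proof (rule is_kernelI)
    show "is_mono D b e' i'"
    proof (rule is_monoI)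
      fix v g assume g: "v \<in> Ob D" "g \<in> Hom D v b" "Cmp D v b e' i' g = Zero D v e'"
      have "Cmp D v b e i g = Cmp D v e' e h (Cmp D v b e' i' g)"
        using g(1,2) by simp
      then show "g = Zero D v b"
        using g is_mono_ZeroD [OF short_exactD(9) [OF se]] by simp
    qed simp_all
    fix v g assume g: "v \<in> Ob D" "g \<in> Hom D v e'" "Cmp D v e' a' p' g = Zero D v a'"
    then have "Cmp D v e a p (Cmp D v e' e h g) = Zero D v a"
      by (simp add: square')
    then obtain u where u: "u \<in> Hom D v b" "Cmp D v b e i u = Cmp D v e' e h g"
      using is_kernel_lift [OF short_exactD(7) [OF se], of v "Cmp D v e' e h g"] g by auto
    have "Cmp D v b e' i' u = g"
      by (rule uniq [OF g(1)]) (use g u in simp_all)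
    then show "\<exists>u\<in>Hom D v b. Cmp D v b e' i' u = g"
      using u by blast
  qed simp_all
  \<comment> \<open>On the first summand \<open>q\<close> restricts to \<open>p\<close>, which is
    epic. Hence \<open>q\<close> is the cokernel of its kernel \<open>k\<close>.\<close>
  have "is_epi D s a q"
  proof (rule is_epiI)
    fix z g assume g: "z \<in> Ob D" "g \<in> Hom D a z" "Cmp D s a z g q = Zero D s z"
    have "Cmp D e a z g p = Cmp D e s z (Cmp D s a z g q) l1"
      using g(1,2) by (simp add: Cmp_assoc_right q)
    then show "g = Zero D a z"
      using g is_epi_ZeroD [OF short_exactD(10) [OF se]] by simp
  qed simp_all
  then have coker: "is_cokernel D e' s k a q"
    using epi_cokernel_of_kernel ker by simp
  \<comment> \<open>Stability of epimorphisms under pullback: if \<open>g p' = 0\<close>, then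
    \<open>g r2\<close> vanishes on \<open>k\<close> and so equals some \<open>u q\<close>.
    Restricting along \<open>l1\<close> gives \<open>u p = 0\<close>, hence \<open>u = 0\<close>;
    restricting along \<open>l2\<close> then gives \<open>g = 0\<close>.\<close>
  have "is_epi D e' a' p'"
  proof (rule is_epiI)
    fix z g assume g: "z \<in> Ob D" "g \<in> Hom D a' z" "Cmp D e' a' z g p' = Zero D e' z"
    then have "Cmp D e' s z (Cmp D s a' z g r2) k = Zero D e' z"
      by (simp add: p'_def Cmp_assoc_right)
    then obtain u where u: "u \<in> Hom D a z" "Cmp D s a z u q = Cmp D s a' z g r2"
      using is_cokernel_desc [OF coker, of z "Cmp D s a' z g r2"] g by auto
    have "Cmp D e a z u p = Cmp D e s z (Cmp D s a z u q) l1"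
      using g(1,2) u(1) by (simp add: Cmp_assoc_right q)
    also have "\<dots> = Zero D e z"
      using g(1,2) u by (simp add: Cmp_assoc_right)
    finally have "u = Zero D a z"
      using g u is_epi_ZeroD [OF short_exactD(10) [OF se]] by simp
    then have "Cmp D a' s z (Cmp D s a' z g r2) l2 = Zero D a' z"
      using u g by (simp flip: u(2))
    then show "g = Zero D a' z"
      using g by (simp add: Cmp_assoc_right)
  qed simp_all
  then have se': "short_exact D b e' a' i' p'"
    using epi_cokernel_of_kernel [OF _ _ _ ker_p'] ker_p' by (simp add: short_exact_def)
  show ?thesis
  proof (rule that)
    show "(e', i', p') \<in> extensions D a' b"
      using se' by (simp add: extensions_def)
    show "ext_mor D a' b a b \<alpha> (Idn D b) (e', i', p') \<zeta>"
      by (auto simp: ext_mor_def \<zeta> square intro!: bexI [of _ h])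
    fix a0 b0 \<gamma> \<beta> \<eta>
    assume "\<eta> \<in> extensions D a0 b0" and \<gamma>: "\<gamma> \<in> Hom D a0 a'" "\<beta> \<in> Hom D b0 b"
      and mor: "ext_mor D a0 b0 a b (Cmp D a0 a' a \<alpha> \<gamma>) \<beta> \<eta> \<zeta>"
    then obtain e0 i0 p0 where \<eta>: "\<eta> = (e0, i0, p0)" and se0: "short_exact D b0 e0 a0 i0 p0"
      by (auto simp: extensions_def)
    note [simp] = short_exactD(1-6,11) [OF se0] \<gamma>
    obtain h0 where h0 [simp]: "h0 \<in> Hom D e0 e" "Cmp D b0 e0 e h0 i0 = Cmp D b0 b e i \<beta>"
      and "Cmp D e0 e a p h0 = Cmp D e0 a0 a (Cmp D a0 a' a \<alpha> \<gamma>) p0"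
      using mor by (auto simp: ext_mor_def \<eta> \<zeta>)
    then obtain t where t: "t \<in> Hom D e0 e'" "Cmp D e0 e' e h t = h0"
        "Cmp D e0 e' a' p' t = Cmp D e0 a0 a' \<gamma> p0"
      using univ [of e0 h0 "Cmp D e0 a0 a' \<gamma> p0"] by (auto simp: Cmp_assoc_right)
    have "Cmp D b0 e0 e' t i0 = Cmp D b0 b e' i' \<beta>"
      by (rule uniq [of b0]) (simp_all add: t Cmp_assoc_eq [OF t(2)] Cmp_assoc_eq [OF t(3)] Cmp_assoc_right)
    then show "ext_mor D a0 b0 a' b \<gamma> \<beta> \<eta> (e', i', p')"
      using t by (auto simp: ext_mor_def \<eta>)
  qed
qed

lemma extensions_Ob: "\<xi> \<in> extensions D a b \<Longrightarrow> a \<in> Ob D \<and> b \<in> Ob D"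
  by (auto simp: extensions_def short_exact_def)

text \<open>By the short five lemma every extension over \<open>(\<alpha>, id)\<close> is isomorphic to the pullback, so it has its
  universal property.\<close>

lemma ext_mor_lift:
  assumes \<eta>': "\<eta>' \<in> extensions D a' b" and \<zeta>: "\<zeta> \<in> extensions D a b" and \<alpha>: "\<alpha> \<in> Hom D a' a"
    and mor: "ext_mor D a' b a b \<alpha> (Idn D b) \<eta>' \<zeta>"
    and \<eta>: "\<eta> \<in> extensions D a0 b0" and \<gamma>: "\<gamma> \<in> Hom D a0 a'" and \<beta>: "\<beta> \<in> Hom D b0 b"
    and mor0: "ext_mor D a0 b0 a b (Cmp D a0 a' a \<alpha> \<gamma>) \<beta> \<eta> \<zeta>"
  shows "ext_mor D a0 b0 a' b \<gamma> \<beta> \<eta> \<eta>'"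
proof -
  note [simp] = extensions_Ob [OF \<eta>'] extensions_Ob [OF \<eta>] extensions_Ob [OF \<zeta>]
  obtain \<zeta>' where \<zeta>': "\<zeta>' \<in> extensions D a' b"
    and univ: "\<And>a0 b0 \<gamma> \<beta> \<eta>. \<lbrakk>\<eta> \<in> extensions D a0 b0; \<gamma> \<in> Hom D a0 a'; \<beta> \<in> Hom D b0 b;
        ext_mor D a0 b0 a b (Cmp D a0 a' a \<alpha> \<gamma>) \<beta> \<eta> \<zeta>\<rbrakk> \<Longrightarrow> ext_mor D a0 b0 a' b \<gamma> \<beta> \<eta> \<zeta>'"
    using pullback_extension [OF \<zeta> _ \<alpha>] extensions_Ob [OF \<eta>'] by metis
  have "ext_mor D a' b a' b (Idn D a') (Idn D b) \<eta>' \<zeta>'"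
    using univ [OF \<eta>', of "Idn D a'" "Idn D b"] mor \<alpha> by simp
  then have "ext_mor D a' b a' b (Idn D a') (Idn D b) \<zeta>' \<eta>'"
    using ext_mor_sym \<eta>' \<zeta>' by blast
  from ext_mor_comp [OF \<eta> \<zeta>' \<eta>' univ [OF \<eta> \<gamma> \<beta> mor0] this \<gamma> \<beta>] \<gamma> \<beta>
  show ?thesis
    by simp
qed

end

lemma extensions_op: "(e, p, i) \<in> extensions (op_cat D) b a \<longleftrightarrow> (e, i, p) \<in> extensions D a b"
  by (simp add: extensions_def)

section \<open>Pushouts of extensions by duality\<close>

context abelian_category
begin

interpretation op: abelian_category "op_cat D"
  by (rule abelian_category_op)

lemma pushout_extension:
  assumes "\<zeta> \<in> extensions D a b" "b' \<in> Ob D" "\<beta> \<in> Hom D b b'"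
  obtains \<zeta>' where "\<zeta>' \<in> extensions D a b'" "ext_mor D a b a b' (Idn D a) \<beta> \<zeta> \<zeta>'"
proof -
  obtain e i p where \<zeta>: "\<zeta> = (e, i, p)"
    by (metis prod_cases3)
  obtain \<zeta>' where "\<zeta>' \<in> extensions (op_cat D) b' a" "ext_mor (op_cat D) b' a b a \<beta> (Idn D a) \<zeta>' (e, p, i)"
    using op.pullback_extension [of "(e, p, i)" b a b' \<beta>] assms unfolding \<zeta>
    by (metis extensions_op op_cat_simps(1,2,4))
  then show ?thesis
    using that by (cases \<zeta>') (auto simp: extensions_op \<zeta> ext_mor_op)
qed

text \<open>Dual of \<open>ext_mor_lift\<close>: every extension under \<open>(id, \<beta>)\<close>
  has the universal property of the pushout.\<close>

lemma ext_mor_desc: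
  assumes "\<eta>' \<in> extensions D a b'" "\<zeta> \<in> extensions D a b" "\<beta> \<in> Hom D b b'"
    and "ext_mor D a b a b' (Idn D a) \<beta> \<zeta> \<eta>'"
    and "\<eta> \<in> extensions D a0 b0" "\<gamma> \<in> Hom D b' b0" "\<alpha> \<in> Hom D a a0"
    and "ext_mor D a b a0 b0 \<alpha> (Cmp D b b' b0 \<gamma> \<beta>) \<zeta> \<eta>"
  shows "ext_mor D a b' a0 b0 \<alpha> \<gamma> \<eta>' \<eta>"
proof -
  obtain e i p e' i' p' e0 i0 p0 where \<xi>: "\<zeta> = (e, i, p)" "\<eta>' = (e', i', p')" "\<eta> = (e0, i0, p0)"
    by (metis prod_cases3)
  show ?thesis
    using op.ext_mor_lift [of "(e', p', i')" b' a "(e, p, i)" b \<beta> "(e0, p0, i0)" b0 a0 \<gamma> \<alpha>] assms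
    by (simp add: extensions_op ext_mor_op \<xi>)
qed

end

subsection \<open>Operations on extension classes\<close>

context abelian_category
begin

text \<open>The operations on extension classes are defined as sets of all possible results. Such a
  set is a class as soon as it has one element \<xi> and membership in it means equivalence to
  \<xi>.\<close>

lemma Ext1_I:
  assumes "\<xi> \<in> W" "W \<subseteq> extensions D a b"
    and "\<And>\<xi>'. \<xi>' \<in> extensions D a b \<Longrightarrow> ext_mor D a b a b (Idn D a) (Idn D b) \<xi> \<xi>' \<longleftrightarrow> \<xi>' \<in> W"
  shows "W \<in> Ext1 D a b"
proof -
  have "W = ext_equiv D a b `` {\<xi>}"
    using assms by (auto simp: ext_equiv_def)
  then show ?thesis
    using assms by (auto simp: Ext1_def quotient_def)
qed

lemma Ext1_E:
  assumes "c \<in> Ext1 D a b"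
  obtains \<xi> where "\<xi> \<in> c" "c \<subseteq> extensions D a b"
    "\<And>\<xi> \<xi>'. \<lbrakk>\<xi> \<in> c; \<xi>' \<in> c\<rbrakk> \<Longrightarrow> ext_mor D a b a b (Idn D a) (Idn D b) \<xi> \<xi>'"
    "\<And>\<xi>'. \<lbrakk>\<xi>' \<in> extensions D a b; ext_mor D a b a b (Idn D a) (Idn D b) \<xi> \<xi>'\<rbrakk> \<Longrightarrow> \<xi>' \<in> c"
proof -
  obtain \<xi> where \<xi>: "\<xi> \<in> extensions D a b" "c = ext_equiv D a b `` {\<xi>}"
    using assms by (auto simp: Ext1_def elim: quotientE)
  show ?thesis
  proof (rule that)
    show "\<xi> \<in> c"
      using \<xi> ext_mor_Idn by (auto simp: ext_equiv_def)
    fix \<xi>1 \<xi>2 assume "\<xi>1 \<in> c" "\<xi>2 \<in> c"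
    then have "(\<xi>1, \<xi>2) \<in> ext_equiv D a b"
      using quotient_eq_iff [OF equiv_ext_equiv] assms unfolding Ext1_def by blast
    then show "ext_mor D a b a b (Idn D a) (Idn D b) \<xi>1 \<xi>2"
      by (simp add: ext_equiv_def)
  qed (use \<xi> in \<open>auto simp: ext_equiv_def\<close>)
qed

lemma Ext1_eqI:
  assumes "c \<in> Ext1 D a b" "d \<in> Ext1 D a b" "\<xi> \<in> c" "\<xi> \<in> d"
  shows "c = d"
  using quotient_disj [OF equiv_ext_equiv] assms unfolding Ext1_def by blast

lemma ext_class_in_Ext1:
  "\<xi> \<in> extensions D a b \<Longrightarrow> \<exists>c\<in>Ext1 D a b. \<xi> \<in> c"
  using equiv_class_self [OF equiv_ext_equiv] by (metis Ext1_def quotientI)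

text \<open>Existence comes from the constructed pullback. Two results over different
  representatives of \<open>c\<close> are compared by moving one over the representative of the
  other and lifting with \<open>ext_mor_lift\<close>.\<close>

lemma ext_pull_Ext1:
  assumes c: "c \<in> Ext1 D a b" and \<alpha>: "a' \<in> Ob D" "\<alpha> \<in> Hom D a' a"
  shows "ext_pull D a b a' \<alpha> c \<in> Ext1 D a' b"
proof -
  obtain \<xi> where \<xi>: "\<xi> \<in> c" and c_ext: "c \<subseteq> extensions D a b"
    and c_mor: "\<And>\<xi> \<xi>'. \<lbrakk>\<xi> \<in> c; \<xi>' \<in> c\<rbrakk> \<Longrightarrow> ext_mor D a b a b (Idn D a) (Idn D b) \<xi> \<xi>'"
    using Ext1_E [OF c] by metis
  then have \<xi>_ext: "\<xi> \<in> extensions D a b"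
    by blast
  note [simp] = extensions_Ob [OF \<xi>_ext] \<alpha>
  obtain \<zeta> where \<zeta>: "\<zeta> \<in> extensions D a' b" "ext_mor D a' b a b \<alpha> (Idn D b) \<zeta> \<xi>"
    using pullback_extension [OF \<xi>_ext \<alpha>] by metis
  show ?thesis
  proof (rule Ext1_I)
    show "\<zeta> \<in> ext_pull D a b a' \<alpha> c"
      using \<zeta> \<xi> by (auto simp: ext_pull_def)
    fix \<zeta>' assume \<zeta>': "\<zeta>' \<in> extensions D a' b"
    show "ext_mor D a' b a' b (Idn D a') (Idn D b) \<zeta> \<zeta>' \<longleftrightarrow> \<zeta>' \<in> ext_pull D a b a' \<alpha> c"
    proof
      assume "ext_mor D a' b a' b (Idn D a') (Idn D b) \<zeta> \<zeta>'"
      then have "ext_mor D a' b a' b (Idn D a') (Idn D b) \<zeta>' \<zeta>"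
        using ext_mor_sym \<zeta> \<zeta>' by blast
      from ext_mor_comp [OF \<zeta>' \<zeta>(1) \<xi>_ext this \<zeta>(2)] have "ext_mor D a' b a b \<alpha> (Idn D b) \<zeta>' \<xi>"
        by simp
      then show "\<zeta>' \<in> ext_pull D a b a' \<alpha> c"
        using \<zeta>' \<xi> by (auto simp: ext_pull_def)
    next
      assume "\<zeta>' \<in> ext_pull D a b a' \<alpha> c"
      then obtain \<xi>' where \<xi>': "\<xi>' \<in> c" "ext_mor D a' b a b \<alpha> (Idn D b) \<zeta>' \<xi>'"
        by (auto simp: ext_pull_def)
      then have \<xi>'_ext: "\<xi>' \<in> extensions D a b"
        using c_ext by blast
      have "ext_mor D a' b a b \<alpha> (Idn D b) \<zeta> \<xi>'"
        using ext_mor_comp [OF \<zeta>(1) \<xi>_ext \<xi>'_ext \<zeta>(2) c_mor [OF \<xi> \<xi>'(1)]] by simp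
      then show "ext_mor D a' b a' b (Idn D a') (Idn D b) \<zeta> \<zeta>'"
        by - (rule ext_mor_lift [OF \<zeta>' \<xi>'_ext _ \<xi>'(2) \<zeta>(1)]; simp)
    qed
  qed (auto simp: ext_pull_def)
qed

text \<open>As for pullbacks, with \<open>pushout_extension\<close> for existence and
  \<open>ext_mor_desc\<close> for the comparison.\<close>

lemma ext_push_Ext1:
  assumes c: "c \<in> Ext1 D a b" and \<beta>: "b' \<in> Ob D" "\<beta> \<in> Hom D b b'"
  shows "ext_push D a b b' \<beta> c \<in> Ext1 D a b'"
proof -
  obtain \<xi> where \<xi>: "\<xi> \<in> c" and c_ext: "c \<subseteq> extensions D a b"
    and c_mor: "\<And>\<xi> \<xi>'. \<lbrakk>\<xi> \<in> c; \<xi>' \<in> c\<rbrakk> \<Longrightarrow> ext_mor D a b a b (Idn D a) (Idn D b) \<xi> \<xi>'"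
    using Ext1_E [OF c] by metis
  then have \<xi>_ext: "\<xi> \<in> extensions D a b"
    by blast
  note [simp] = extensions_Ob [OF \<xi>_ext] \<beta>
  obtain \<zeta> where \<zeta>: "\<zeta> \<in> extensions D a b'" "ext_mor D a b a b' (Idn D a) \<beta> \<xi> \<zeta>"
    using pushout_extension [OF \<xi>_ext \<beta>] by metis
  show ?thesis
  proof (rule Ext1_I)
    show "\<zeta> \<in> ext_push D a b b' \<beta> c"
      using \<zeta> \<xi> by (auto simp: ext_push_def)
    fix \<zeta>' assume \<zeta>': "\<zeta>' \<in> extensions D a b'"
    show "ext_mor D a b' a b' (Idn D a) (Idn D b') \<zeta> \<zeta>' \<longleftrightarrow> \<zeta>' \<in> ext_push D a b b' \<beta> c"
    proof
      assume "ext_mor D a b' a b' (Idn D a) (Idn D b') \<zeta> \<zeta>'"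
      from ext_mor_comp [OF \<xi>_ext \<zeta>(1) \<zeta>' \<zeta>(2) this] have "ext_mor D a b a b' (Idn D a) \<beta> \<xi> \<zeta>'"
        by simp
      then show "\<zeta>' \<in> ext_push D a b b' \<beta> c"
        using \<zeta>' \<xi> by (auto simp: ext_push_def)
    next
      assume "\<zeta>' \<in> ext_push D a b b' \<beta> c"
      then obtain \<xi>' where \<xi>': "\<xi>' \<in> c" "ext_mor D a b a b' (Idn D a) \<beta> \<xi>' \<zeta>'"
        by (auto simp: ext_push_def)
      then have \<xi>'_ext: "\<xi>' \<in> extensions D a b"
        using c_ext by blast
      have "ext_mor D a b a b' (Idn D a) \<beta> \<xi> \<zeta>'"
        using ext_mor_comp [OF \<xi>_ext \<xi>'_ext \<zeta>' c_mor [OF \<xi> \<xi>'(1)] \<xi>'(2)] by simp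
      then show "ext_mor D a b' a b' (Idn D a) (Idn D b') \<zeta> \<zeta>'"
        by - (rule ext_mor_desc [OF \<zeta>(1) \<xi>_ext _ \<zeta>(2) \<zeta>']; simp)
    qed
  qed (auto simp: ext_push_def)
qed

lemma biproduct_short_exact:
  assumes "is_biproduct D b a s k j q r" "a \<in> Ob D" "b \<in> Ob D"
  shows "short_exact D b s a k r"
proof -
  note [simp] = biproduct_simps [OF assms(1,3,2)] assms(2,3)
  have k: "is_mono D b s k"
  proof (rule is_monoI)
    fix w g assume "w \<in> Ob D" "g \<in> Hom D w b" "Cmp D w b s k g = Zero D w s"
    then have "Cmp D w s b q (Cmp D w b s k g) = Cmp D w s b q (Zero D w s)"
      by simp
    then show "g = Zero D w b"
      using \<open>w \<in> Ob D\<close> \<open>g \<in> Hom D w b\<close> by simp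
  qed simp_all
  have r: "is_epi D s a r"
  proof (rule is_epiI)
    fix z g assume g: "z \<in> Ob D" "g \<in> Hom D a z" "Cmp D s a z g r = Zero D s z"
    then have "Cmp D a s z (Cmp D s a z g r) j = Zero D a z"
      by simp
    then show "g = Zero D a z"
      using g(1,2) by (simp add: Cmp_assoc_right)
  qed simp_all
  have ker: "is_kernel D s a r b k"
  proof (rule is_kernelI)
    fix v g assume g: "v \<in> Ob D" "g \<in> Hom D v s" "Cmp D v s a r g = Zero D v a"
    then have "Cmp D v b s k (Cmp D v s b q g) = g"
      using biproduct_decomp [OF assms(1,3,2) g(1,2)] by simp
    then show "\<exists>u\<in>Hom D v b. Cmp D v b s k u = g"
      using g by (intro bexI [of _ "Cmp D v s b q g"]) auto
  qed (simp_all add: k)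
  then show ?thesis
    using epi_cokernel_of_kernel r by (simp add: short_exact_def)
qed

text \<open>The biproduct extension represents the class. A morphism \<open>h\<close> from it to
  another extension gives the section \<open>h j\<close>; conversely, a section \<open>t\<close>
  gives the morphism \<open>i q + t r\<close>.\<close>

lemma ext_zero_Ext1:
  assumes "a \<in> Ob D" "b \<in> Ob D"
  shows "ext_zero D a b \<in> Ext1 D a b"
proof -
  obtain s k j q r where bip: "is_biproduct D b a s k j q r"
    using biproducts assms by metis
  note [simp] = biproduct_simps [OF bip assms(2,1)] assms
  show ?thesis
  proof (rule Ext1_I)
    show "(s, k, r) \<in> ext_zero D a b"
      using biproduct_short_exact [OF bip assms]
      by (auto simp: ext_zero_def extensions_def intro!: bexI [of _ j])
    fix \<xi>' assume "\<xi>' \<in> extensions D a b"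
    then obtain e i p where \<xi>': "\<xi>' = (e, i, p)" and se: "short_exact D b e a i p"
      by (auto simp: extensions_def)
    note [simp] = short_exactD(1-6,11) [OF se]
    show "ext_mor D a b a b (Idn D a) (Idn D b) (s, k, r) \<xi>' \<longleftrightarrow> \<xi>' \<in> ext_zero D a b"
    proof
      assume "ext_mor D a b a b (Idn D a) (Idn D b) (s, k, r) \<xi>'"
      then obtain h where h: "h \<in> Hom D s e" "Cmp D s e a p h = r"
        by (auto simp: ext_mor_def \<xi>')
      then have "Cmp D a e a p (Cmp D a s e h j) = Idn D a"
        using Cmp_assoc_eq [OF h(2)] by simp
      then show "\<xi>' \<in> ext_zero D a b"
        using se h by (auto simp: ext_zero_def \<xi>' extensions_def intro!: bexI [of _ "Cmp D a s e h j"])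
    next
      assume "\<xi>' \<in> ext_zero D a b"
      then obtain t where t: "t \<in> Hom D a e" "Cmp D a e a p t = Idn D a"
        by (auto simp: ext_zero_def \<xi>')
      let ?h = "Add D s e (Cmp D s b e i q) (Cmp D s a e t r)"
      have "Cmp D b s e ?h k = i" "Cmp D s e a p ?h = r"
        using t Cmp_assoc_eq [OF t(2)] by (simp_all add: bilinear Cmp_assoc_right)
      then show "ext_mor D a b a b (Idn D a) (Idn D b) (s, k, r) \<xi>'"
        using t by (auto simp: ext_mor_def \<xi>' intro!: bexI [of _ ?h])
    qed
  qed (auto simp: ext_zero_def)
qed

subsection \<open>The Baer sum\<close>

text \<open>Each property is tested after projecting to or restricting to one summand, where it is
  the corresponding property of one of the given sequences.\<close>

lemma dsum_short_exact:
  assumes se1: "short_exact D b1 e1 a1 i1 p1" and se2: "short_exact D b2 e2 a2 i2 p2"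
    and aa: "is_biproduct D a1 a2 aa j1 j2 s1 s2" and bb: "is_biproduct D b1 b2 bb k1 k2 q1 q2"
    and ee: "is_biproduct D e1 e2 ee l1 l2 r1 r2"
  shows "short_exact D bb ee aa
    (Add D bb ee (Cmp D bb e1 ee l1 (Cmp D bb b1 e1 i1 q1)) (Cmp D bb e2 ee l2 (Cmp D bb b2 e2 i2 q2)))
    (Add D ee aa (Cmp D ee a1 aa j1 (Cmp D ee e1 a1 p1 r1)) (Cmp D ee a2 aa j2 (Cmp D ee e2 a2 p2 r2)))"
    (is "short_exact D bb ee aa ?i ?p")
proof -
  note [simp] = short_exactD(1-6,11) [OF se1] short_exactD(1-6,11) [OF se2]
  note [simp] = biproduct_simps [OF aa] biproduct_simps [OF bb] biproduct_simps [OF ee]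
  note [simp] = bilinear Cmp_assoc_right
  have [simp]: "?i \<in> Hom D bb ee" "?p \<in> Hom D ee aa"
    by simp_all
  have mono: "is_mono D bb ee ?i"
  proof (rule is_monoI)
    fix w g assume g: "w \<in> Ob D" "g \<in> Hom D w bb" "Cmp D w bb ee ?i g = Zero D w ee"
    have "Cmp D w b1 e1 i1 (Cmp D w bb b1 q1 g) = Cmp D w ee e1 r1 (Cmp D w bb ee ?i g)"
      "Cmp D w b2 e2 i2 (Cmp D w bb b2 q2 g) = Cmp D w ee e2 r2 (Cmp D w bb ee ?i g)"
      using g(1,2) by simp_all
    then have "Cmp D w b1 e1 i1 (Cmp D w bb b1 q1 g) = Zero D w e1"
      "Cmp D w b2 e2 i2 (Cmp D w bb b2 q2 g) = Zero D w e2"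
      unfolding g(3) using g(1) by simp_all
    then have "Cmp D w bb b1 q1 g = Zero D w b1" "Cmp D w bb b2 q2 g = Zero D w b2"
      using g is_mono_ZeroD [OF short_exactD(9) [OF se1]] is_mono_ZeroD [OF short_exactD(9) [OF se2]]
      by simp_all
    then show "g = Zero D w bb"
      by - (rule biproduct_jointly_mono [OF bb _ _ g(1)], use g in simp_all)
  qed simp_all
  have ker: "is_kernel D ee aa ?p bb ?i"
  proof (rule is_kernelI)
    fix v g assume g: "v \<in> Ob D" "g \<in> Hom D v ee" "Cmp D v ee aa ?p g = Zero D v aa"
    have "Cmp D v e1 a1 p1 (Cmp D v ee e1 r1 g) = Cmp D v aa a1 s1 (Cmp D v ee aa ?p g)"
      "Cmp D v e2 a2 p2 (Cmp D v ee e2 r2 g) = Cmp D v aa a2 s2 (Cmp D v ee aa ?p g)"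
      using g(1,2) by simp_all
    then have z: "Cmp D v e1 a1 p1 (Cmp D v ee e1 r1 g) = Zero D v a1"
      "Cmp D v e2 a2 p2 (Cmp D v ee e2 r2 g) = Zero D v a2"
      unfolding g(3) using g(1) by simp_all
    have m: "Cmp D v ee e1 r1 g \<in> Hom D v e1" "Cmp D v ee e2 r2 g \<in> Hom D v e2"
      using g(1,2) by simp_all
    obtain u1 where u1: "u1 \<in> Hom D v b1" "Cmp D v b1 e1 i1 u1 = Cmp D v ee e1 r1 g"
      using is_kernel_lift [OF short_exactD(7) [OF se1] g(1) m(1) z(1)] by blast
    obtain u2 where u2: "u2 \<in> Hom D v b2" "Cmp D v b2 e2 i2 u2 = Cmp D v ee e2 r2 g"
      using is_kernel_lift [OF short_exactD(7) [OF se2] g(1) m(2) z(2)] by blast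
    note u = u1 u2
    show "\<exists>u\<in>Hom D v bb. Cmp D v bb ee ?i u = g"
    proof
      show "Cmp D v bb ee ?i (Add D v bb (Cmp D v b1 bb k1 u1) (Cmp D v b2 bb k2 u2)) = g"
        by (rule biproduct_jointly_mono [OF ee _ _ g(1)]) (use g u in simp_all)
    qed (use g u in simp_all)
  qed (simp_all add: mono)
  have "is_epi D ee aa ?p"
  proof (rule is_epiI)
    fix z g assume g: "z \<in> Ob D" "g \<in> Hom D aa z" "Cmp D ee aa z g ?p = Zero D ee z"
    have "Cmp D e1 a1 z (Cmp D a1 aa z g j1) p1 = Cmp D e1 ee z (Cmp D ee aa z g ?p) l1"
      "Cmp D e2 a2 z (Cmp D a2 aa z g j2) p2 = Cmp D e2 ee z (Cmp D ee aa z g ?p) l2"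
      using g(1,2) by simp_all
    then have "Cmp D e1 a1 z (Cmp D a1 aa z g j1) p1 = Zero D e1 z"
      "Cmp D e2 a2 z (Cmp D a2 aa z g j2) p2 = Zero D e2 z"
      unfolding g(3) using g(1) by simp_all
    then have *: "Cmp D a1 aa z g j1 = Zero D a1 z" "Cmp D a2 aa z g j2 = Zero D a2 z"
      using g is_epi_ZeroD [OF short_exactD(10) [OF se1], of z "Cmp D a1 aa z g j1"]
        is_epi_ZeroD [OF short_exactD(10) [OF se2], of z "Cmp D a2 aa z g j2"] by simp_all
    have "g = Cmp D aa aa z g (Add D aa aa (Cmp D aa a1 aa j1 s1) (Cmp D aa a2 aa j2 s2))"
      using aa g by (simp add: is_biproduct_def)
    also have "\<dots> = Zero D aa z"
      using g Cmp_assoc_eq [OF *(1), of s1 aa] Cmp_assoc_eq [OF *(2), of s2 aa] by simp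
    finally show "g = Zero D aa z" .
  qed simp_all
  then show ?thesis
    using epi_cokernel_of_kernel [OF _ _ _ ker] ker by (simp add: short_exact_def)
qed

text \<open>\<open>ext_sum\<close> allows any choice of representatives and of biproducts. The outer
  components here are the canonical comparison maps between two such choices of
  \<open>a \<oplus> a\<close> and of \<open>b \<oplus> b\<close>.\<close>

lemma dsum_ext_mor:
  assumes "short_exact D b e1 a i1 p1" "short_exact D b e2 a i2 p2"
    and "is_biproduct D a a aa j1 j2 s1 s2" "is_biproduct D b b bb k1 k2 q1 q2"
    and "is_biproduct D e1 e2 ee l1 l2 r1 r2"
    and "short_exact D b e1' a i1' p1'" "short_exact D b e2' a i2' p2'"
    and "is_biproduct D a a aa' j1' j2' s1' s2'" "is_biproduct D b b bb' k1' k2' q1' q2'"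
    and "is_biproduct D e1' e2' ee' l1' l2' r1' r2'"
    and "ext_mor D a b a b (Idn D a) (Idn D b) (e1, i1, p1) (e1', i1', p1')"
    and "ext_mor D a b a b (Idn D a) (Idn D b) (e2, i2, p2) (e2', i2', p2')"
  shows "ext_mor D aa bb aa' bb'
    (Add D aa aa' (Cmp D aa a aa' j1' s1) (Cmp D aa a aa' j2' s2))
    (Add D bb bb' (Cmp D bb b bb' k1' q1) (Cmp D bb b bb' k2' q2))
    (ee, Add D bb ee (Cmp D bb e1 ee l1 (Cmp D bb b e1 i1 q1)) (Cmp D bb e2 ee l2 (Cmp D bb b e2 i2 q2)),
      Add D ee aa (Cmp D ee a aa j1 (Cmp D ee e1 a p1 r1)) (Cmp D ee a aa j2 (Cmp D ee e2 a p2 r2)))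
    (ee', Add D bb' ee' (Cmp D bb' e1' ee' l1' (Cmp D bb' b e1' i1' q1'))
        (Cmp D bb' e2' ee' l2' (Cmp D bb' b e2' i2' q2')),
      Add D ee' aa' (Cmp D ee' a aa' j1' (Cmp D ee' e1' a p1' r1'))
        (Cmp D ee' a aa' j2' (Cmp D ee' e2' a p2' r2')))"
proof -
  note [simp] = short_exactD(1-6,11) [OF assms(1)] short_exactD(1-6,11) [OF assms(2)]
    short_exactD(1-6,11) [OF assms(6)] short_exactD(1-6,11) [OF assms(7)]
  note [simp] = biproduct_simps [OF assms(3)] biproduct_simps [OF assms(4)] biproduct_simps [OF assms(5)]
    biproduct_simps [OF assms(8)] biproduct_simps [OF assms(9)] biproduct_simps [OF assms(10)]
  note [simp] = bilinear Cmp_assoc_right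
  obtain h1 where h1: "h1 \<in> Hom D e1 e1'" "Cmp D b e1 e1' h1 i1 = i1'" "Cmp D e1 e1' a p1' h1 = p1"
    using assms(11) by (auto simp: ext_mor_def)
  obtain h2 where h2: "h2 \<in> Hom D e2 e2'" "Cmp D b e2 e2' h2 i2 = i2'" "Cmp D e2 e2' a p2' h2 = p2"
    using assms(12) by (auto simp: ext_mor_def)
  note [simp] = h1 h2 Cmp_assoc_eq [OF h1(2)] Cmp_assoc_eq [OF h1(3)] Cmp_assoc_eq [OF h2(2)] Cmp_assoc_eq [OF h2(3)]
  show ?thesis
    unfolding ext_mor_def
    by (auto intro!: bexI [of _ "Add D ee ee' (Cmp D ee e1' ee' l1' (Cmp D ee e1 e1' h1 r1))
      (Cmp D ee e2' ee' l2' (Cmp D ee e2 e2' h2 r2))"])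
qed

text \<open>Two representatives of a Baer sum are compared by lifting \<open>\<eta>\<close> along the second pullback square and
  descending along the first pushout square.\<close>

lemma ext_sum_Ext1:
  assumes c: "c \<in> Ext1 D a b" and d: "d \<in> Ext1 D a b"
  shows "ext_sum D a b c d \<in> Ext1 D a b"
proof -
  obtain \<xi>1 where \<xi>1: "\<xi>1 \<in> c" and c_ext: "c \<subseteq> extensions D a b"
    and c_mor: "\<And>\<xi> \<xi>'. \<lbrakk>\<xi> \<in> c; \<xi>' \<in> c\<rbrakk> \<Longrightarrow> ext_mor D a b a b (Idn D a) (Idn D b) \<xi> \<xi>'"
    using Ext1_E [OF c] by metis
  obtain \<xi>2 where \<xi>2: "\<xi>2 \<in> d" and d_ext: "d \<subseteq> extensions D a b"
    and d_mor: "\<And>\<xi> \<xi>'. \<lbrakk>\<xi> \<in> d; \<xi>' \<in> d\<rbrakk> \<Longrightarrow> ext_mor D a b a b (Idn D a) (Idn D b) \<xi> \<xi>'"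
    using Ext1_E [OF d] by metis
  obtain e1 i1 p1 e2 i2 p2 where \<xi>: "\<xi>1 = (e1, i1, p1)" "\<xi>2 = (e2, i2, p2)"
    by (metis prod_cases3)
  have se: "short_exact D b e1 a i1 p1" "short_exact D b e2 a i2 p2"
    using \<xi>1 \<xi>2 c_ext d_ext by (auto simp: extensions_def \<xi>)
  note [simp] = short_exactD(1-6,11) [OF se(1)] short_exactD(1-6,11) [OF se(2)]
  obtain aa j1 j2 s1 s2 where aa: "is_biproduct D a a aa j1 j2 s1 s2"
    using biproducts [of a a] by auto
  obtain bb k1 k2 q1 q2 where bb: "is_biproduct D b b bb k1 k2 q1 q2"
    using biproducts [of b b] by auto
  obtain ee l1 l2 r1 r2 where ee: "is_biproduct D e1 e2 ee l1 l2 r1 r2"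
    using biproducts [of e1 e2] by auto
  note [simp] = biproduct_simps [OF aa] biproduct_simps [OF bb] biproduct_simps [OF ee]
  define \<zeta> where "\<zeta> = (ee,
    Add D bb ee (Cmp D bb e1 ee l1 (Cmp D bb b e1 i1 q1)) (Cmp D bb e2 ee l2 (Cmp D bb b e2 i2 q2)),
    Add D ee aa (Cmp D ee a aa j1 (Cmp D ee e1 a p1 r1)) (Cmp D ee a aa j2 (Cmp D ee e2 a p2 r2)))"
  have \<zeta>: "\<zeta> \<in> extensions D aa bb"
    using dsum_short_exact [OF se aa bb ee] by (simp add: \<zeta>_def extensions_def)
  obtain \<eta> where \<eta>: "\<eta> \<in> extensions D a bb"
    "ext_mor D a bb aa bb (Add D a aa j1 j2) (Idn D bb) \<eta> \<zeta>"
    by (rule pullback_extension [OF \<zeta>, of a "Add D a aa j1 j2"]) (use that in simp_all)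
  obtain \<xi>0 where \<xi>0: "\<xi>0 \<in> extensions D a b" "ext_mor D a bb a b (Idn D a) (Add D bb b q1 q2) \<eta> \<xi>0"
    by (rule pushout_extension [OF \<eta>(1), of b "Add D bb b q1 q2"]) (use that in simp_all)
  show ?thesis
  proof (rule Ext1_I)
    \<comment> \<open>With the pullback \<eta> fixed, every pushout of it along the codiagonal
      counts as a Baer sum.\<close>
    have *: "\<xi>' \<in> ext_sum D a b c d"
      if "\<xi>' \<in> extensions D a b" "ext_mor D a bb a b (Idn D a) (Add D bb b q1 q2) \<eta> \<xi>'" for \<xi>'
      unfolding ext_sum_def
      by (intro CollectI conjI exI)
        (rule that \<xi>1 [unfolded \<xi>] \<xi>2 [unfolded \<xi>] aa bb ee \<eta> [unfolded \<zeta>_def])+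
    show "\<xi>0 \<in> ext_sum D a b c d"
      using * \<xi>0 by blast
    fix \<xi>' assume \<xi>': "\<xi>' \<in> extensions D a b"
    show "ext_mor D a b a b (Idn D a) (Idn D b) \<xi>0 \<xi>' \<longleftrightarrow> \<xi>' \<in> ext_sum D a b c d"
    proof
      assume "ext_mor D a b a b (Idn D a) (Idn D b) \<xi>0 \<xi>'"
      from ext_mor_comp [OF \<eta>(1) \<xi>0(1) \<xi>' \<xi>0(2) this]
      show "\<xi>' \<in> ext_sum D a b c d"
        using * \<xi>' by simp
    next
      assume "\<xi>' \<in> ext_sum D a b c d"
      then obtain e1' i1' p1' e2' i2' p2' aa' j1' j2' s1' s2' bb' k1' k2' q1' q2' ee' l1' l2' r1' r2' \<eta>' \<zeta>' where
        in': "(e1', i1', p1') \<in> c" "(e2', i2', p2') \<in> d" and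
        bip': "is_biproduct D a a aa' j1' j2' s1' s2'" "is_biproduct D b b bb' k1' k2' q1' q2'"
          "is_biproduct D e1' e2' ee' l1' l2' r1' r2'" and
        \<zeta>'_def: "\<zeta>' = (ee', Add D bb' ee' (Cmp D bb' e1' ee' l1' (Cmp D bb' b e1' i1' q1'))
            (Cmp D bb' e2' ee' l2' (Cmp D bb' b e2' i2' q2')),
          Add D ee' aa' (Cmp D ee' a aa' j1' (Cmp D ee' e1' a p1' r1'))
            (Cmp D ee' a aa' j2' (Cmp D ee' e2' a p2' r2')))" and
        \<eta>': "\<eta>' \<in> extensions D a bb'"
          "ext_mor D a bb' aa' bb' (Add D a aa' j1' j2') (Idn D bb') \<eta>' \<zeta>'" and
        mor': "ext_mor D a bb' a b (Idn D a) (Add D bb' b q1' q2') \<eta>' \<xi>'"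
        unfolding ext_sum_def mem_Collect_eq by (elim conjE exE) (rule that; (assumption | rule refl))
      have se': "short_exact D b e1' a i1' p1'" "short_exact D b e2' a i2' p2'"
        using in' c_ext d_ext by (auto simp: extensions_def)
      note [simp] = short_exactD(1-6,11) [OF se'(1)] short_exactD(1-6,11) [OF se'(2)]
      note [simp] = biproduct_simps [OF bip'(1)] biproduct_simps [OF bip'(2)] biproduct_simps [OF bip'(3)]
      have \<zeta>': "\<zeta>' \<in> extensions D aa' bb'"
        using dsum_short_exact [OF se' bip'] by (simp add: \<zeta>'_def extensions_def)
      let ?v = "Add D aa aa' (Cmp D aa a aa' j1' s1) (Cmp D aa a aa' j2' s2)"
      let ?w = "Add D bb bb' (Cmp D bb b bb' k1' q1) (Cmp D bb b bb' k2' q2)"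
      have "ext_mor D aa bb aa' bb' ?v ?w \<zeta> \<zeta>'"
        unfolding \<zeta>_def \<zeta>'_def
        using dsum_ext_mor [OF se aa bb ee se' bip'] c_mor [OF \<xi>1 in'(1)] d_mor [OF \<xi>2 in'(2)] by (simp add: \<xi>)
      \<comment> \<open>The comparison map \<open>?v\<close> carries the diagonal of
        \<open>aa\<close> to the diagonal of \<open>aa'\<close>. The composite therefore factors
        through \<open>\<eta>'\<close>, the pullback along the latter.\<close>
      from ext_mor_comp [OF \<eta>(1) \<zeta> \<zeta>' \<eta>(2) this]
      have "ext_mor D a bb aa' bb' (Add D a aa' j1' j2') ?w \<eta> \<zeta>'"
        by (simp add: bilinear Cmp_assoc_right)
      then have "ext_mor D a bb a bb' (Idn D a) ?w \<eta> \<eta>'"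
        by - (rule ext_mor_lift [OF \<eta>'(1) \<zeta>' _ \<eta>'(2) \<eta>(1)]; simp)
      \<comment> \<open>Likewise the codiagonal of \<open>bb'\<close> after \<open>?w\<close> is the
        codiagonal of \<open>bb\<close>, so \<open>\<xi>'\<close> lies under \<eta> along the same
        map as \<open>\<xi>0\<close> and the pushout property applies.\<close>
      from ext_mor_comp [OF \<eta>(1) \<eta>'(1) \<xi>' this mor']
      have "ext_mor D a bb a b (Idn D a) (Add D bb b q1 q2) \<eta> \<xi>'"
        by (simp add: bilinear Cmp_assoc_right)
      then show "ext_mor D a b a b (Idn D a) (Idn D b) \<xi>0 \<xi>'"
        by - (rule ext_mor_desc [OF \<xi>0(1) \<eta>(1) _ \<xi>0(2) \<xi>']; simp)
    qed
  qed (auto simp: ext_sum_def)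
qed

end

section \<open>Wide subcategories\<close>

lemma full_subcategory_simps [simp]:
  "Ob (full_subcategory D S) = Ob D \<inter> S" "Hom (full_subcategory D S) = Hom D"
  "Cmp (full_subcategory D S) = Cmp D" "Idn (full_subcategory D S) = Idn D"
  "Add (full_subcategory D S) = Add D" "Zero (full_subcategory D S) = Zero D"
  "Scale (full_subcategory D S) = Scale D"
  by (simp_all add: full_subcategory_def)

lemma full_subcategory_op: "full_subcategory (op_cat D) S = op_cat (full_subcategory D S)"
  by (simp add: full_subcategory_def op_cat_def)

lemma (in linear_category) linear_category_full: "linear_category (full_subcategory D S)"
  by unfold_locales
    (simp_all add: Cmp_assoc Add_ac Add_inverse Scale_one Scale_mult Scale_add_left Scale_add_right bilinear)

lemma (in linear_category) is_kernel_iso: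
  assumes ker: "is_kernel D x y f w k" and u: "is_iso D w' w u"
    and [simp]: "w' \<in> Ob D" "x \<in> Ob D" "y \<in> Ob D" "f \<in> Hom D x y"
  shows "is_kernel D x y f w' (Cmp D w' w x k u)"
proof -
  obtain v where v [simp]: "v \<in> Hom D w w'" "Cmp D w' w w' v u = Idn D w'" "Cmp D w w' w u v = Idn D w"
    using is_isoE [OF u] by metis
  have [simp]: "u \<in> Hom D w' w" "w \<in> Ob D" "k \<in> Hom D w x" and fk: "Cmp D w x y f k = Zero D w y"
    using is_iso_in [OF u] ker by (auto simp: is_kernel_def)
  show ?thesis
  proof (rule is_kernelI)
    show "is_mono D w' x (Cmp D w' w x k u)"
    proof (rule is_monoI)
      fix a g assume g: "a \<in> Ob D" "g \<in> Hom D a w'" "Cmp D a w' x (Cmp D w' w x k u) g = Zero D a x"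
      then have "Cmp D a w' w u g = Zero D a w"
        using is_mono_ZeroD [OF is_kernel_mono [OF ker]] by (simp add: Cmp_assoc_right)
      then have "Cmp D a w w' v (Cmp D a w' w u g) = Zero D a w'"
        using g by simp
      then show "g = Zero D a w'"
        using g by (simp add: Cmp_assoc)
    qed simp_all
    fix a g assume g: "a \<in> Ob D" "g \<in> Hom D a x" "Cmp D a x y f g = Zero D a y"
    then obtain t where "t \<in> Hom D a w" "Cmp D a w x k t = g"
      using is_kernel_lift [OF ker] by metis
    then show "\<exists>t\<in>Hom D a w'. Cmp D a w' x (Cmp D w' w x k u) t = g"
      using g(1) by (intro bexI [of _ "Cmp D a w w' v t"]) (simp_all add: Cmp_assoc_right Cmp_assoc_eq [OF v(3)])
  qed (simp_all add: Cmp_assoc fk)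
qed

text \<open>Each closure condition asks for one suitable object in \<open>S\<close>, as these
  objects are determined only up to isomorphism. Properties established inside the subcategory are
  therefore transported to the ambient category along isomorphisms.\<close>

locale wide_subset = abelian_category D
  for D :: "('o, 'm, 'k::{comm_ring,comm_monoid_mult}) lcat" +
  fixes S :: "'o set"
  assumes zero_in: "\<exists>z\<in>S. is_zero_object D z"
    and biproduct_in: "\<lbrakk>a \<in> Ob D \<inter> S; b \<in> Ob D \<inter> S\<rbrakk> \<Longrightarrow> \<exists>s\<in>S. \<exists>i1 i2 p1 p2. is_biproduct D a b s i1 i2 p1 p2"
    and kernel_in: "\<lbrakk>x \<in> Ob D \<inter> S; y \<in> Ob D \<inter> S; f \<in> Hom D x y\<rbrakk> \<Longrightarrow> \<exists>w\<in>S. \<exists>k. is_kernel D x y f w k"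
    and cokernel_in: "\<lbrakk>x \<in> Ob D \<inter> S; y \<in> Ob D \<inter> S; f \<in> Hom D x y\<rbrakk> \<Longrightarrow> \<exists>w\<in>S. \<exists>c. is_cokernel D x y f w c"
begin

abbreviation "DS \<equiv> full_subcategory D S"

sublocale full: linear_category DS
  by (rule linear_category_full)

lemma wide_subset_op: "wide_subset (op_cat D) S"
proof -
  interpret op: abelian_category "op_cat D"
    by (rule abelian_category_op)
  show ?thesis
  proof unfold_locales
    fix a b assume "a \<in> Ob (op_cat D) \<inter> S" "b \<in> Ob (op_cat D) \<inter> S"
    then show "\<exists>s\<in>S. \<exists>i1 i2 p1 p2. is_biproduct (op_cat D) a b s i1 i2 p1 p2"
      using biproduct_in [of a b] by simp blast
  qed (use zero_in kernel_in cokernel_in in auto)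
qed

lemma is_kernel_full: "\<lbrakk>is_kernel D x y f w k; w \<in> S\<rbrakk> \<Longrightarrow> is_kernel DS x y f w k"
  by (auto simp: is_kernel_def)

text \<open>The universal property in the subcategory tests only objects of \<open>S\<close>. Some
  ambient kernel lies in \<open>S\<close> and is a kernel there too, so the two are isomorphic, and
  being an ambient kernel passes along the isomorphism.\<close>

lemma is_kernel_fullD:
  assumes ker: "is_kernel DS x y f w k" and xy: "x \<in> Ob D \<inter> S" "y \<in> Ob D \<inter> S" "f \<in> Hom D x y"
  shows "is_kernel D x y f w k"
proof -
  obtain w' k' where w': "w' \<in> S" "is_kernel D x y f w' k'"
    using kernel_in xy by blast
  obtain u where u: "is_iso DS w w' u" "Cmp D w w' x k' u = k"
    using full.is_kernel_cong [OF ker is_kernel_full [OF w'(2,1)]] xy by auto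
  then have "is_iso D w w' u"
    by (simp add: is_iso_def)
  then show ?thesis
    using is_kernel_iso [OF w'(2), of w u] ker xy u(2) by (auto simp: is_kernel_def [of DS])
qed

text \<open>An ambient kernel \<open>k\<close> of \<open>f\<close> can be chosen with source in
  \<open>S\<close>, where \<open>f\<close> can be cancelled. So \<open>k = 0\<close>, and every
  morphism that \<open>f\<close> sends to zero factors through it.\<close>

lemma is_mono_fullD:
  assumes mono: "is_mono DS x y f" and xy: "x \<in> Ob D \<inter> S" "y \<in> Ob D \<inter> S"
  shows "is_mono D x y f"
proof -
  have f: "f \<in> Hom D x y"
    using mono by (simp add: is_mono_def)
  obtain w k where ker: "w \<in> S" "is_kernel D x y f w k"
    using kernel_in xy f by blast
  then have w: "w \<in> Ob D" "k \<in> Hom D w x" "Cmp D w x y f k = Zero D w y"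
    by (auto simp: is_kernel_def)
  have k: "k = Zero D w x"
    using full.is_mono_ZeroD [OF mono, of w k] w ker(1) xy by simp
  show ?thesis
  proof (rule is_monoI)
    fix v g assume g: "v \<in> Ob D" "g \<in> Hom D v x" "Cmp D v x y f g = Zero D v y"
    then obtain t where "t \<in> Hom D v w" "Cmp D v w x k t = g"
      using is_kernel_lift [OF ker(2)] by metis
    then show "g = Zero D v x"
      using k w(1) xy g(1) by auto
  qed (use xy f in auto)
qed

lemma mono_is_kernel_full:
  assumes xy: "x \<in> Ob D \<inter> S" "y \<in> Ob D \<inter> S" and mono: "is_mono DS x y f"
  shows "\<exists>z\<in>Ob DS. \<exists>g\<in>Hom DS y z. is_kernel DS y z g x f"
proof -
  have f: "f \<in> Hom D x y"
    using mono by (simp add: is_mono_def)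
  obtain w c where coker: "w \<in> S" "is_cokernel D x y f w c"
    using cokernel_in xy f by blast
  then have "is_kernel DS y w c x f"
    using mono_kernel_of_cokernel [OF _ _ is_mono_fullD [OF mono xy]] xy is_kernel_full by auto
  then show ?thesis
    using coker by (auto simp: is_cokernel_def)
qed

end

context wide_subset
begin

interpretation op: wide_subset "op_cat D" S
  by (rule wide_subset_op)

lemma is_cokernel_full: "\<lbrakk>is_cokernel D x y f w c; w \<in> S\<rbrakk> \<Longrightarrow> is_cokernel DS x y f w c"
  using op.is_kernel_full [of y x f w c] by (simp add: full_subcategory_op)

lemma is_cokernel_fullD:
  assumes "is_cokernel DS x y f w c" "x \<in> Ob D \<inter> S" "y \<in> Ob D \<inter> S" "f \<in> Hom D x y"
  shows "is_cokernel D x y f w c"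
  using op.is_kernel_fullD [of y x f w c] assms by (simp add: full_subcategory_op)

lemma epi_is_cokernel_full:
  assumes "x \<in> Ob D \<inter> S" "y \<in> Ob D \<inter> S" "is_epi DS x y f"
  shows "\<exists>z\<in>Ob DS. \<exists>g\<in>Hom DS z x. is_cokernel DS z x g y f"
  using op.mono_is_kernel_full [of y x f] assms by (simp add: full_subcategory_op)

lemma abelian_category_full: "abelian_category DS"
proof unfold_locales
  show "\<exists>z. is_zero_object DS z"
  proof -
    obtain z where "z \<in> S" "is_zero_object D z"
      using zero_in by blast
    then have "is_zero_object DS z"
      by (simp add: is_zero_object_def)
    then show ?thesis ..
  qed
  show "\<exists>s i1 i2 p1 p2. is_biproduct DS a b s i1 i2 p1 p2" if "a \<in> Ob DS" "b \<in> Ob DS" for a b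
    using biproduct_in [of a b] that by (simp add: is_biproduct_def) blast
  show "\<exists>w k. is_kernel DS x y f w k" if "x \<in> Ob DS" "y \<in> Ob DS" "f \<in> Hom DS x y" for x y f
    using kernel_in [of x y f] is_kernel_full that by simp blast
  show "\<exists>w k. is_cokernel DS x y f w k" if "x \<in> Ob DS" "y \<in> Ob DS" "f \<in> Hom DS x y" for x y f
    using cokernel_in [of x y f] is_cokernel_full that by simp blast
qed (use mono_is_kernel_full epi_is_cokernel_full in auto)

lemma short_exact_fullD: "short_exact DS b e a i p \<Longrightarrow> short_exact D b e a i p"
  using is_kernel_fullD is_cokernel_fullD by (auto simp: short_exact_def)

lemma wide_subcategory: "wide_subcategory D S"
proof -
  have "linear_functor DS D (embedding DS)"
    unfolding linear_functor_def embedding_def by (auto simp: PiE_def)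
  moreover have "short_exact D (FOb (embedding DS) b) (FOb (embedding DS) e) (FOb (embedding DS) a)
      (FMor (embedding DS) b e i) (FMor (embedding DS) e a p)" if "short_exact DS b e a i p" for b e a i p
    using short_exact_fullD [OF that] that by (simp add: embedding_def short_exact_def)
  ultimately have "exact_functor DS D (embedding DS)"
    unfolding exact_functor_def by blast
  then show ?thesis
    using abelian_category_full by (simp add: wide_subcategory_def)
qed

subsection \<open>Restriction of exact structures\<close>

interpretation full_ab: abelian_category DS
  by (rule abelian_category_full)

lemma extensions_full: "extensions DS a b \<subseteq> extensions D a b"
  using short_exact_fullD by (auto simp: extensions_def)

lemma ext_mor_full: "ext_mor DS = ext_mor D"
  by (simp add: fun_eq_iff ext_mor_def)

lemma is_biproduct_fullD: "is_biproduct DS a b s i1 i2 p1 p2 \<Longrightarrow> is_biproduct D a b s i1 i2 p1 p2"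
  by (simp add: is_biproduct_def)

text \<open>Short exact sequences, morphisms and biproducts of the subcategory remain such in the
  ambient category, so a result obtained there is also an ambient result. The class may grow from
  \<open>c\<close> to \<open>c'\<close> because a class of the subcategory is in general only part
  of an ambient class.\<close>

lemma ext_pull_full: "c \<subseteq> c' \<Longrightarrow> ext_pull DS a b a' \<alpha> c \<subseteq> ext_pull D a b a' \<alpha> c'"
  using extensions_full by (auto simp: ext_pull_def ext_mor_full)

lemma ext_push_full: "c \<subseteq> c' \<Longrightarrow> ext_push DS a b b' \<beta> c \<subseteq> ext_push D a b b' \<beta> c'"
  using extensions_full by (auto simp: ext_push_def ext_mor_full)

lemma ext_zero_full: "ext_zero DS a b \<subseteq> ext_zero D a b"
  using extensions_full by (auto simp: ext_zero_def)

lemma ext_sum_full: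
  assumes "c1 \<subseteq> c1'" "c2 \<subseteq> c2'"
  shows "ext_sum DS a b c1 c2 \<subseteq> ext_sum D a b c1' c2'"
proof
  fix \<xi> assume "\<xi> \<in> ext_sum DS a b c1 c2"
  then show "\<xi> \<in> ext_sum D a b c1' c2'"
    unfolding ext_sum_def mem_Collect_eq full_subcategory_simps ext_mor_full
    apply (elim conjE exE)
    apply (intro conjI exI)
            apply (erule subsetD [OF extensions_full])
           apply (erule subsetD [OF assms(1)])
          apply (erule subsetD [OF assms(2)])
         apply (erule is_biproduct_fullD)+
      apply (erule subsetD [OF extensions_full])
     apply assumption+
    done
qed

text \<open>Zero, sums, pullbacks and pushouts follow one pattern: the operation in the subcategory
  yields a class there, and this class is contained in the ambient result, which belongs to
  \<open>E\<close>.\<close>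

theorem exact_structure_restrict:
  assumes E: "exact_structure D E"
  shows "exact_structure DS (restrict_structure D S E)"
proof -
  have E_Ext1: "E a b \<subseteq> Ext1 D a b" if "a \<in> Ob D" "b \<in> Ob D" for a b
    using E that unfolding exact_structure_def by blast
  show ?thesis
    unfolding exact_structure_def
  proof (intro conjI ballI impI)
    fix a b assume ab: "a \<in> Ob DS" "b \<in> Ob DS"
    then have ab': "a \<in> Ob D" "b \<in> Ob D"
      by simp_all
    show "restrict_structure D S E a b \<subseteq> Ext1 DS a b"
      by (auto simp: restrict_structure_def)
    show "ext_zero DS a b \<in> restrict_structure D S E a b"
    proof -
      have "ext_zero D a b \<in> E a b"
        using E ab' by (simp add: exact_structure_def)
      then show ?thesis
        using full_ab.ext_zero_Ext1 [OF ab] ext_zero_full by (auto simp: restrict_structure_def)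
    qed
    fix c d assume c: "c \<in> restrict_structure D S E a b"
    then obtain c' where c': "c' \<in> E a b" "c \<subseteq> c'" and c_Ext: "c \<in> Ext1 DS a b"
      by (auto simp: restrict_structure_def)
    show "ext_sum DS a b c d \<in> restrict_structure D S E a b"
      if d: "d \<in> restrict_structure D S E a b"
    proof -
      obtain d' where d': "d' \<in> E a b" "d \<subseteq> d'" and d_Ext: "d \<in> Ext1 DS a b"
        using d by (auto simp: restrict_structure_def)
      have "ext_sum D a b c' d' \<in> E a b"
        using E ab' c'(1) d'(1) unfolding exact_structure_def by blast
      then show ?thesis
        using full_ab.ext_sum_Ext1 [OF c_Ext d_Ext] ext_sum_full [OF c'(2) d'(2)]
        by (auto simp: restrict_structure_def)
    qed
    \<comment> \<open>Inverses need the converse direction: the ambient class \<open>d'\<close>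
      around \<open>d\<close> must be shown to be inverse to \<open>c'\<close>. The ambient sum and
      the ambient zero class share the element \<zeta> coming from the subcategory, and classes that
      meet are equal.\<close>
    show "d \<in> restrict_structure D S E a b"
      if d: "d \<in> Ext1 DS a b" and sum: "ext_sum DS a b c d = ext_zero DS a b"
    proof -
      obtain \<xi> where \<xi>: "\<xi> \<in> d" "d \<subseteq> extensions DS a b"
        and d_mor: "\<And>\<xi> \<xi>'. \<lbrakk>\<xi> \<in> d; \<xi>' \<in> d\<rbrakk> \<Longrightarrow> ext_mor DS a b a b (Idn DS a) (Idn DS b) \<xi> \<xi>'"
        using full_ab.Ext1_E [OF d] by metis
      obtain d' where d': "d' \<in> Ext1 D a b" "\<xi> \<in> d'"
        using ext_class_in_Ext1 \<xi> extensions_full by blast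
      have dd': "d \<subseteq> d'"
      proof
        fix \<xi>' assume \<xi>': "\<xi>' \<in> d"
        then obtain d'' where d'': "d'' \<in> Ext1 D a b" "\<xi>' \<in> d''"
          using ext_class_in_Ext1 \<xi> extensions_full by blast
        have "(\<xi>, \<xi>') \<in> ext_equiv D a b"
          using d_mor [OF \<xi>(1) \<xi>'] \<xi> \<xi>' extensions_full by (auto simp: ext_equiv_def ext_mor_full)
        then show "\<xi>' \<in> d'"
          using in_quotient_imp_closed [OF equiv_ext_equiv] d' unfolding Ext1_def by blast
      qed
      have c'_Ext: "c' \<in> Ext1 D a b"
        using c'(1) E_Ext1 [OF ab'] by blast
      obtain \<zeta> where "\<zeta> \<in> ext_zero DS a b"
        using full_ab.Ext1_E [OF full_ab.ext_zero_Ext1 [OF ab]] by metis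
      then have "\<zeta> \<in> ext_sum D a b c' d'" "\<zeta> \<in> ext_zero D a b"
        using sum ext_sum_full [OF c'(2) dd'] ext_zero_full by blast+
      then have "ext_sum D a b c' d' = ext_zero D a b"
        using Ext1_eqI [OF ext_sum_Ext1 [OF c'_Ext d'(1)] ext_zero_Ext1 [OF ab']] by blast
      then have "d' \<in> E a b"
        using E ab' c'(1) d'(1) unfolding exact_structure_def by blast
      then show ?thesis
        using d dd' by (auto simp: restrict_structure_def)
    qed
  next
    fix a b a' \<alpha> c
    assume ob: "a \<in> Ob DS" "b \<in> Ob DS" "a' \<in> Ob DS" and \<alpha>: "\<alpha> \<in> Hom DS a' a"
      and c: "c \<in> restrict_structure D S E a b"
    then obtain c' where c': "c' \<in> E a b" "c \<subseteq> c'" and c_Ext: "c \<in> Ext1 DS a b"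
      by (auto simp: restrict_structure_def)
    have "ext_pull D a b a' \<alpha> c' \<in> E a' b"
      using E ob \<alpha> c'(1) unfolding exact_structure_def by simp
    then show "ext_pull DS a b a' \<alpha> c \<in> restrict_structure D S E a' b"
      using full_ab.ext_pull_Ext1 [OF c_Ext ob(3) \<alpha>] ext_pull_full [OF c'(2)]
      unfolding restrict_structure_def by blast
  next
    fix a b b' \<beta> c
    assume ob: "a \<in> Ob DS" "b \<in> Ob DS" "b' \<in> Ob DS" and \<beta>: "\<beta> \<in> Hom DS b b'"
      and c: "c \<in> restrict_structure D S E a b"
    then obtain c' where c': "c' \<in> E a b" "c \<subseteq> c'" and c_Ext: "c \<in> Ext1 DS a b"
      by (auto simp: restrict_structure_def)
    have "ext_push D a b b' \<beta> c' \<in> E a b'"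
      using E ob \<beta> c'(1) unfolding exact_structure_def by simp
    then show "ext_push DS a b b' \<beta> c \<in> restrict_structure D S E a b'"
      using full_ab.ext_push_Ext1 [OF c_Ext ob(3) \<beta>] ext_push_full [OF c'(2)]
      unfolding restrict_structure_def by blast
  qed
qed

end

section \<open>Functor categories\<close>

lemma functor_category_simps [simp]:
  "Ob (functor_category A D) = {M. linear_functor A D M}"
  "Hom (functor_category A D) = nat_trans A D"
  "Cmp (functor_category A D) L M N \<theta> \<eta> = (\<lambda>x\<in>Ob A. Cmp D (FOb L x) (FOb M x) (FOb N x) (\<theta> x) (\<eta> x))"
  "Idn (functor_category A D) M = (\<lambda>x\<in>Ob A. Idn D (FOb M x))"
  "Add (functor_category A D) M N \<eta> \<theta> = (\<lambda>x\<in>Ob A. Add D (FOb M x) (FOb N x) (\<eta> x) (\<theta> x))"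
  "Zero (functor_category A D) M N = (\<lambda>x\<in>Ob A. Zero D (FOb M x) (FOb N x))"
  "Scale (functor_category A D) M N c \<eta> = (\<lambda>x\<in>Ob A. Scale D (FOb M x) (FOb N x) c (\<eta> x))"
  by (simp_all add: functor_category_def)

lemma linear_functorD:
  assumes "linear_functor A D M" "x \<in> Ob A"
  shows "FOb M x \<in> Ob D" "FMor M x x (Idn A x) = Idn D (FOb M x)"
    "\<lbrakk>y \<in> Ob A; f \<in> Hom A x y\<rbrakk> \<Longrightarrow> FMor M x y f \<in> Hom D (FOb M x) (FOb M y)"
    "\<lbrakk>y \<in> Ob A; z \<in> Ob A; f \<in> Hom A x y; g \<in> Hom A y z\<rbrakk>
      \<Longrightarrow> FMor M x z (Cmp A x y z g f) = Cmp D (FOb M x) (FOb M y) (FOb M z) (FMor M y z g) (FMor M x y f)"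
    "\<lbrakk>y \<in> Ob A; f \<in> Hom A x y; g \<in> Hom A x y\<rbrakk>
      \<Longrightarrow> FMor M x y (Add A x y f g) = Add D (FOb M x) (FOb M y) (FMor M x y f) (FMor M x y g)"
    "\<lbrakk>y \<in> Ob A; f \<in> Hom A x y\<rbrakk> \<Longrightarrow> FMor M x y (Scale A x y c f) = Scale D (FOb M x) (FOb M y) c (FMor M x y f)"
  using assms unfolding linear_functor_def by (auto simp: PiE_def Pi_def)

text \<open>Linear functors respect scaling, and the zero morphism is \<open>0\<close> times a
  morphism.\<close>

lemma FMor_Zero:
  assumes "linear_category A" "linear_category D" "linear_functor A D M" "x \<in> Ob A" "y \<in> Ob A"
  shows "FMor M x y (Zero A x y) = Zero D (FOb M x) (FOb M y)"
proof -
  interpret A: linear_category A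
    by fact
  interpret D: linear_category D
    by fact
  have "FMor M x y (Scale A x y 0 (Zero A x y)) = Scale D (FOb M x) (FOb M y) 0 (FMor M x y (Zero A x y))"
    by (rule linear_functorD(6) [OF assms(3-5)]) (use assms in simp)
  then show ?thesis
    using linear_functorD(1) [OF assms(3)] linear_functorD(3) [OF assms(3-5)] assms by simp
qed

lemma nat_transD:
  assumes "\<eta> \<in> nat_trans A D M N" "x \<in> Ob A"
  shows "\<eta> x \<in> Hom D (FOb M x) (FOb N x)"
    "\<lbrakk>y \<in> Ob A; f \<in> Hom A x y\<rbrakk> \<Longrightarrow> Cmp D (FOb M x) (FOb M y) (FOb N y) (\<eta> y) (FMor M x y f) =
      Cmp D (FOb M x) (FOb N x) (FOb N y) (FMor N x y f) (\<eta> x)"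
  using assms unfolding nat_trans_def by (auto simp: PiE_def Pi_def)

lemma nat_transI:
  assumes "\<And>x. x \<in> Ob A \<Longrightarrow> \<eta> x \<in> Hom D (FOb M x) (FOb N x)"
    and "\<And>x y f. \<lbrakk>x \<in> Ob A; y \<in> Ob A; f \<in> Hom A x y\<rbrakk>
      \<Longrightarrow> Cmp D (FOb M x) (FOb M y) (FOb N y) (\<eta> y) (FMor M x y f) =
        Cmp D (FOb M x) (FOb N x) (FOb N y) (FMor N x y f) (\<eta> x)"
  shows "(\<lambda>x\<in>Ob A. \<eta> x) \<in> nat_trans A D M N"
  using assms unfolding nat_trans_def by auto

lemma nat_trans_restrict: "\<eta> \<in> nat_trans A D M N \<Longrightarrow> restrict \<eta> (Ob A) = \<eta>"
  unfolding nat_trans_def by (auto simp: PiE_def extensional_restrict)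

lemma nat_trans_eqI:
  assumes "\<eta> \<in> nat_trans A D M N" "\<theta> \<in> nat_trans A D M N" "\<And>x. x \<in> Ob A \<Longrightarrow> \<eta> x = \<theta> x"
  shows "\<eta> = \<theta>"
  using assms unfolding nat_trans_def by (auto intro: PiE_ext)

section \<open>Constructing functors and passing to opposite functors\<close>

definition make_functor ::
  "('a, 'q, 'k) lcat \<Rightarrow> ('a \<Rightarrow> 'o) \<Rightarrow> ('a \<Rightarrow> 'a \<Rightarrow> 'q \<Rightarrow> 'n) \<Rightarrow> ('a, 'q, 'o, 'n) lfun" where
  "make_functor A F\<^sub>0 F\<^sub>1 = \<lparr> FOb = (\<lambda>x\<in>Ob A. F\<^sub>0 x),
     FMor = (\<lambda>x y. if x \<in> Ob A \<and> y \<in> Ob A then (\<lambda>f\<in>Hom A x y. F\<^sub>1 x y f) else (\<lambda>_. undefined)) \<rparr>"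

lemma make_functor_simps [simp]:
  "x \<in> Ob A \<Longrightarrow> FOb (make_functor A F\<^sub>0 F\<^sub>1) x = F\<^sub>0 x"
  "\<lbrakk>x \<in> Ob A; y \<in> Ob A; f \<in> Hom A x y\<rbrakk> \<Longrightarrow> FMor (make_functor A F\<^sub>0 F\<^sub>1) x y f = F\<^sub>1 x y f"
  by (simp_all add: make_functor_def)

lemma (in linear_category) linear_functor_make:
  assumes "\<And>x. x \<in> Ob D \<Longrightarrow> F\<^sub>0 x \<in> Ob B"
    and "\<And>x y f. \<lbrakk>x \<in> Ob D; y \<in> Ob D; f \<in> Hom D x y\<rbrakk> \<Longrightarrow> F\<^sub>1 x y f \<in> Hom B (F\<^sub>0 x) (F\<^sub>0 y)"
    and "\<And>x. x \<in> Ob D \<Longrightarrow> F\<^sub>1 x x (Idn D x) = Idn B (F\<^sub>0 x)"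
    and "\<And>x y z f g. \<lbrakk>x \<in> Ob D; y \<in> Ob D; z \<in> Ob D; f \<in> Hom D x y; g \<in> Hom D y z\<rbrakk>
      \<Longrightarrow> F\<^sub>1 x z (Cmp D x y z g f) = Cmp B (F\<^sub>0 x) (F\<^sub>0 y) (F\<^sub>0 z) (F\<^sub>1 y z g) (F\<^sub>1 x y f)"
    and "\<And>x y f g. \<lbrakk>x \<in> Ob D; y \<in> Ob D; f \<in> Hom D x y; g \<in> Hom D x y\<rbrakk>
      \<Longrightarrow> F\<^sub>1 x y (Add D x y f g) = Add B (F\<^sub>0 x) (F\<^sub>0 y) (F\<^sub>1 x y f) (F\<^sub>1 x y g)"
    and "\<And>x y f c. \<lbrakk>x \<in> Ob D; y \<in> Ob D; f \<in> Hom D x y\<rbrakk>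
      \<Longrightarrow> F\<^sub>1 x y (Scale D x y c f) = Scale B (F\<^sub>0 x) (F\<^sub>0 y) c (F\<^sub>1 x y f)"
  shows "linear_functor D B (make_functor D F\<^sub>0 F\<^sub>1)"
  unfolding linear_functor_def
  using assms by (auto simp: make_functor_def)

text \<open>The same assignments, read between opposite categories. Natural transformations keep
  their components but change direction, so functors between opposite categories form the opposite
  of the functor category, up to this renaming.\<close>

definition op_fun :: "('a, 'q, 'o, 'n) lfun \<Rightarrow> ('a, 'q, 'o, 'n) lfun" where
  "op_fun M = \<lparr> FOb = FOb M, FMor = (\<lambda>x y. FMor M y x) \<rparr>"

lemma op_fun_simps [simp]:
  "FOb (op_fun M) = FOb M" "FMor (op_fun M) x y = FMor M y x" "op_fun (op_fun M) = M"
  by (simp_all add: op_fun_def)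

lemma op_op_cat [simp]: "op_cat (op_cat D) = D"
  by (simp add: op_cat_def)

lemma linear_functor_op_fun:
  assumes "linear_functor A D M"
  shows "linear_functor (op_cat A) (op_cat D) (op_fun M)"
  using assms unfolding linear_functor_def op_cat_simps op_fun_simps
  by (elim conjE, intro conjI allI impI) blast+

lemma linear_functor_op [simp]: "linear_functor (op_cat A) (op_cat D) (op_fun M) = linear_functor A D M"
  using linear_functor_op_fun [of A D M] linear_functor_op_fun [of "op_cat A" "op_cat D" "op_fun M"] by auto

text \<open>The universal properties quantify over all test functors; \<open>op_fun\<close> is a
  bijection that reindexes this quantifier, which reduces duality for functor categories to
  rewriting.\<close>

lemma ball_linear_functor_op:
  "(\<forall>M\<in>{M. linear_functor (op_cat A) (op_cat D) M}. P M) \<longleftrightarrow> (\<forall>M\<in>{M. linear_functor A D M}. P (op_fun M))"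
proof safe
  fix M
  assume *: "\<forall>M\<in>{M. linear_functor A D M}. P (op_fun M)" and "linear_functor (op_cat A) (op_cat D) M"
  then have "linear_functor A D (op_fun M)"
    using linear_functor_op [of A D "op_fun M"] by simp
  then show "P M"
    using * by force
qed simp

lemma nat_trans_op [simp]:
  "nat_trans (op_cat A) (op_cat D) (op_fun M) (op_fun N) = nat_trans A D N M"
  unfolding nat_trans_def by auto

lemma is_kernel_functor_op [simp]:
  "is_kernel (functor_category (op_cat A) (op_cat D)) (op_fun M) (op_fun N) \<eta> (op_fun W) c
    = is_cokernel (functor_category A D) N M \<eta> W c"
  unfolding is_kernel_def is_cokernel_def functor_category_simps ball_linear_functor_op by simp

lemma is_mono_functor_op [simp]:
  "is_mono (functor_category (op_cat A) (op_cat D)) (op_fun M) (op_fun N) \<eta>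
    = is_epi (functor_category A D) N M \<eta>"
  unfolding is_mono_def is_epi_def functor_category_simps ball_linear_functor_op by simp

definition inverts ::
  "('o, 'n, 'k) lcat \<Rightarrow> ('a, 'q, 'o, 'n) lfun \<Rightarrow> ('a \<times> 'a \<times> 'q) set \<Rightarrow> bool" where
  "inverts D M R \<longleftrightarrow> (\<forall>(x, y, \<sigma>)\<in>R. is_iso D (FOb M x) (FOb M y) (FMor M x y \<sigma>))"

section \<open>Kernels and monomorphisms in functor categories\<close>

locale functors = A: linear_category A + abelian_category D
  for A :: "('a, 'q, 'k::{comm_ring,comm_monoid_mult}) lcat"
    and D :: "('o, 'n, 'k) lcat"
begin

abbreviation "\<F> \<equiv> functor_category A D"

lemma functors_op: "functors (op_cat A) (op_cat D)"
  by (intro functors.intro A.linear_category_op abelian_category_op)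

lemma nat_trans_Cmp:
  assumes LMN: "linear_functor A D L" "linear_functor A D M" "linear_functor A D N"
    and \<eta>: "\<eta> \<in> nat_trans A D L M" and \<theta>: "\<theta> \<in> nat_trans A D M N"
  shows "(\<lambda>x\<in>Ob A. Cmp D (FOb L x) (FOb M x) (FOb N x) (\<theta> x) (\<eta> x)) \<in> nat_trans A D L N"
proof (rule nat_transI)
  note [simp] = linear_functorD [OF LMN(1)] linear_functorD [OF LMN(2)] linear_functorD [OF LMN(3)]
    nat_transD(1) [OF \<eta>] nat_transD(1) [OF \<theta>]
  fix x y f assume [simp]: "x \<in> Ob A" "y \<in> Ob A" "f \<in> Hom A x y"
  show "Cmp D (FOb L x) (FOb L y) (FOb N y) (Cmp D (FOb L y) (FOb M y) (FOb N y) (\<theta> y) (\<eta> y)) (FMor L x y f) =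
    Cmp D (FOb L x) (FOb N x) (FOb N y) (FMor N x y f) (Cmp D (FOb L x) (FOb M x) (FOb N x) (\<theta> x) (\<eta> x))"
    using nat_transD(2) [OF \<eta>, of x y f] Cmp_assoc_eq [OF nat_transD(2) [OF \<theta>, of x y f]]
    by (simp add: Cmp_assoc_right)
qed (use assms in \<open>simp add: linear_functorD nat_transD\<close>)

lemma linear_category_functors: "linear_category \<F>"
proof -
  note [simp] = linear_functorD nat_transD(1) nat_trans_restrict
  note * = nat_trans_restrict [symmetric]
  have closed:
    "linear_functor A D M \<Longrightarrow> (\<lambda>x\<in>Ob A. Idn D (FOb M x)) \<in> nat_trans A D M M"
    "\<lbrakk>linear_functor A D M; linear_functor A D N\<rbrakk> \<Longrightarrow> (\<lambda>x\<in>Ob A. Zero D (FOb M x) (FOb N x)) \<in> nat_trans A D M N"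
    "\<lbrakk>linear_functor A D M; linear_functor A D N; \<eta> \<in> nat_trans A D M N; \<theta> \<in> nat_trans A D M N\<rbrakk>
      \<Longrightarrow> (\<lambda>x\<in>Ob A. Add D (FOb M x) (FOb N x) (\<eta> x) (\<theta> x)) \<in> nat_trans A D M N"
    "\<lbrakk>linear_functor A D M; linear_functor A D N; \<eta> \<in> nat_trans A D M N\<rbrakk>
      \<Longrightarrow> (\<lambda>x\<in>Ob A. Scale D (FOb M x) (FOb N x) c (\<eta> x)) \<in> nat_trans A D M N" for M N \<eta> \<theta> c
    by (rule nat_transI; simp add: bilinear nat_transD(2))+
  show ?thesis
  proof unfold_locales
    fix M N f assume *: "M \<in> Ob \<F>" "N \<in> Ob \<F>" "f \<in> Hom \<F> M N"
    have "Add \<F> M N f (Scale \<F> M N (- 1) f) = Zero \<F> M N"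
      using * by (simp cong: restrict_cong)
    then show "\<exists>g\<in>Hom \<F> M N. Add \<F> M N f g = Zero \<F> M N"
      using * closed(4) [of M N f "- 1"] by (intro bexI [of _ "Scale \<F> M N (- 1) f"]) simp_all
  qed (simp_all add: closed nat_trans_Cmp Cmp_assoc Add_ac Scale_one Scale_mult Scale_add_left
      Scale_add_right bilinear cong: restrict_cong)
qed

sublocale fc: linear_category \<F>
  by (rule linear_category_functors)

text \<open>The lifts exist at every object. They form a natural transformation because naturality
  may be checked after composing with the monomorphism \<open>k y\<close>.\<close>

lemma is_kernel_pointwise:
  assumes MN: "linear_functor A D M" "linear_functor A D N" "linear_functor A D W"
    and \<eta>: "\<eta> \<in> nat_trans A D M N" and k: "k \<in> nat_trans A D W M"
    and ker: "\<And>x. x \<in> Ob A \<Longrightarrow> is_kernel D (FOb M x) (FOb N x) (\<eta> x) (FOb W x) (k x)"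
  shows "is_kernel \<F> M N \<eta> W k"
proof -
  note [simp] = linear_functorD [OF MN(1)] linear_functorD [OF MN(2)] linear_functorD [OF MN(3)]
    nat_transD(1) [OF \<eta>] nat_transD(1) [OF k]
  have mono: "is_mono D (FOb W x) (FOb M x) (k x)" if "x \<in> Ob A" for x
    using is_kernel_mono [OF ker] that by simp
  show ?thesis
  proof (rule fc.is_kernelI)
    show "Cmp \<F> W M N \<eta> k = Zero \<F> W N"
      using ker by (simp add: is_kernel_def cong: restrict_cong)
    show "is_mono \<F> W M k"
    proof (rule fc.is_monoI)
      fix V g assume g: "V \<in> Ob \<F>" "g \<in> Hom \<F> V W" "Cmp \<F> V W M k g = Zero \<F> V M"
      show "g = Zero \<F> V W"
      proof (rule nat_trans_eqI)
        fix x assume x: "x \<in> Ob A"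
        have "Cmp D (FOb V x) (FOb W x) (FOb M x) (k x) (g x) = Zero D (FOb V x) (FOb M x)"
          using fun_cong [OF g(3), of x] x by simp
        then show "g x = Zero \<F> V W x"
          using is_mono_ZeroD [OF mono [OF x]] g x by (simp add: linear_functorD nat_transD)
      qed (use g fc.Zero_in [of V W] MN in simp_all)
    qed (use MN k in simp_all)
    fix V g assume g: "V \<in> Ob \<F>" "g \<in> Hom \<F> V M" "Cmp \<F> V M N \<eta> g = Zero \<F> V N"
    then have V: "linear_functor A D V" and g': "g \<in> nat_trans A D V M"
      by simp_all
    note [simp] = linear_functorD [OF V] nat_transD(1) [OF g']
    have "\<exists>u\<in>Hom D (FOb V x) (FOb W x). Cmp D (FOb V x) (FOb W x) (FOb M x) (k x) u = g x" if x: "x \<in> Ob A" for x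
    proof -
      have "Cmp D (FOb V x) (FOb M x) (FOb N x) (\<eta> x) (g x) = Zero D (FOb V x) (FOb N x)"
        using fun_cong [OF g(3), of x] x by simp
      then show ?thesis
        using is_kernel_lift [OF ker [OF x]] x by (metis nat_transD(1) [OF g'] linear_functorD(1) [OF V])
    qed
    then obtain u where u [simp]: "\<And>x. x \<in> Ob A \<Longrightarrow> u x \<in> Hom D (FOb V x) (FOb W x)"
      "\<And>x. x \<in> Ob A \<Longrightarrow> Cmp D (FOb V x) (FOb W x) (FOb M x) (k x) (u x) = g x"
      by metis
    have "restrict u (Ob A) \<in> nat_trans A D V W"
    proof (rule nat_transI)
      fix x y f assume [simp]: "x \<in> Ob A" "y \<in> Ob A" "f \<in> Hom A x y"
      show "Cmp D (FOb V x) (FOb V y) (FOb W y) (u y) (FMor V x y f) =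
        Cmp D (FOb V x) (FOb W x) (FOb W y) (FMor W x y f) (u x)"
        by (rule is_monoD [OF mono [of y], of "FOb V x"])
          (simp_all add: Cmp_assoc_eq [OF u(2)] nat_transD(2) [OF g'] Cmp_assoc_eq [OF nat_transD(2) [OF k, of x y f]]
            Cmp_assoc_right)
    qed simp
    moreover have "Cmp \<F> V W M k (restrict u (Ob A)) = g"
      using nat_trans_restrict [OF g'] by (simp cong: restrict_cong)
    ultimately show "\<exists>u\<in>Hom \<F> V W. Cmp \<F> V W M k u = g"
      by (metis functor_category_simps(2))
  qed (use MN k in simp_all)
qed

text \<open>A family of subobjects preserved by the action of \<open>M\<close> inherits a functor
  structure: each functor law for the chosen restrictions \<open>u\<close> holds after composing
  with a monomorphism \<open>k\<close>.\<close>

lemma subfunctor: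
  assumes M: "linear_functor A D M"
    and W: "\<And>x. x \<in> Ob A \<Longrightarrow> W x \<in> Ob D" and k: "\<And>x. x \<in> Ob A \<Longrightarrow> is_mono D (W x) (FOb M x) (k x)"
    and lift: "\<And>x y f. \<lbrakk>x \<in> Ob A; y \<in> Ob A; f \<in> Hom A x y\<rbrakk> \<Longrightarrow> \<exists>u\<in>Hom D (W x) (W y).
      Cmp D (W x) (W y) (FOb M y) (k y) u = Cmp D (W x) (FOb M x) (FOb M y) (FMor M x y f) (k x)"
  obtains V where "linear_functor A D V" "\<And>x. x \<in> Ob A \<Longrightarrow> FOb V x = W x" "restrict k (Ob A) \<in> nat_trans A D V M"
proof -
  have k_in [simp]: "k x \<in> Hom D (W x) (FOb M x)" if "x \<in> Ob A" for x
    using k [OF that] by (simp add: is_mono_def)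
  obtain u where u [simp]: "\<And>x y f. \<lbrakk>x \<in> Ob A; y \<in> Ob A; f \<in> Hom A x y\<rbrakk> \<Longrightarrow> u x y f \<in> Hom D (W x) (W y)"
    "\<And>x y f. \<lbrakk>x \<in> Ob A; y \<in> Ob A; f \<in> Hom A x y\<rbrakk> \<Longrightarrow>
      Cmp D (W x) (W y) (FOb M y) (k y) (u x y f) = Cmp D (W x) (FOb M x) (FOb M y) (FMor M x y f) (k x)"
    using lift by metis
  note [simp] = W linear_functorD [OF M]
  note uniq = is_monoD [OF k]
  have "linear_functor A D (make_functor A W u)"
  proof (rule A.linear_functor_make)
    fix x assume x: "x \<in> Ob A"
    show "u x x (Idn A x) = Idn D (W x)"
      by (rule uniq [OF x, of "W x"]) (use x in simp_all)
  next
    fix x y z f g assume *: "x \<in> Ob A" "y \<in> Ob A" "z \<in> Ob A" "f \<in> Hom A x y" "g \<in> Hom A y z"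
    show "u x z (Cmp A x y z g f) = Cmp D (W x) (W y) (W z) (u y z g) (u x y f)"
      by (rule uniq [OF *(3), of "W x"])
        (use * in \<open>simp_all add: Cmp_assoc_eq [OF u(2)] Cmp_assoc_right\<close>)
  next
    fix x y f g c assume *: "x \<in> Ob A" "y \<in> Ob A" "f \<in> Hom A x y"
    show "u x y (Scale A x y c f) = Scale D (W x) (W y) c (u x y f)"
      by (rule uniq [OF *(2), of "W x"]) (use * in \<open>simp_all add: bilinear\<close>)
    assume g: "g \<in> Hom A x y"
    show "u x y (Add A x y f g) = Add D (W x) (W y) (u x y f) (u x y g)"
      by (rule uniq [OF *(2), of "W x"]) (use * g in \<open>simp_all add: bilinear\<close>)
  qed simp_all
  moreover have "restrict k (Ob A) \<in> nat_trans A D (make_functor A W u) M"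
    by (rule nat_transI) simp_all
  ultimately show ?thesis
    using that by simp
qed

lemma kernel_exists:
  assumes MN: "linear_functor A D M" "linear_functor A D N" and \<eta>: "\<eta> \<in> nat_trans A D M N"
  obtains W k where "linear_functor A D W" "k \<in> nat_trans A D W M"
    "\<And>x. x \<in> Ob A \<Longrightarrow> is_kernel D (FOb M x) (FOb N x) (\<eta> x) (FOb W x) (k x)" "is_kernel \<F> M N \<eta> W k"
proof -
  note [simp] = linear_functorD [OF MN(1)] linear_functorD [OF MN(2)] nat_transD(1) [OF \<eta>]
  obtain W k where ker: "\<And>x. x \<in> Ob A \<Longrightarrow> is_kernel D (FOb M x) (FOb N x) (\<eta> x) (W x) (k x)"
    using kernels [of "FOb M x" "FOb N x" "\<eta> x" for x] MN \<eta> linear_functorD(1) nat_transD(1) by metis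
  then have [simp]: "W x \<in> Ob D" "k x \<in> Hom D (W x) (FOb M x)"
    "Cmp D (W x) (FOb M x) (FOb N x) (\<eta> x) (k x) = Zero D (W x) (FOb N x)" if "x \<in> Ob A" for x
    using that by (auto simp: is_kernel_def)
  obtain V where V: "linear_functor A D V" "\<And>x. x \<in> Ob A \<Longrightarrow> FOb V x = W x" "restrict k (Ob A) \<in> nat_trans A D V M"
  proof (rule subfunctor [OF MN(1)])
    fix x y f assume [simp]: "x \<in> Ob A" "y \<in> Ob A" "f \<in> Hom A x y"
    \<comment> \<open>By naturality of \<eta>, the map \<open>M(f)\<close> carries the kernel at
      \<open>x\<close> into the kernel at \<open>y\<close>.\<close>
    have "Cmp D (W x) (FOb M y) (FOb N y) (\<eta> y) (Cmp D (W x) (FOb M x) (FOb M y) (FMor M x y f) (k x)) =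
        Zero D (W x) (FOb N y)"
      using Cmp_assoc_eq [OF nat_transD(2) [OF \<eta>, of x y f]] by (simp add: Cmp_assoc_right)
    then show "\<exists>u\<in>Hom D (W x) (W y). Cmp D (W x) (W y) (FOb M y) (k y) u =
        Cmp D (W x) (FOb M x) (FOb M y) (FMor M x y f) (k x)"
      by - (rule is_kernel_lift [OF ker [of y]]; auto)
  qed (use is_kernel_mono [OF ker] in simp_all)
  show ?thesis
    using that [OF V(1,3)] is_kernel_pointwise [OF MN V(1) \<eta> V(3)] ker V(2) by simp
qed

text \<open>A monic transformation has a zero kernel, and kernels are computed pointwise. So every
  morphism sent to zero at \<open>x\<close> factors through a zero map.\<close>

lemma is_mono_pointwise:
  assumes MN: "linear_functor A D M" "linear_functor A D N" and mono: "is_mono \<F> M N \<eta>" and x: "x \<in> Ob A"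
  shows "is_mono D (FOb M x) (FOb N x) (\<eta> x)"
proof -
  have \<eta>: "\<eta> \<in> nat_trans A D M N"
    using mono by (simp add: is_mono_def)
  obtain W k where W: "linear_functor A D W" "k \<in> nat_trans A D W M"
    "is_kernel D (FOb M x) (FOb N x) (\<eta> x) (FOb W x) (k x)" "is_kernel \<F> M N \<eta> W k"
    using kernel_exists [OF MN \<eta>] x by metis
  then have "k = Zero \<F> W M"
    using fc.is_mono_ZeroD [OF mono, of W k] MN unfolding is_kernel_def by simp
  then have k: "k x = Zero D (FOb W x) (FOb M x)"
    using x by simp
  show ?thesis
  proof (rule is_monoI)
    fix v g assume g: "v \<in> Ob D" "g \<in> Hom D v (FOb M x)" "Cmp D v (FOb M x) (FOb N x) (\<eta> x) g = Zero D v (FOb N x)"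
    then obtain t where "t \<in> Hom D v (FOb W x)" "Cmp D v (FOb W x) (FOb M x) (k x) t = g"
      using is_kernel_lift [OF W(3)] by metis
    then show "g = Zero D v (FOb M x)"
      using k g(1) x W(1) MN by (auto simp: linear_functorD)
  qed (use x MN \<eta> in \<open>auto simp: linear_functorD nat_transD\<close>)
qed

text \<open>The inverse of \<open>W(\<sigma>)\<close> is induced by \<open>m\<close>, the inverse of
  \<open>M(\<sigma>)\<close>. It maps the kernel at \<open>y\<close> to the kernel at
  \<open>x\<close>: \<open>N(\<sigma>) \<eta>_x m k_y = \<eta>_y M(\<sigma>) m k_y = \<eta>_y k_y =
  0\<close>, and \<open>N(\<sigma>)\<close> is monic.\<close>

lemma inverts_kernel:
  assumes MN: "linear_functor A D M" "linear_functor A D N" "linear_functor A D W"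
    and \<eta>: "\<eta> \<in> nat_trans A D M N" and k: "k \<in> nat_trans A D W M"
    and ker: "\<And>x. x \<in> Ob A \<Longrightarrow> is_kernel D (FOb M x) (FOb N x) (\<eta> x) (FOb W x) (k x)"
    and R: "\<And>x y \<sigma>. (x, y, \<sigma>) \<in> R \<Longrightarrow> x \<in> Ob A \<and> y \<in> Ob A \<and> \<sigma> \<in> Hom A x y"
    and inv: "inverts D M R" "inverts D N R"
  shows "inverts D W R"
  unfolding inverts_def
proof safe
  note [simp] = linear_functorD [OF MN(1)] linear_functorD [OF MN(2)] linear_functorD [OF MN(3)]
    nat_transD(1) [OF \<eta>] nat_transD(1) [OF k]
  fix x y \<sigma> assume xy: "(x, y, \<sigma>) \<in> R"
  then have [simp]: "x \<in> Ob A" "y \<in> Ob A" "\<sigma> \<in> Hom A x y"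
    using R by auto
  have mono: "is_mono D (FOb W z) (FOb M z) (k z)" if "z \<in> Ob A" for z
    using is_kernel_mono [OF ker] that by simp
  have [simp]: "Cmp D (FOb W z) (FOb M z) (FOb N z) (\<eta> z) (k z) = Zero D (FOb W z) (FOb N z)" if "z \<in> Ob A" for z
    using ker that by (simp add: is_kernel_def)
  obtain m where m [simp]: "m \<in> Hom D (FOb M y) (FOb M x)"
    "Cmp D (FOb M x) (FOb M y) (FOb M x) m (FMor M x y \<sigma>) = Idn D (FOb M x)"
    "Cmp D (FOb M y) (FOb M x) (FOb M y) (FMor M x y \<sigma>) m = Idn D (FOb M y)"
    using inv(1) xy is_isoE unfolding inverts_def by blast
  have N_mono: "is_mono D (FOb N x) (FOb N y) (FMor N x y \<sigma>)"
    using inv(2) xy is_iso_mono unfolding inverts_def by auto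
  have "Cmp D (FOb W y) (FOb M x) (FOb N x) (\<eta> x) (Cmp D (FOb W y) (FOb M y) (FOb M x) m (k y)) =
      Zero D (FOb W y) (FOb N x)"
    by (rule is_mono_ZeroD [OF N_mono])
      (simp_all add: Cmp_assoc_eq [OF nat_transD(2) [OF \<eta>, symmetric]] Cmp_assoc_eq [OF m(3)] Cmp_assoc_right)
  then obtain u where u: "u \<in> Hom D (FOb W y) (FOb W x)"
    "Cmp D (FOb W y) (FOb W x) (FOb M x) (k x) u = Cmp D (FOb W y) (FOb M y) (FOb M x) m (k y)"
    by - (rule is_kernel_lift [OF ker [of x]]; auto)
  note [simp] = u Cmp_assoc_eq [OF u(2)] Cmp_assoc_eq [OF m(2)] Cmp_assoc_eq [OF m(3)]
    nat_transD(2) [OF k] Cmp_assoc_eq [OF nat_transD(2) [OF k]] Cmp_assoc_right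
  have "Cmp D (FOb W x) (FOb W y) (FOb W x) u (FMor W x y \<sigma>) = Idn D (FOb W x)"
    by (rule is_monoD [OF mono [of x], of "FOb W x"]) simp_all
  moreover have "Cmp D (FOb W y) (FOb W x) (FOb W y) (FMor W x y \<sigma>) u = Idn D (FOb W y)"
    by (rule is_monoD [OF mono [of y], of "FOb W y"]) simp_all
  ultimately show "is_iso D (FOb W x) (FOb W y) (FMor W x y \<sigma>)"
    using u(1) by (auto simp: is_iso_def)
qed

end

section \<open>Cokernels of functors by duality\<close>

context functors
begin

interpretation op: functors "op_cat A" "op_cat D"
  by (rule functors_op)

lemma cokernel_exists:
  assumes "linear_functor A D M" "linear_functor A D N" "\<eta> \<in> nat_trans A D M N"
  obtains W c where "linear_functor A D W" "c \<in> nat_trans A D N W"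
    "\<And>x. x \<in> Ob A \<Longrightarrow> is_cokernel D (FOb M x) (FOb N x) (\<eta> x) (FOb W x) (c x)" "is_cokernel \<F> M N \<eta> W c"
proof -
  obtain W c where W: "linear_functor (op_cat A) (op_cat D) W" "c \<in> nat_trans (op_cat A) (op_cat D) W (op_fun N)"
    "\<And>x. x \<in> Ob A \<Longrightarrow> is_kernel (op_cat D) (FOb N x) (FOb M x) (\<eta> x) (FOb W x) (c x)"
    "is_kernel (functor_category (op_cat A) (op_cat D)) (op_fun N) (op_fun M) \<eta> W c"
    by (rule op.kernel_exists [of "op_fun N" "op_fun M" \<eta>]) (use assms in simp_all)
  obtain V where V: "W = op_fun V"
    using op_fun_simps(3) by metis
  show ?thesis
    using that [of V c] W by (simp add: V)
qed

lemma inverts_cokernel: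
  assumes "linear_functor A D M" "linear_functor A D N" "linear_functor A D W"
    and "\<eta> \<in> nat_trans A D M N" "c \<in> nat_trans A D N W"
    and "\<And>x. x \<in> Ob A \<Longrightarrow> is_cokernel D (FOb M x) (FOb N x) (\<eta> x) (FOb W x) (c x)"
    and R: "\<And>x y \<sigma>. (x, y, \<sigma>) \<in> R \<Longrightarrow> x \<in> Ob A \<and> y \<in> Ob A \<and> \<sigma> \<in> Hom A x y"
    and "inverts D M R" "inverts D N R"
  shows "inverts D W R"
proof -
  \<comment> \<open>The arrows to be inverted point the other way in the opposite category.\<close>
  let ?R = "(\<lambda>(x, y, \<sigma>). (y, x, \<sigma>)) ` R"
  have inv_op: "inverts (op_cat D) (op_fun M) ?R \<longleftrightarrow> inverts D M R" for M :: "('a, 'q, 'o, 'n) lfun"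
    by (auto simp: inverts_def)
  have "inverts (op_cat D) (op_fun W) ?R"
    by (rule op.inverts_kernel [of "op_fun N" "op_fun M" "op_fun W" \<eta> c])
      (use assms in \<open>auto simp: inv_op\<close>)
  then show ?thesis
    by (simp add: inv_op)
qed

text \<open>A monic transformation is monic at each object, hence at each object the kernel of its
  pointwise cokernel; pointwise kernels are kernels.\<close>

lemma mono_is_kernel_fun:
  assumes MN: "linear_functor A D M" "linear_functor A D N" and mono: "is_mono \<F> M N \<eta>"
  obtains C c where "linear_functor A D C" "c \<in> nat_trans A D N C" "is_kernel \<F> N C c M \<eta>"
proof -
  have \<eta>: "\<eta> \<in> nat_trans A D M N"
    using mono by (simp add: is_mono_def)
  obtain C c where C: "linear_functor A D C" "c \<in> nat_trans A D N C"
    "\<And>x. x \<in> Ob A \<Longrightarrow> is_cokernel D (FOb M x) (FOb N x) (\<eta> x) (FOb C x) (c x)"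
    using cokernel_exists [OF MN \<eta>] by metis
  have "is_kernel D (FOb N x) (FOb C x) (c x) (FOb M x) (\<eta> x)" if "x \<in> Ob A" for x
    using mono_kernel_of_cokernel [OF _ _ is_mono_pointwise [OF MN mono that] C(3)] MN that
    by (simp add: linear_functorD)
  then show ?thesis
    using that C is_kernel_pointwise [OF MN(2) C(1) MN(1) C(2) \<eta>] by blast
qed

end

context functors
begin

interpretation op: functors "op_cat A" "op_cat D"
  by (rule functors_op)

lemma epi_is_cokernel_fun:
  assumes "linear_functor A D M" "linear_functor A D N" "is_epi \<F> M N \<eta>"
  obtains K k where "linear_functor A D K" "k \<in> nat_trans A D K M" "is_cokernel \<F> K M k N \<eta>"
proof -
  obtain W k where W: "linear_functor (op_cat A) (op_cat D) W" "k \<in> nat_trans (op_cat A) (op_cat D) (op_fun M) W"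
    "is_kernel (functor_category (op_cat A) (op_cat D)) (op_fun M) W k (op_fun N) \<eta>"
    by (rule op.mono_is_kernel_fun [of "op_fun N" "op_fun M" \<eta>]) (use assms in simp_all)
  obtain V where V: "W = op_fun V"
    using op_fun_simps(3) by metis
  show ?thesis
    using that [of V k] W by (simp add: V)
qed

text \<open>The constant functor at a zero object sends every morphism to the identity of that
  object. It therefore inverts every set of arrows, which puts it into every subcategory considered
  later.\<close>

lemma zero_functor_exists:
  obtains Z where "linear_functor A D Z" "is_zero_object \<F> Z"
    "\<And>x y \<sigma>. \<lbrakk>x \<in> Ob A; y \<in> Ob A; \<sigma> \<in> Hom A x y\<rbrakk> \<Longrightarrow> is_iso D (FOb Z x) (FOb Z y) (FMor Z x y \<sigma>)"
proof -
  obtain z where z: "is_zero_object D z"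
    using zero_object by blast
  then have [simp]: "z \<in> Ob D"
    by (simp add: is_zero_object_def)
  have to_z: "f = g" if "f \<in> Hom D x z" "g \<in> Hom D x z" "x \<in> Ob D" for x f g
    using z that unfolding is_zero_object_def by blast
  have from_z: "f = g" if "f \<in> Hom D z x" "g \<in> Hom D z x" "x \<in> Ob D" for x f g
    using z that unfolding is_zero_object_def by blast
  define Z :: "('a, 'q, 'o, 'n) lfun" where "Z = make_functor A (\<lambda>_. z) (\<lambda>_ _ _. Idn D z)"
  have Z: "linear_functor A D Z"
    unfolding Z_def
    by (rule A.linear_functor_make) (simp_all add: to_z [of "Add D z z (Idn D z) (Idn D z)" z "Idn D z"]
      to_z [of "Scale D z z c (Idn D z)" z "Idn D z" for c])
  have [simp]: "FOb Z x = z" if "x \<in> Ob A" for x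
    using that by (simp add: Z_def)
  have "is_zero_object \<F> Z"
    unfolding is_zero_object_def
  proof (intro conjI ballI)
    fix M assume "M \<in> Ob \<F>"
    then have M: "linear_functor A D M"
      by simp
    show "\<exists>!f. f \<in> Hom \<F> M Z"
    proof (rule ex1I)
      show "Zero \<F> M Z \<in> Hom \<F> M Z"
        using M Z by (intro fc.Zero_in) simp_all
      show "f = Zero \<F> M Z" if "f \<in> Hom \<F> M Z" for f
        using fc.Zero_in [of M Z] that M Z
        by (intro nat_trans_eqI [of f A D M Z]) (auto intro!: to_z dest: nat_transD(1) simp: linear_functorD)
    qed
    show "\<exists>!f. f \<in> Hom \<F> Z M"
    proof (rule ex1I)
      show "Zero \<F> Z M \<in> Hom \<F> Z M"
        using M Z by (intro fc.Zero_in) simp_all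
      show "f = Zero \<F> Z M" if "f \<in> Hom \<F> Z M" for f
        using fc.Zero_in [of Z M] that M Z
        by (intro nat_trans_eqI [of f A D Z M]) (auto intro!: from_z dest: nat_transD(1) simp: linear_functorD)
    qed
  qed (use Z in simp)
  moreover have "is_iso D (FOb Z x) (FOb Z y) (FMor Z x y \<sigma>)"
    if "x \<in> Ob A" "y \<in> Ob A" "\<sigma> \<in> Hom A x y" for x y \<sigma>
    using that by (auto simp: Z_def is_iso_def intro!: bexI [of _ "Idn D z"])
  ultimately show ?thesis
    using that Z by blast
qed

lemma biproduct_exists:
  assumes MN: "linear_functor A D M" "linear_functor A D N"
  obtains S i1 i2 p1 p2 where "linear_functor A D S" "is_biproduct \<F> M N S i1 i2 p1 p2"
proof -
  have "\<forall>x\<in>Ob A. \<exists>s i1 i2 p1 p2. is_biproduct D (FOb M x) (FOb N x) s i1 i2 p1 p2"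
    using biproducts MN linear_functorD(1) by metis
  then obtain s i1 i2 p1 p2 where
    bip: "\<And>x. x \<in> Ob A \<Longrightarrow> is_biproduct D (FOb M x) (FOb N x) (s x) (i1 x) (i2 x) (p1 x) (p2 x)"
    by metis
  note [simp] = linear_functorD [OF MN(1)] linear_functorD [OF MN(2)]
  note [simp] = biproduct_simps [OF bip]
  have idn: "Add D (s x) (s x) (Cmp D (s x) (FOb M x) (s x) (i1 x) (p1 x)) (Cmp D (s x) (FOb N x) (s x) (i2 x) (p2 x))
      = Idn D (s x)" if "x \<in> Ob A" for x
    using bip [OF that] by (simp add: is_biproduct_def)
  \<comment> \<open>The block diagonal map with blocks \<open>M(f)\<close> and
    \<open>N(f)\<close>.\<close>
  define F\<^sub>1 where "F\<^sub>1 = (\<lambda>x y f. Add D (s x) (s y)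
    (Cmp D (s x) (FOb M y) (s y) (i1 y) (Cmp D (s x) (FOb M x) (FOb M y) (FMor M x y f) (p1 x)))
    (Cmp D (s x) (FOb N y) (s y) (i2 y) (Cmp D (s x) (FOb N x) (FOb N y) (FMor N x y f) (p2 x))))"
  define S where "S = make_functor A s F\<^sub>1"
  have S: "linear_functor A D S"
    unfolding S_def
    by (rule A.linear_functor_make)
      (simp_all add: F\<^sub>1_def idn bilinear Cmp_assoc_right Scale_add_right Add_ac)
  note [simp] = linear_functorD [OF S]
  have FObS [simp]: "FOb S x = s x" if "x \<in> Ob A" for x
    using that by (simp add: S_def)
  have [simp]: "FMor S x y f = F\<^sub>1 x y f" if "x \<in> Ob A" "y \<in> Ob A" "f \<in> Hom A x y" for x y f
    using that by (simp add: S_def)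
  have nat: "restrict i1 (Ob A) \<in> nat_trans A D M S" "restrict i2 (Ob A) \<in> nat_trans A D N S"
    "restrict p1 (Ob A) \<in> nat_trans A D S M" "restrict p2 (Ob A) \<in> nat_trans A D S N"
    by (rule nat_transI; simp add: F\<^sub>1_def bilinear Cmp_assoc_right)+
  have "is_biproduct \<F> M N S (restrict i1 (Ob A)) (restrict i2 (Ob A)) (restrict p1 (Ob A)) (restrict p2 (Ob A))"
    unfolding is_biproduct_def using S nat by (simp add: idn cong: restrict_cong)
  then show ?thesis
    using that S by blast
qed

lemma inverts_biproduct:
  assumes MN: "linear_functor A D M" "linear_functor A D N"
    and bip: "is_biproduct \<F> M N S i1 i2 p1 p2"
    and R: "\<And>x y \<sigma>. (x, y, \<sigma>) \<in> R \<Longrightarrow> x \<in> Ob A \<and> y \<in> Ob A \<and> \<sigma> \<in> Hom A x y"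
    and inv: "inverts D M R" "inverts D N R"
  shows "inverts D S R"
  unfolding inverts_def
proof safe
  have S: "linear_functor A D S" and nat: "i1 \<in> nat_trans A D M S" "i2 \<in> nat_trans A D N S"
    "p1 \<in> nat_trans A D S M" "p2 \<in> nat_trans A D S N"
    using bip by (simp_all add: is_biproduct_def)
  note [simp] = linear_functorD [OF MN(1)] linear_functorD [OF MN(2)] linear_functorD [OF S]
    nat_transD(1) [OF nat(1)] nat_transD(1) [OF nat(2)] nat_transD(1) [OF nat(3)] nat_transD(1) [OF nat(4)]
  have bipx: "is_biproduct D (FOb M x) (FOb N x) (FOb S x) (i1 x) (i2 x) (p1 x) (p2 x)" if "x \<in> Ob A" for x
  proof -
    \<comment> \<open>Equations between natural transformations are equations between restricted
      functions; they are evaluated at \<open>x\<close> to obtain a biproduct in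
      \<open>D\<close>.\<close>
    have eqD: "f x = g x" if "restrict f (Ob A) = restrict g (Ob A)" for f g :: "'a \<Rightarrow> 'n"
      using fun_cong [OF that, of x] \<open>x \<in> Ob A\<close> by simp
    show ?thesis
      using bip that unfolding is_biproduct_def functor_category_simps
      by (auto dest!: eqD)
  qed
  note [simp] = biproduct_simps [OF bipx]
  fix x y \<sigma> assume xy: "(x, y, \<sigma>) \<in> R"
  then have [simp]: "x \<in> Ob A" "y \<in> Ob A" "\<sigma> \<in> Hom A x y"
    using R by auto
  obtain m where m [simp]: "m \<in> Hom D (FOb M y) (FOb M x)"
    "Cmp D (FOb M x) (FOb M y) (FOb M x) m (FMor M x y \<sigma>) = Idn D (FOb M x)"
    "Cmp D (FOb M y) (FOb M x) (FOb M y) (FMor M x y \<sigma>) m = Idn D (FOb M y)"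
    using inv(1) xy is_isoE unfolding inverts_def by blast
  obtain n where n [simp]: "n \<in> Hom D (FOb N y) (FOb N x)"
    "Cmp D (FOb N x) (FOb N y) (FOb N x) n (FMor N x y \<sigma>) = Idn D (FOb N x)"
    "Cmp D (FOb N y) (FOb N x) (FOb N y) (FMor N x y \<sigma>) n = Idn D (FOb N y)"
    using inv(2) xy is_isoE unfolding inverts_def by blast
  \<comment> \<open>The inverse of a block diagonal map is block diagonal; naturality of the
    inclusions and projections identifies \<open>S(\<sigma>)\<close> as such a map.\<close>
  let ?u = "Add D (FOb S y) (FOb S x)
    (Cmp D (FOb S y) (FOb M x) (FOb S x) (i1 x) (Cmp D (FOb S y) (FOb M y) (FOb M x) m (p1 y)))
    (Cmp D (FOb S y) (FOb N x) (FOb S x) (i2 x) (Cmp D (FOb S y) (FOb N y) (FOb N x) n (p2 y)))"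
  note [simp] = bilinear Cmp_assoc_right Cmp_assoc_eq [OF m(2)] Cmp_assoc_eq [OF m(3)]
    Cmp_assoc_eq [OF n(2)] Cmp_assoc_eq [OF n(3)]
  have "Cmp D (FOb S x) (FOb S y) (FOb S x) ?u (FMor S x y \<sigma>) = Idn D (FOb S x)"
    using bipx [of x]
    by (simp add: nat_transD(2) [OF nat(3)] nat_transD(2) [OF nat(4)] is_biproduct_def)
  moreover have "Cmp D (FOb S y) (FOb S x) (FOb S y) (FMor S x y \<sigma>) ?u = Idn D (FOb S y)"
    using bipx [of y]
    by (simp add: Cmp_assoc_eq [OF nat_transD(2) [OF nat(1), symmetric]]
        Cmp_assoc_eq [OF nat_transD(2) [OF nat(2), symmetric]] is_biproduct_def)
  ultimately show "is_iso D (FOb S x) (FOb S y) (FMor S x y \<sigma>)"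
    by (auto simp: is_iso_def intro!: bexI [of _ ?u])
qed

section \<open>The functor category is abelian, and functors inverting arrows form a wide
  subcategory\<close>

lemma abelian_category_functors: "abelian_category \<F>"
proof unfold_locales
  show "\<exists>z. is_zero_object \<F> z"
    using zero_functor_exists by metis
  show "\<exists>s i1 i2 p1 p2. is_biproduct \<F> a b s i1 i2 p1 p2" if "a \<in> Ob \<F>" "b \<in> Ob \<F>" for a b
    using biproduct_exists [of a b] that by simp metis
  show "\<exists>w k. is_kernel \<F> x y f w k" if "x \<in> Ob \<F>" "y \<in> Ob \<F>" "f \<in> Hom \<F> x y" for x y f
    using kernel_exists [of x y f] that by simp metis
  show "\<exists>w k. is_cokernel \<F> x y f w k" if "x \<in> Ob \<F>" "y \<in> Ob \<F>" "f \<in> Hom \<F> x y" for x y f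
    using cokernel_exists [of x y f] that by simp metis
  show "\<exists>z\<in>Ob \<F>. \<exists>g\<in>Hom \<F> y z. is_kernel \<F> y z g x f" if "x \<in> Ob \<F>" "y \<in> Ob \<F>" "is_mono \<F> x y f" for x y f
    using mono_is_kernel_fun [of x y f] that by simp metis
  show "\<exists>z\<in>Ob \<F>. \<exists>g\<in>Hom \<F> z x. is_cokernel \<F> z x g y f" if "x \<in> Ob \<F>" "y \<in> Ob \<F>" "is_epi \<F> x y f" for x y f
    using epi_is_cokernel_fun [of x y f] that by simp metis
qed

text \<open>Stated for any family of sets of arrows directed under reverse inclusion. The index type
  is abstract, with screens and their in-pixel arrows as the intended case. A common index for two
  functors reduces every closure condition to a single set of arrows.\<close>

theorem wide_subset_inverts:
  fixes R :: "'p \<Rightarrow> ('a \<times> 'a \<times> 'q) set"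
  assumes R: "\<And>P x y \<sigma>. \<lbrakk>P \<in> L; (x, y, \<sigma>) \<in> R P\<rbrakk> \<Longrightarrow> x \<in> Ob A \<and> y \<in> Ob A \<and> \<sigma> \<in> Hom A x y"
    and L: "L \<noteq> {}" and directed: "\<And>P Q. \<lbrakk>P \<in> L; Q \<in> L\<rbrakk> \<Longrightarrow> \<exists>U\<in>L. R U \<subseteq> R P \<inter> R Q"
  shows "wide_subset \<F> {M \<in> Ob \<F>. \<exists>P\<in>L. inverts D M (R P)}" (is "wide_subset \<F> ?S")
proof -
  interpret fc: abelian_category \<F>
    by (rule abelian_category_functors)
  have common: "\<exists>P\<in>L. inverts D M (R P) \<and> inverts D N (R P)" if MN: "M \<in> ?S" "N \<in> ?S" for M N
  proof -
    obtain P Q where "P \<in> L" "Q \<in> L" "inverts D M (R P)" "inverts D N (R Q)"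
      using MN by blast
    then show ?thesis
      using directed [of P Q] unfolding inverts_def by blast
  qed
  show ?thesis
  proof unfold_locales
    obtain Z where Z: "linear_functor A D Z" "is_zero_object \<F> Z"
      "\<And>x y \<sigma>. \<lbrakk>x \<in> Ob A; y \<in> Ob A; \<sigma> \<in> Hom A x y\<rbrakk> \<Longrightarrow> is_iso D (FOb Z x) (FOb Z y) (FMor Z x y \<sigma>)"
      using zero_functor_exists by metis
    have "inverts D Z (R P)" if "P \<in> L" for P
      using Z(3) R that unfolding inverts_def by blast
    then have "Z \<in> ?S"
      using L Z(1) by auto
    then show "\<exists>z\<in>?S. is_zero_object \<F> z"
      using Z(2) by blast
  next
    fix M N assume MN: "M \<in> Ob \<F> \<inter> ?S" "N \<in> Ob \<F> \<inter> ?S"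
    then have MN_fun: "linear_functor A D M" "linear_functor A D N"
      by simp_all
    obtain P where P: "P \<in> L" "inverts D M (R P)" "inverts D N (R P)"
      using common MN by blast
    obtain S i1 i2 p1 p2 where S: "linear_functor A D S" "is_biproduct \<F> M N S i1 i2 p1 p2"
      using biproduct_exists [OF MN_fun] by metis
    have "S \<in> ?S"
      using inverts_biproduct [OF MN_fun S(2) R [OF P(1)] P(2,3)] S(1) P(1) by auto
    then show "\<exists>s\<in>?S. \<exists>i1 i2 p1 p2. is_biproduct \<F> M N s i1 i2 p1 p2"
      using S(2) by blast
    fix \<eta> assume \<eta>: "\<eta> \<in> Hom \<F> M N"
    then have \<eta>': "\<eta> \<in> nat_trans A D M N"
      by simp
    obtain W k where W: "linear_functor A D W" "k \<in> nat_trans A D W M"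
      "\<And>x. x \<in> Ob A \<Longrightarrow> is_kernel D (FOb M x) (FOb N x) (\<eta> x) (FOb W x) (k x)" "is_kernel \<F> M N \<eta> W k"
      using kernel_exists [OF MN_fun \<eta>'] by metis
    have "W \<in> ?S"
      using inverts_kernel [OF MN_fun W(1) \<eta>' W(2,3) R [OF P(1)] P(2,3)] W(1) P(1) by auto
    then show "\<exists>w\<in>?S. \<exists>k. is_kernel \<F> M N \<eta> w k"
      using W(4) by blast
    obtain C c where C: "linear_functor A D C" "c \<in> nat_trans A D N C"
      "\<And>x. x \<in> Ob A \<Longrightarrow> is_cokernel D (FOb M x) (FOb N x) (\<eta> x) (FOb C x) (c x)" "is_cokernel \<F> M N \<eta> C c"
      using cokernel_exists [OF MN_fun \<eta>'] by metis
    have "C \<in> ?S"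
      using inverts_cokernel [OF MN_fun C(1) \<eta>' C(2,3) R [OF P(1)] P(2,3)] C(1) P(1) by auto
    then show "\<exists>w\<in>?S. \<exists>c. is_cokernel \<F> M N \<eta> w c"
      using C(4) by blast
  qed
qed

end

section \<open>Quotient categories\<close>

lemma quotient_simps [simp]:
  "Ob (quotient_category D I) = Ob D"
  "Hom (quotient_category D I) x y = coset D I x y ` Hom D x y"
  "Idn (quotient_category D I) x = coset D I x x (Idn D x)"
  "Zero (quotient_category D I) x y = coset D I x y (Zero D x y)"
  by (simp_all add: quotient_category_def)

locale category_ideal = linear_category D
  for D :: "('o, 'm, 'k::{comm_ring,comm_monoid_mult}) lcat" +
  fixes I :: "'o \<Rightarrow> 'o \<Rightarrow> 'm set"
  assumes ideal: "is_ideal D I"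
begin

lemma ideal_simps [simp]:
  "\<lbrakk>x \<in> Ob D; y \<in> Ob D; i \<in> I x y\<rbrakk> \<Longrightarrow> i \<in> Hom D x y"
  "\<lbrakk>x \<in> Ob D; y \<in> Ob D\<rbrakk> \<Longrightarrow> Zero D x y \<in> I x y"
  "\<lbrakk>x \<in> Ob D; y \<in> Ob D; i \<in> I x y; j \<in> I x y\<rbrakk> \<Longrightarrow> Add D x y i j \<in> I x y"
  "\<lbrakk>x \<in> Ob D; y \<in> Ob D; i \<in> I x y\<rbrakk> \<Longrightarrow> Scale D x y c i \<in> I x y"
  "\<lbrakk>x \<in> Ob D; y \<in> Ob D; z \<in> Ob D; i \<in> I x y; g \<in> Hom D y z\<rbrakk> \<Longrightarrow> Cmp D x y z g i \<in> I x z"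
  "\<lbrakk>x \<in> Ob D; y \<in> Ob D; z \<in> Ob D; f \<in> Hom D x y; i \<in> I y z\<rbrakk> \<Longrightarrow> Cmp D x y z i f \<in> I x z"
  using ideal unfolding is_ideal_def by blast+

lemma coset_memE:
  assumes "h \<in> coset D I x y f"
  obtains i where "i \<in> I x y" "h = Add D x y f i"
  using assms by (auto simp: coset_def)

lemma coset_self: "\<lbrakk>x \<in> Ob D; y \<in> Ob D; f \<in> Hom D x y\<rbrakk> \<Longrightarrow> f \<in> coset D I x y f"
  by (auto simp: coset_def intro!: image_eqI [of _ _ "Zero D x y"])

lemma coset_Add:
  assumes xy: "x \<in> Ob D" "y \<in> Ob D" and f: "f \<in> Hom D x y" and i: "i \<in> I x y"
  shows "coset D I x y (Add D x y f i) = coset D I x y f"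
proof -
  have sub: "coset D I x y (Add D x y f i) \<subseteq> coset D I x y f"
    if "f \<in> Hom D x y" "i \<in> I x y" for f i
    using xy that by (auto simp: coset_def Add_assoc)
  have "Add D x y (Add D x y f i) (Scale D x y (- 1) i) = f"
    using assms by (simp add: Add_assoc)
  then show ?thesis
    using sub [OF f i] sub [of "Add D x y f i" "Scale D x y (- 1) i"] assms by auto
qed

lemma coset_eq_Zero_iff:
  assumes "x \<in> Ob D" "y \<in> Ob D" "f \<in> Hom D x y"
  shows "coset D I x y f = coset D I x y (Zero D x y) \<longleftrightarrow> f \<in> I x y"
proof
  assume "coset D I x y f = coset D I x y (Zero D x y)"
  then obtain i where "i \<in> I x y" "f = Add D x y (Zero D x y) i"
    using coset_self [OF assms] coset_memE by metis
  then show "f \<in> I x y"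
    using assms by simp
next
  assume "f \<in> I x y"
  then show "coset D I x y f = coset D I x y (Zero D x y)"
    using coset_Add [of x y "Zero D x y" f] assms by simp
qed

text \<open>\<open>quotient_category\<close> defines its operations as unions over all
  representatives. If every representative gives the same set, the union is that set, because a
  coset is nonempty.\<close>

lemma coset_UN:
  assumes "x \<in> Ob D" "y \<in> Ob D" "f \<in> Hom D x y" "\<And>i. i \<in> I x y \<Longrightarrow> F (Add D x y f i) = c"
  shows "(\<Union>h\<in>coset D I x y f. F h) = c"
proof -
  have "F h = c" if "h \<in> coset D I x y f" for h
    using that assms(4) by (auto simp: coset_def)
  then show ?thesis
    using coset_self [OF assms(1-3)] by auto
qed

lemma quotient_Cmp [simp]:
  assumes "x \<in> Ob D" "y \<in> Ob D" "z \<in> Ob D" "f \<in> Hom D x y" "g \<in> Hom D y z"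
  shows "Cmp (quotient_category D I) x y z (coset D I y z g) (coset D I x y f) = coset D I x z (Cmp D x y z g f)"
proof -
  have "coset D I x z (Cmp D x y z (Add D y z g j) (Add D x y f i)) = coset D I x z (Cmp D x y z g f)"
    if "i \<in> I x y" "j \<in> I y z" for i j
  proof -
    \<comment> \<open>Changing representatives alters the composite by
      \<open>g i + j (f + i)\<close>, which lies in the ideal.\<close>
    have "Cmp D x y z (Add D y z g j) (Add D x y f i) =
        Add D x z (Cmp D x y z g f) (Add D x z (Cmp D x y z g i) (Cmp D x y z j (Add D x y f i)))"
      using that assms by (simp add: bilinear Add_ac)
    then show ?thesis
      using that assms by (simp add: coset_Add)
  qed
  then show ?thesis
    using assms by (simp add: quotient_category_def coset_UN)
qed

lemma quotient_Add [simp]: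
  assumes "x \<in> Ob D" "y \<in> Ob D" "f \<in> Hom D x y" "g \<in> Hom D x y"
  shows "Add (quotient_category D I) x y (coset D I x y f) (coset D I x y g) = coset D I x y (Add D x y f g)"
proof -
  have "coset D I x y (Add D x y (Add D x y f i) (Add D x y g j)) = coset D I x y (Add D x y f g)"
    if "i \<in> I x y" "j \<in> I x y" for i j
  proof -
    have "Add D x y (Add D x y f i) (Add D x y g j) = Add D x y (Add D x y f g) (Add D x y i j)"
      using that assms by (simp add: Add_ac)
    then show ?thesis
      using that assms by (simp add: coset_Add)
  qed
  then show ?thesis
    using assms by (simp add: quotient_category_def coset_UN)
qed

lemma quotient_Scale [simp]:
  assumes "x \<in> Ob D" "y \<in> Ob D" "f \<in> Hom D x y"
  shows "Scale (quotient_category D I) x y c (coset D I x y f) = coset D I x y (Scale D x y c f)"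
  using assms by (simp add: quotient_category_def coset_UN Scale_add_right coset_Add)

lemma linear_category_quotient: "linear_category (quotient_category D I)"
proof unfold_locales
  fix x y f assume "x \<in> Ob (quotient_category D I)" "y \<in> Ob (quotient_category D I)"
    "f \<in> Hom (quotient_category D I) x y"
  then obtain h where h: "x \<in> Ob D" "y \<in> Ob D" "h \<in> Hom D x y" "f = coset D I x y h"
    by auto
  then have "Add (quotient_category D I) x y f (coset D I x y (Scale D x y (- 1) h)) =
      Zero (quotient_category D I) x y"
    by simp
  then show "\<exists>g\<in>Hom (quotient_category D I) x y.
      Add (quotient_category D I) x y f g = Zero (quotient_category D I) x y"
    using h by (intro bexI [of _ "coset D I x y (Scale D x y (- 1) h)"]) simp_all
qed (auto simp: Cmp_assoc Add_ac Scale_one Scale_mult Scale_add_left Scale_add_right bilinear)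

end

section \<open>The path category\<close>

text \<open>In the real line intervals are the connected sets, so a continuous map sends intervals
  to intervals. The reparametrisations used below are piecewise linear.\<close>

lemma reparamI:
  assumes "\<And>t. t \<in> {0..1} \<Longrightarrow> \<phi> t \<in> {0..1}" "mono_on {0..1} \<phi>" "continuous_on {0..1} \<phi>"
  shows "reparam \<phi>"
  unfolding reparam_def
proof (intro conjI allI impI)
  fix J :: "real set" assume "J \<subseteq> {0..1}" "is_interval J"
  then show "is_interval (\<phi> ` J)"
    using assms(3) by (meson connected_continuous_image continuous_on_subset is_interval_connected_1)
qed (use assms in auto)

lemma pconcat_0 [simp]: "(\<gamma> \<cdot> \<gamma>') 0 = \<gamma> 0"
  and pconcat_1 [simp]: "(\<gamma> \<cdot> \<gamma>') 1 = \<gamma>' 1"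
  and const_path_0 [simp]: "const_path x 0 = x"
  and const_path_1 [simp]: "const_path x 1 = x"
  by (simp_all add: pconcat_def const_path_def)

lemma im_const_path [simp]: "im (const_path x) = {x}"
  by (auto simp: im_def const_path_def intro!: image_eqI [of _ _ 0])

lemma im_pconcat:
  assumes "\<gamma> 1 = \<gamma>' 0"
  shows "im (\<gamma> \<cdot> \<gamma>') = im \<gamma> \<union> im \<gamma>'"
proof
  show "im (\<gamma> \<cdot> \<gamma>') \<subseteq> im \<gamma> \<union> im \<gamma>'"
    by (auto simp: im_def pconcat_def intro!: imageI split: if_splits)
  have "\<gamma> t \<in> im (\<gamma> \<cdot> \<gamma>')" if "t \<in> {0..1}" for t
    using that by (auto simp: im_def pconcat_def intro!: image_eqI [of _ _ "t/2"])
  moreover have "\<gamma>' t \<in> im (\<gamma> \<cdot> \<gamma>')" if "t \<in> {0..1}" for t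
  proof -
    have "2 * ((t + 1) / 2) - 1 = t"
      by (simp add: field_simps)
    \<comment> \<open>At \<open>t = 0\<close> the point is \<open>1/2\<close>, where the
      concatenation still follows the first path; the two paths agree there because \<gamma> ends
      where \<open>\<gamma>'\<close> starts.\<close>
    then have "(\<gamma> \<cdot> \<gamma>') ((t + 1) / 2) = \<gamma>' t"
      using that assms by (cases "t = 0") (simp_all add: pconcat_def)
    moreover have "(t + 1) / 2 \<in> {0..1}"
      using that by simp
    ultimately show ?thesis
      unfolding im_def by (metis imageI)
  qed
  ultimately show "im \<gamma> \<union> im \<gamma>' \<subseteq> im (\<gamma> \<cdot> \<gamma>')"
    by (auto simp: im_def)
qed

section \<open>Paths up to equivalence form a category\<close>

context path_triple
begin

lemma Eqv_in_Paths: "(\<gamma>, \<gamma>') \<in> Eqv T \<Longrightarrow> \<gamma> \<in> Paths T \<and> \<gamma>' \<in> Paths T"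
  using triple_equiv by (auto simp: equiv_def refl_on_def)

lemma Eqv_refl: "\<gamma> \<in> Paths T \<Longrightarrow> (\<gamma>, \<gamma>) \<in> Eqv T"
  using triple_equiv by (auto simp: equiv_def refl_on_def)

lemma Eqv_sym: "(\<gamma>, \<gamma>') \<in> Eqv T \<Longrightarrow> (\<gamma>', \<gamma>) \<in> Eqv T"
  using triple_equiv by (auto simp: equiv_def sym_def)

lemma Eqv_trans: "\<lbrakk>(\<gamma>, \<gamma>') \<in> Eqv T; (\<gamma>', \<gamma>'') \<in> Eqv T\<rbrakk> \<Longrightarrow> (\<gamma>, \<gamma>'') \<in> Eqv T"
  using triple_equiv by (auto simp: equiv_def intro: transD)

lemma path_extensional: "\<gamma> \<in> Paths T \<Longrightarrow> t \<notin> {0..1} \<Longrightarrow> \<gamma> t = undefined"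
  using triple_paths by (auto simp: PiE_def extensional_def)

lemma path_Pts: "\<gamma> \<in> Paths T \<Longrightarrow> t \<in> {0..1} \<Longrightarrow> \<gamma> t \<in> Pts T"
  using triple_paths by (meson PiE_mem subsetD)

lemma path_ends [simp]: "\<gamma> \<in> Paths T \<Longrightarrow> \<gamma> 0 \<in> Pts T" "\<gamma> \<in> Paths T \<Longrightarrow> \<gamma> 1 \<in> Pts T"
  by (simp_all add: path_Pts)

text \<open>Paths are extensional, so an identity on the unit interval determines the reparametrised
  path.\<close>

lemma Eqv_reparam:
  assumes "\<gamma> \<in> Paths T" "\<And>t. t \<in> {0..1} \<Longrightarrow> \<phi> t \<in> {0..1}" "mono_on {0..1} \<phi>" "continuous_on {0..1} \<phi>"
    and "\<phi> 0 = 0" "\<phi> 1 = 1" and \<delta>: "\<delta> \<in> Paths T" "\<And>t. t \<in> {0..1} \<Longrightarrow> \<delta> t = \<gamma> (\<phi> t)"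
  shows "(\<gamma>, \<delta>) \<in> Eqv T"
proof -
  have "\<delta> = compose {0..1} \<gamma> \<phi>"
    using \<delta> path_extensional [OF \<delta>(1)] by (auto simp: compose_def fun_eq_iff)
  then show ?thesis
    using triple_reparam_eqv [OF assms(1) reparamI] assms by simp
qed

text \<open>The reparametrisation waits at \<open>0\<close> during the first half and then runs at
  double speed.\<close>

lemma const_concat:
  assumes "\<gamma> \<in> Paths T"
  shows "(const_path (\<gamma> 0) \<cdot> \<gamma>, \<gamma>) \<in> Eqv T"
proof (rule Eqv_sym, rule Eqv_reparam [where \<phi> = "\<lambda>t. max 0 (2 * t - 1)"])
  fix t :: real assume t: "t \<in> {0..1}"
  have "max 0 (2 * t - 1) = (if t \<le> 1/2 then 0 else 2 * t - 1)"
    by simp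
  then show "(const_path (\<gamma> 0) \<cdot> \<gamma>) t = \<gamma> (max 0 (2 * t - 1))"
    using t by (simp add: pconcat_def const_path_def)
qed (use assms in \<open>auto simp: triple_concat triple_const mono_on_def intro!: continuous_intros\<close>)

lemma concat_const:
  assumes "\<gamma> \<in> Paths T"
  shows "(\<gamma> \<cdot> const_path (\<gamma> 1), \<gamma>) \<in> Eqv T"
proof (rule Eqv_sym, rule Eqv_reparam [where \<phi> = "\<lambda>t. min 1 (2 * t)"])
  fix t :: real assume t: "t \<in> {0..1}"
  have "min 1 (2 * t) = (if t \<le> 1/2 then 2 * t else 1)"
    by simp
  then show "(\<gamma> \<cdot> const_path (\<gamma> 1)) t = \<gamma> (min 1 (2 * t))"
    using t by (simp add: pconcat_def const_path_def)
qed (use assms in \<open>auto simp: triple_concat triple_const mono_on_def intro!: continuous_intros\<close>)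

text \<open>The reparametrisation takes the break points \<open>1/4\<close>, \<open>1/2\<close> of
  the left bracketing to the break points \<open>1/2\<close>, \<open>3/4\<close> of the right one.
  Its slopes \<open>2\<close>, \<open>1\<close>, \<open>1/2\<close> decrease, so it is the minimum
  of three increasing affine functions, which makes monotonicity and continuity evident.\<close>

lemma concat_assoc:
  assumes "\<alpha> \<in> Paths T" "\<beta> \<in> Paths T" "\<gamma> \<in> Paths T" "\<alpha> 1 = \<beta> 0" "\<beta> 1 = \<gamma> 0"
  shows "(\<alpha> \<cdot> (\<beta> \<cdot> \<gamma>), \<alpha> \<cdot> \<beta> \<cdot> \<gamma>) \<in> Eqv T"
proof (rule Eqv_reparam [where \<phi> = "\<lambda>t. min (2 * t) (min (t + 1/4) (t/2 + 1/2))"])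
  fix t :: real assume t: "t \<in> {0..1}"
  consider "t \<le> 1/4" | "1/4 < t" "t \<le> 1/2" | "1/2 < t"
    by linarith
  then show "(\<alpha> \<cdot> \<beta> \<cdot> \<gamma>) t = (\<alpha> \<cdot> (\<beta> \<cdot> \<gamma>)) (min (2 * t) (min (t + 1/4) (t/2 + 1/2)))"
  proof cases
    case 1
    then have "min (2 * t) (min (t + 1/4) (t/2 + 1/2)) = 2 * t"
      by simp
    then show ?thesis
      using 1 t by (simp add: pconcat_def)
  next
    case 2
    then have "min (2 * t) (min (t + 1/4) (t/2 + 1/2)) = t + 1/4"
      by simp
    then show ?thesis
      using 2 t by (simp add: pconcat_def)
  next
    case 3
    then have "min (2 * t) (min (t + 1/4) (t/2 + 1/2)) = t/2 + 1/2"
      by simp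
    then show ?thesis
      using 3 t by (simp add: pconcat_def)
  qed
qed (use assms in \<open>auto simp: triple_concat mono_on_def intro!: continuous_intros\<close>)

text \<open>\<open>triple_cancel\<close> replaces the middle one of three paths. A constant path
  fills the free slot, first in front while \<gamma> is replaced, then behind while \<delta> is
  replaced, and is removed again each time.\<close>

lemma concat_cong:
  assumes "(\<gamma>, \<gamma>') \<in> Eqv T" "(\<delta>, \<delta>') \<in> Eqv T" "\<gamma> 1 = \<delta> 0"
  shows "(\<gamma> \<cdot> \<delta>, \<gamma>' \<cdot> \<delta>') \<in> Eqv T"
proof -
  have p [simp]: "\<gamma> \<in> Paths T" "\<gamma>' \<in> Paths T" "\<delta> \<in> Paths T" "\<delta>' \<in> Paths T"
    using Eqv_in_Paths assms by auto
  have e [simp]: "\<gamma>' 0 = \<gamma> 0" "\<gamma>' 1 = \<delta> 0" "\<delta>' 0 = \<delta> 0" "\<delta>' 1 = \<delta> 1"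
    using triple_endpoints [OF assms(1)] triple_endpoints [OF assms(2)] assms(3) by auto
  have *: "(const_path (\<gamma> 0) \<cdot> \<alpha> \<cdot> \<delta>, \<alpha> \<cdot> \<delta>) \<in> Eqv T"
    if "\<alpha> \<in> Paths T" "\<alpha> 0 = \<gamma> 0" "\<alpha> 1 = \<delta> 0" for \<alpha>
    using concat_assoc [of "const_path (\<gamma> 0)" \<alpha> \<delta>] const_concat [of "\<alpha> \<cdot> \<delta>"] that
    by (metis Eqv_sym Eqv_trans const_path_1 p(1,3) path_ends(1) pconcat_0 triple_concat triple_const)
  have "(const_path (\<gamma> 0) \<cdot> \<gamma> \<cdot> \<delta>, const_path (\<gamma> 0) \<cdot> \<gamma>' \<cdot> \<delta>) \<in> Eqv T"
    using triple_cancel [of \<gamma> \<gamma>' "const_path (\<gamma> 0)" \<delta>] assms by (simp add: triple_const)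
  then have 1: "(\<gamma> \<cdot> \<delta>, \<gamma>' \<cdot> \<delta>) \<in> Eqv T"
    using * [of \<gamma>] * [of \<gamma>'] assms(3) p e by (metis Eqv_sym Eqv_trans)
  have "(\<gamma>' \<cdot> \<delta> \<cdot> const_path (\<delta> 1), \<gamma>' \<cdot> \<delta>' \<cdot> const_path (\<delta> 1)) \<in> Eqv T"
    using triple_cancel [of \<delta> \<delta>' \<gamma>' "const_path (\<delta> 1)"] assms by (simp add: triple_const)
  moreover have "(\<gamma>' \<cdot> \<delta> \<cdot> const_path (\<delta> 1), \<gamma>' \<cdot> \<delta>) \<in> Eqv T"
    using concat_const [of "\<gamma>' \<cdot> \<delta>"] by (simp add: triple_concat)
  moreover have "(\<gamma>' \<cdot> \<delta>' \<cdot> const_path (\<delta> 1), \<gamma>' \<cdot> \<delta>') \<in> Eqv T"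
    using concat_const [of "\<gamma>' \<cdot> \<delta>'"] by (simp add: triple_concat)
  ultimately have "(\<gamma>' \<cdot> \<delta>, \<gamma>' \<cdot> \<delta>') \<in> Eqv T"
    using Eqv_sym Eqv_trans by blast
  then show ?thesis
    using 1 Eqv_trans by blast
qed

lemma path_class_eq_iff:
  "\<lbrakk>\<gamma> \<in> Paths T; \<gamma>' \<in> Paths T\<rbrakk> \<Longrightarrow> path_class T \<gamma> = path_class T \<gamma>' \<longleftrightarrow> (\<gamma>, \<gamma>') \<in> Eqv T"
  unfolding path_class_def using eq_equiv_class_iff [OF triple_equiv] by blast

lemma class_concat_path_class [simp]:
  assumes "\<gamma> \<in> Paths T" "\<gamma>' \<in> Paths T" "\<gamma> 1 = \<gamma>' 0"
  shows "class_concat T (path_class T \<gamma>) (path_class T \<gamma>') = path_class T (\<gamma> \<cdot> \<gamma>')"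
proof -
  have "path_class T (\<delta> \<cdot> \<delta>') = path_class T (\<gamma> \<cdot> \<gamma>')"
    if "\<delta> \<in> path_class T \<gamma>" "\<delta>' \<in> path_class T \<gamma>'" for \<delta> \<delta>'
  proof -
    have "(\<gamma> \<cdot> \<gamma>', \<delta> \<cdot> \<delta>') \<in> Eqv T"
      using that assms by (auto simp: path_class_def intro: concat_cong)
    then show ?thesis
      using path_class_eq_iff Eqv_in_Paths by blast
  qed
  moreover have "\<gamma> \<in> path_class T \<gamma>" "\<gamma>' \<in> path_class T \<gamma>'"
    using assms Eqv_refl by (auto simp: path_class_def)
  ultimately show ?thesis
    unfolding class_concat_def by blast
qed

end

section \<open>The linear category spanned by path classes\<close>

definition path_comp ::
  "'x triple \<Rightarrow> ('x, 'k::{comm_ring,comm_monoid_mult}) path_mor \<Rightarrow> ('x, 'k) path_mor \<Rightarrow> ('x, 'k) path_mor" where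
  "path_comp T g f = (\<Sum>p\<in>Poly_Mapping.keys f. \<Sum>q\<in>Poly_Mapping.keys g.
     Poly_Mapping.single (class_concat T p q) (Poly_Mapping.lookup g q * Poly_Mapping.lookup f p))"

lemma path_category_simps [simp]:
  fixes T :: "'x triple"
  shows "Ob (path_category T :: (_, ('x, 'k::{comm_ring,comm_monoid_mult}) path_mor, 'k) lcat) = insert None (Some ` Pts T)"
    "Hom (path_category T :: (_, ('x, 'k) path_mor, 'k) lcat) = path_hom T"
    "Cmp (path_category T :: (_, ('x, 'k) path_mor, 'k) lcat) x y z = path_comp T"
    "Add (path_category T :: (_, ('x, 'k) path_mor, 'k) lcat) x y = (+)"
    "Zero (path_category T :: (_, ('x, 'k) path_mor, 'k) lcat) x y = 0"
    "Scale (path_category T :: (_, ('x, 'k) path_mor, 'k) lcat) x y = (\<lambda>c. Poly_Mapping.map ((*) c))"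
    "Idn (path_category T :: (_, ('x, 'k) path_mor, 'k) lcat) None = 0"
    "Idn (path_category T :: (_, ('x, 'k) path_mor, 'k) lcat) (Some a) = path_morphism T (const_path a)"
  by (simp_all add: path_category_def fun_eq_iff path_comp_def path_morphism_def)

lemma lookup_scale [simp]:
  "Poly_Mapping.lookup (Poly_Mapping.map ((*) c) f) k = (c::'k::mult_zero) * Poly_Mapping.lookup f k"
  by (simp add: map.rep_eq when_def)

text \<open>Terms outside the supports have coefficient zero. Additivity needs a common index set,
  since cancellation may make the support of a sum smaller than the union of the supports.\<close>

lemma path_comp_superset:
  assumes "finite A" "finite B" "Poly_Mapping.keys f \<subseteq> A" "Poly_Mapping.keys g \<subseteq> B"
  shows "path_comp T g f = (\<Sum>p\<in>A. \<Sum>q\<in>B.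
    Poly_Mapping.single (class_concat T p q) (Poly_Mapping.lookup g q * Poly_Mapping.lookup f p))"
proof -
  have "(\<Sum>q\<in>Poly_Mapping.keys g.
        Poly_Mapping.single (class_concat T p q) (Poly_Mapping.lookup g q * Poly_Mapping.lookup f p)) =
      (\<Sum>q\<in>B. Poly_Mapping.single (class_concat T p q) (Poly_Mapping.lookup g q * Poly_Mapping.lookup f p))" for p
    using assms by (intro sum.mono_neutral_left) (auto simp: in_keys_iff)
  then have "path_comp T g f = (\<Sum>p\<in>Poly_Mapping.keys f. \<Sum>q\<in>B.
      Poly_Mapping.single (class_concat T p q) (Poly_Mapping.lookup g q * Poly_Mapping.lookup f p))"
    by (simp add: path_comp_def)
  also have "\<dots> = (\<Sum>p\<in>A. \<Sum>q\<in>B.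
      Poly_Mapping.single (class_concat T p q) (Poly_Mapping.lookup g q * Poly_Mapping.lookup f p))"
    using assms by (intro sum.mono_neutral_left) (auto simp: in_keys_iff)
  finally show ?thesis .
qed

lemma path_comp_add_left: "path_comp T (g + h) f = path_comp T g f + path_comp T h f"
proof -
  let ?A = "Poly_Mapping.keys f" and ?B = "Poly_Mapping.keys g \<union> Poly_Mapping.keys h"
  show ?thesis
    using keys_add [of g h] by (simp add: path_comp_superset [of ?A ?B] lookup_add distrib_right single_add sum.distrib)
qed

lemma path_comp_add_right: "path_comp T h (f + g) = path_comp T h f + path_comp T h g"
proof -
  let ?A = "Poly_Mapping.keys f \<union> Poly_Mapping.keys g" and ?B = "Poly_Mapping.keys h"
  show ?thesis
    using keys_add [of f g] by (simp add: path_comp_superset [of ?A ?B] lookup_add distrib_left single_add sum.distrib)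
qed

lemma path_comp_0_left [simp]: "path_comp T 0 f = 0"
  and path_comp_0_right [simp]: "path_comp T f 0 = 0"
  by (simp_all add: path_comp_def)

lemma scale_add_right:
  "Poly_Mapping.map ((*) (c::'k::comm_ring)) (f + g) = Poly_Mapping.map ((*) c) f + Poly_Mapping.map ((*) c) g"
  by (rule poly_mapping_eqI) (simp add: lookup_add distrib_left)

lemma scale_sum:
  "Poly_Mapping.map ((*) (c::'k::comm_ring)) (sum f A) = (\<Sum>a\<in>A. Poly_Mapping.map ((*) c) (f a))"
  by (rule poly_mapping_eqI) (simp add: lookup_sum sum_distrib_left)

lemma scale_single [simp]:
  "Poly_Mapping.map ((*) (c::'k::comm_ring)) (Poly_Mapping.single k v) = Poly_Mapping.single k (c * v)"
  by (rule poly_mapping_eqI) (simp add: lookup_single when_def)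

lemma keys_scale: "Poly_Mapping.keys (Poly_Mapping.map ((*) (c::'k::comm_ring)) f) \<subseteq> Poly_Mapping.keys f"
  by (auto simp: in_keys_iff)

lemma path_comp_scale_left: "path_comp T (Poly_Mapping.map ((*) c) g) f = Poly_Mapping.map ((*) c) (path_comp T g f)"
  using keys_scale [of c g]
  by (simp add: path_comp_superset [of "Poly_Mapping.keys f" "Poly_Mapping.keys g"] scale_sum mult.assoc)

lemma path_comp_scale_right: "path_comp T g (Poly_Mapping.map ((*) c) f) = Poly_Mapping.map ((*) c) (path_comp T g f)"
  using keys_scale [of c f]
  by (simp add: path_comp_superset [of "Poly_Mapping.keys f" "Poly_Mapping.keys g"] scale_sum mult.left_commute)

lemma path_comp_single [simp]:
  "path_comp T (Poly_Mapping.single q d) (Poly_Mapping.single p c) = Poly_Mapping.single (class_concat T p q) (d * c)"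
  by (simp add: path_comp_superset [of "{p}" "{q}"])

lemma path_hom_0 [simp]: "0 \<in> path_hom T x y"
  by (simp add: path_hom_def)

lemma path_hom_add: "\<lbrakk>f \<in> path_hom T x y; g \<in> path_hom T x y\<rbrakk> \<Longrightarrow> f + g \<in> path_hom T x y"
  using keys_add [of f g] by (auto simp: path_hom_def)

lemma path_hom_scale: "f \<in> path_hom T x y \<Longrightarrow> Poly_Mapping.map ((*) (c::'k::comm_ring)) f \<in> path_hom T x y"
  using keys_scale [of c f] by (auto simp: path_hom_def)

lemma path_hom_single:
  "\<gamma> \<in> Paths T \<Longrightarrow> Poly_Mapping.single (path_class T \<gamma>) c \<in> path_hom T (Some (\<gamma> 0)) (Some (\<gamma> 1))"
  by (auto simp: path_hom_def)

text \<open>A morphism is a finite sum of multiples of path classes, so bilinear identities reduce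
  to single paths. Partial sums are tracked inside the hom set, which makes typing available in the
  \<open>add\<close> case.\<close>

lemma path_hom_induct [consumes 1, case_names zero add single]:
  fixes f :: "('x, 'k::comm_ring) path_mor"
  assumes "f \<in> path_hom T x y" and "P 0"
    and "\<And>f g. \<lbrakk>f \<in> path_hom T x y; g \<in> path_hom T x y; P f; P g\<rbrakk> \<Longrightarrow> P (f + g)"
    and "\<And>\<gamma> c. \<lbrakk>\<gamma> \<in> Paths T; x = Some (\<gamma> 0); y = Some (\<gamma> 1)\<rbrakk> \<Longrightarrow> P (Poly_Mapping.single (path_class T \<gamma>) c)"
  shows "P f"
proof -
  have "(\<Sum>k\<in>A. Poly_Mapping.single k (Poly_Mapping.lookup f k)) \<in> path_hom T x y \<and>
      P (\<Sum>k\<in>A. Poly_Mapping.single k (Poly_Mapping.lookup f k))"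
    if "finite A" "A \<subseteq> Poly_Mapping.keys f" for A
    using that
  proof (induction A)
    case (insert k A)
    then obtain \<gamma> where \<gamma>: "\<gamma> \<in> Paths T" "x = Some (\<gamma> 0)" "y = Some (\<gamma> 1)" "k = path_class T \<gamma>"
      using assms(1) by (auto simp: path_hom_def)
    then have k: "Poly_Mapping.single k (Poly_Mapping.lookup f k) \<in> path_hom T x y"
      "P (Poly_Mapping.single k (Poly_Mapping.lookup f k))"
      using assms(4) path_hom_single by auto
    have A: "(\<Sum>k\<in>A. Poly_Mapping.single k (Poly_Mapping.lookup f k)) \<in> path_hom T x y"
      "P (\<Sum>k\<in>A. Poly_Mapping.single k (Poly_Mapping.lookup f k))"
      using insert.IH insert.prems by auto
    show ?case
      using path_hom_add [OF k(1) A(1)] assms(3) [OF k(1) A(1) k(2) A(2)] insert.hyps by simp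
  qed (simp add: assms(2))
  moreover have "(\<Sum>k\<in>Poly_Mapping.keys f. Poly_Mapping.single k (Poly_Mapping.lookup f k)) = f"
    by (rule poly_mapping_eqI) (simp add: lookup_sum lookup_single when_def in_keys_iff)
  ultimately show ?thesis
    by (metis finite_keys order_refl)
qed

text \<open>No path has \<open>None\<close> as an end, so the hom sets there are free modules on the
  empty set.\<close>

lemma path_hom_None:
  assumes "f \<in> path_hom T x y" "x = None \<or> y = None"
  shows "f = 0"
  using assms by (auto simp: path_hom_def)

context path_triple
begin

lemma path_comp_hom:
  fixes f g :: "('x, 'k::{comm_ring,comm_monoid_mult}) path_mor"
  assumes "f \<in> path_hom T x y" "g \<in> path_hom T y z"
  shows "path_comp T g f \<in> path_hom T x z"
  using assms(1)
proof (induction rule: path_hom_induct)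
  case (single \<gamma> c)
  note \<gamma> = single
  show ?case
    using assms(2)
  proof (induction rule: path_hom_induct)
    case (single \<delta> d)
    then show ?case
      using \<gamma> path_hom_single [OF triple_concat, of \<gamma> \<delta>] by simp
  qed (simp_all add: path_comp_add_left path_hom_add)
qed (simp_all add: path_comp_add_right path_hom_add)

lemma path_comp_assoc:
  fixes f g h :: "('x, 'k::{comm_ring,comm_monoid_mult}) path_mor"
  assumes "f \<in> path_hom T w x" "g \<in> path_hom T x y" "h \<in> path_hom T y z"
  shows "path_comp T h (path_comp T g f) = path_comp T (path_comp T h g) f"
  using assms(1)
proof (induction rule: path_hom_induct)
  case (single \<alpha> a)
  note \<alpha> = single
  show ?case
    using assms(2)
  proof (induction rule: path_hom_induct)
    case (single \<beta> b)
    note \<beta> = single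
    show ?case
      using assms(3)
    proof (induction rule: path_hom_induct)
      case (single \<gamma> c)
      then have "path_class T (\<alpha> \<cdot> (\<beta> \<cdot> \<gamma>)) = path_class T (\<alpha> \<cdot> \<beta> \<cdot> \<gamma>)"
        using \<alpha> \<beta> concat_assoc [of \<alpha> \<beta> \<gamma>] path_class_eq_iff Eqv_in_Paths by auto
      then show ?case
        using \<alpha> \<beta> single by (simp add: triple_concat mult.assoc)
    qed (simp_all add: path_comp_add_left)
  qed (simp_all add: path_comp_add_left path_comp_add_right)
qed (simp_all add: path_comp_add_right)

lemma path_comp_const_right:
  fixes f :: "('x, 'k::{comm_ring,comm_monoid_mult}) path_mor"
  assumes "f \<in> path_hom T (Some a) y" "a \<in> Pts T"
  shows "path_comp T f (path_morphism T (const_path a)) = f"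
  using assms(1)
proof (induction rule: path_hom_induct)
  case (single \<gamma> c)
  then have "path_class T (const_path a \<cdot> \<gamma>) = path_class T \<gamma>"
    using const_concat [of \<gamma>] path_class_eq_iff Eqv_in_Paths by auto
  then show ?case
    using single assms(2) by (simp add: path_morphism_def triple_const)
qed (simp_all add: path_comp_add_left)

lemma path_comp_const_left:
  fixes f :: "('x, 'k::{comm_ring,comm_monoid_mult}) path_mor"
  assumes "f \<in> path_hom T x (Some a)" "a \<in> Pts T"
  shows "path_comp T (path_morphism T (const_path a)) f = f"
  using assms(1)
proof (induction rule: path_hom_induct)
  case (single \<gamma> c)
  then have "path_class T (\<gamma> \<cdot> const_path a) = path_class T \<gamma>"
    using concat_const [of \<gamma>] path_class_eq_iff Eqv_in_Paths by auto
  then show ?case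
    using single assms(2) by (simp add: path_morphism_def triple_const)
qed (simp_all add: path_comp_add_right)

lemma path_morphism_hom: "\<gamma> \<in> Paths T \<Longrightarrow> path_morphism T \<gamma> \<in> path_hom T (Some (\<gamma> 0)) (Some (\<gamma> 1))"
  by (simp add: path_morphism_def path_hom_single)

lemma path_comp_path_morphism:
  "\<lbrakk>\<gamma> \<in> Paths T; \<delta> \<in> Paths T; \<gamma> 1 = \<delta> 0\<rbrakk>
    \<Longrightarrow> path_comp T (path_morphism T \<delta>) (path_morphism T \<gamma>) = path_morphism T (\<gamma> \<cdot> \<delta>)"
  by (simp add: path_morphism_def)

lemma path_morphism_eqI: "(\<gamma>, \<delta>) \<in> Eqv T \<Longrightarrow> path_morphism T \<gamma> = path_morphism T \<delta>"
  using path_class_eq_iff Eqv_in_Paths by (metis path_morphism_def)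

lemma linear_category_path: "linear_category (path_category T :: (_, ('x, 'k::{comm_ring,comm_monoid_mult}) path_mor, 'k) lcat)"
  (is "linear_category ?C")
proof unfold_locales
  fix x assume "x \<in> Ob ?C"
  then show "Idn ?C x \<in> Hom ?C x x"
    using path_morphism_hom [OF triple_const] by auto
next
  fix x y f assume xy: "x \<in> Ob ?C" "y \<in> Ob ?C" and f: "f \<in> Hom ?C x y"
  show "Cmp ?C x x y f (Idn ?C x) = f"
    using xy f path_comp_const_right path_hom_None by (cases x) fastforce+
  show "Cmp ?C x y y (Idn ?C y) f = f"
    using xy f path_comp_const_left path_hom_None by (cases y) fastforce+
  show "\<exists>g\<in>Hom ?C x y. Add ?C x y f g = Zero ?C x y"
    using f path_hom_scale [of f T x y "- 1"]
    by (intro bexI [of _ "Poly_Mapping.map ((*) (- 1)) f"]) (auto intro!: poly_mapping_eqI simp: lookup_add)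
  show "Scale ?C x y 1 f = f"
    by (auto intro!: poly_mapping_eqI)
  show "Scale ?C x y (c + d) f = Add ?C x y (Scale ?C x y c f) (Scale ?C x y d f)" for c d
    by (auto intro!: poly_mapping_eqI simp: lookup_add distrib_right)
  show "Scale ?C x y (c * d) f = Scale ?C x y c (Scale ?C x y d f)" for c d
    by (auto intro!: poly_mapping_eqI simp: mult.assoc)
qed (simp_all add: path_comp_hom path_comp_assoc path_hom_add path_hom_scale scale_add_right add_ac
    path_comp_add_left path_comp_add_right path_comp_scale_left path_comp_scale_right)

end

section \<open>Saturating an ideal along an Ore system\<close>

text \<open>Models the arrows given by in-pixel paths. \<open>W_left\<close> and
  \<open>W_right\<close> complete a square with an arbitrary morphism on one side; in
  \<open>W_join\<close> and \<open>W_meet\<close> all four sides lie in \<open>W\<close>, which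
  provides common denominators.\<close>

locale ore_system = category_ideal D I
  for D :: "('o, 'm, 'k::{comm_ring,comm_monoid_mult}) lcat" and I +
  fixes W :: "'o \<Rightarrow> 'o \<Rightarrow> 'm set"
  assumes W_Hom: "u \<in> W x y \<Longrightarrow> x \<in> Ob D \<and> y \<in> Ob D \<and> u \<in> Hom D x y"
    and W_Idn: "x \<in> Ob D \<Longrightarrow> Idn D x \<in> W x x"
    and W_Cmp: "\<lbrakk>u \<in> W x y; v \<in> W y z\<rbrakk> \<Longrightarrow> Cmp D x y z v u \<in> W x z"
    and W_unique: "\<lbrakk>u \<in> W x y; v \<in> W x y\<rbrakk> \<Longrightarrow> u = v"
    and W_left: "\<lbrakk>u \<in> W x x'; y \<in> Ob D; f \<in> Hom D x y\<rbrakk>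
      \<Longrightarrow> \<exists>y'. \<exists>v\<in>W y y'. \<exists>f'\<in>Hom D x' y'. Cmp D x y y' v f = Cmp D x x' y' f' u"
    and W_right: "\<lbrakk>u \<in> W y' y; x \<in> Ob D; f \<in> Hom D x y\<rbrakk>
      \<Longrightarrow> \<exists>x'. \<exists>v\<in>W x' x. \<exists>f'\<in>Hom D x' y'. Cmp D x' x y f v = Cmp D x' y' y u f'"
    and W_join: "\<lbrakk>u \<in> W x a; v \<in> W x b\<rbrakk> \<Longrightarrow> \<exists>d. \<exists>u'\<in>W a d. \<exists>v'\<in>W b d. Cmp D x a d u' u = Cmp D x b d v' v"
    and W_meet: "\<lbrakk>u \<in> W a x; v \<in> W b x\<rbrakk> \<Longrightarrow> \<exists>d. \<exists>u'\<in>W d a. \<exists>v'\<in>W d b. Cmp D d a x u u' = Cmp D d b x v v'"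
begin

text \<open>Modelled on the kernel of localisation at \<open>W\<close> modulo \<open>I\<close>, with
  denominators allowed at both ends.\<close>

definition saturation :: "'o \<Rightarrow> 'o \<Rightarrow> 'm set" where
  "saturation x y = {f \<in> Hom D x y. \<exists>s t. \<exists>u\<in>W s x. \<exists>v\<in>W y t. Cmp D s y t v (Cmp D s x y f u) \<in> I s t}"

lemma saturationI:
  "\<lbrakk>f \<in> Hom D x y; u \<in> W s x; v \<in> W y t; Cmp D s y t v (Cmp D s x y f u) \<in> I s t\<rbrakk> \<Longrightarrow> f \<in> saturation x y"
  unfolding saturation_def by blast

lemma saturationE:
  assumes "f \<in> saturation x y"
  obtains s t u v where "x \<in> Ob D" "y \<in> Ob D" "f \<in> Hom D x y" "s \<in> Ob D" "t \<in> Ob D"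
    "u \<in> W s x" "u \<in> Hom D s x" "v \<in> W y t" "v \<in> Hom D y t" "Cmp D s y t v (Cmp D s x y f u) \<in> I s t"
  using assms W_Hom unfolding saturation_def by blast

text \<open>Sums are handled by common denominators at both ends. For composites, the denominator
  between the two morphisms is moved past the arbitrary factor by an Ore square.\<close>

lemma is_ideal_saturation: "is_ideal D saturation"
  unfolding is_ideal_def
proof (intro conjI ballI allI)
  fix x y assume xy [simp]: "x \<in> Ob D" "y \<in> Ob D"
  show "saturation x y \<subseteq> Hom D x y"
    by (auto simp: saturation_def)
  show "Zero D x y \<in> saturation x y"
    by (rule saturationI [OF _ W_Idn W_Idn]) simp_all
  fix f assume f: "f \<in> saturation x y"
  then obtain s t u v where u [simp]: "f \<in> Hom D x y" "s \<in> Ob D" "t \<in> Ob D" "u \<in> W s x" "u \<in> Hom D s x"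
    "v \<in> W y t" "v \<in> Hom D y t" and fI: "Cmp D s y t v (Cmp D s x y f u) \<in> I s t"
    by (blast elim: saturationE)
  show "Scale D x y c f \<in> saturation x y" for c
    by (rule saturationI [OF _ u(4,6)]) (simp_all add: bilinear fI)
  show "Add D x y f g \<in> saturation x y" if g: "g \<in> saturation x y" for g
  proof -
    obtain s' t' u' v' where u' [simp]: "g \<in> Hom D x y" "s' \<in> Ob D" "t' \<in> Ob D" "u' \<in> W s' x" "u' \<in> Hom D s' x"
      "v' \<in> W y t'" "v' \<in> Hom D y t'" and gI: "Cmp D s' y t' v' (Cmp D s' x y g u') \<in> I s' t'"
      using g by (blast elim: saturationE)
    obtain s0 a a' where a: "a \<in> W s0 s" "a' \<in> W s0 s'" and aeq: "Cmp D s0 s x u a = Cmp D s0 s' x u' a'"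
      using W_meet [OF u(4) u'(4)] by blast
    obtain t0 b b' where b: "b \<in> W t t0" "b' \<in> W t' t0" and beq: "Cmp D y t t0 b v = Cmp D y t' t0 b' v'"
      using W_join [OF u(6) u'(6)] by blast
    note [simp] = a b W_Hom [OF a(1)] W_Hom [OF a(2)] W_Hom [OF b(1)] W_Hom [OF b(2)]
    \<comment> \<open>Over the common denominators each summand is its former element of
      \<open>I\<close> multiplied by further arrows of \<open>W\<close>.\<close>
    have "Cmp D s0 y t0 (Cmp D y t t0 b v) (Cmp D s0 x y f (Cmp D s0 s x u a)) =
        Cmp D s0 t t0 b (Cmp D s0 s t (Cmp D s y t v (Cmp D s x y f u)) a)"
      by (simp add: Cmp_assoc_right)
    then have f0: "Cmp D s0 y t0 (Cmp D y t t0 b v) (Cmp D s0 x y f (Cmp D s0 s x u a)) \<in> I s0 t0"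
      using fI by simp
    have "Cmp D s0 y t0 (Cmp D y t t0 b v) (Cmp D s0 x y g (Cmp D s0 s x u a)) =
        Cmp D s0 t' t0 b' (Cmp D s0 s' t' (Cmp D s' y t' v' (Cmp D s' x y g u')) a')"
      unfolding aeq beq by (simp add: Cmp_assoc_right)
    then have g0: "Cmp D s0 y t0 (Cmp D y t t0 b v) (Cmp D s0 x y g (Cmp D s0 s x u a)) \<in> I s0 t0"
      using gI by simp
    have "Cmp D s0 y t0 (Cmp D y t t0 b v) (Cmp D s0 x y (Add D x y f g) (Cmp D s0 s x u a)) =
        Add D s0 t0 (Cmp D s0 y t0 (Cmp D y t t0 b v) (Cmp D s0 x y f (Cmp D s0 s x u a)))
          (Cmp D s0 y t0 (Cmp D y t t0 b v) (Cmp D s0 x y g (Cmp D s0 s x u a)))"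
      by (simp add: Cmp_Add_left Cmp_Add_right)
    also have "\<dots> \<in> I s0 t0"
      using ideal_simps(3) [OF _ _ f0 g0] a b W_Hom by blast
    finally show ?thesis
      using W_Cmp [OF a(1) u(4)] W_Cmp [OF u(6) b(1)] by - (rule saturationI, simp_all only: Add_in xy u u')
  qed
next
  fix x y z f g assume [simp]: "x \<in> Ob D" "y \<in> Ob D" "z \<in> Ob D"
    and f: "f \<in> saturation x y" and g [simp]: "g \<in> Hom D y z"
  then obtain s t u v where u [simp]: "f \<in> Hom D x y" "s \<in> Ob D" "t \<in> Ob D" "u \<in> W s x" "u \<in> Hom D s x"
    "v \<in> W y t" "v \<in> Hom D y t" and fI: "Cmp D s y t v (Cmp D s x y f u) \<in> I s t"
    by (blast elim: saturationE)
  obtain z' w g' where w: "w \<in> W z z'" "g' \<in> Hom D t z'" and eq: "Cmp D y z z' w g = Cmp D y t z' g' v"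
    using W_left [OF u(6) _ g] by auto
  note [simp] = w(2) W_Hom [OF w(1)]
  have "Cmp D s z z' w (Cmp D s x z (Cmp D x y z g f) u) = Cmp D s t z' g' (Cmp D s y t v (Cmp D s x y f u))"
    by (simp add: Cmp_assoc_right Cmp_assoc_eq [OF eq])
  then show "Cmp D x y z g f \<in> saturation x z"
    using fI by (intro saturationI [OF _ u(4) w(1)]) simp_all
next
  fix x y z f g assume [simp]: "x \<in> Ob D" "y \<in> Ob D" "z \<in> Ob D"
    and f [simp]: "f \<in> Hom D x y" and g: "g \<in> saturation y z"
  then obtain s t u v where u [simp]: "g \<in> Hom D y z" "s \<in> Ob D" "t \<in> Ob D" "u \<in> W s y" "u \<in> Hom D s y"
    "v \<in> W z t" "v \<in> Hom D z t" and gI: "Cmp D s z t v (Cmp D s y z g u) \<in> I s t"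
    by (blast elim: saturationE)
  obtain x' w f' where w: "w \<in> W x' x" "f' \<in> Hom D x' s" and eq: "Cmp D x' x y f w = Cmp D x' s y u f'"
    using W_right [OF u(4) _ f] by auto
  note [simp] = w(2) W_Hom [OF w(1)]
  have "Cmp D x' z t v (Cmp D x' x z (Cmp D x y z g f) w) = Cmp D x' s t (Cmp D s z t v (Cmp D s y z g u)) f'"
    by (simp add: Cmp_assoc_right eq)
  then show "Cmp D x y z g f \<in> saturation x z"
    using gI by (intro saturationI [OF _ w(1) u(6)]) simp_all
qed

text \<open>The categorical form of equivalence with respect to a screen: arrows of \<open>W\<close>
  at the two ends make the morphisms equal.\<close>

definition linked :: "'o \<Rightarrow> 'o \<Rightarrow> 'm \<Rightarrow> 'o \<Rightarrow> 'o \<Rightarrow> 'm \<Rightarrow> bool" where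
  "linked x y f x' y' g \<longleftrightarrow> f \<in> Hom D x y \<and> g \<in> Hom D x' y' \<and>
    (\<exists>s t. \<exists>u\<in>W s x. \<exists>u'\<in>W s x'. \<exists>v\<in>W y t. \<exists>v'\<in>W y' t.
      Cmp D s y t v (Cmp D s x y f u) = Cmp D s y' t v' (Cmp D s x' y' g u'))"

lemma linked_saturation:
  assumes "linked x y f x' y' g" "g \<in> I x' y'"
  shows "f \<in> saturation x y"
proof -
  obtain s t u u' v v' where f: "f \<in> Hom D x y" and u: "u \<in> W s x" "u' \<in> W s x'" "v \<in> W y t" "v' \<in> W y' t"
    and eq: "Cmp D s y t v (Cmp D s x y f u) = Cmp D s y' t v' (Cmp D s x' y' g u')"
    using assms(1) unfolding linked_def by blast
  note [simp] = W_Hom [OF u(1)] W_Hom [OF u(2)] W_Hom [OF u(3)] W_Hom [OF u(4)]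
  show ?thesis
    by (rule saturationI [OF f u(1,3)]) (simp add: eq assms(2))
qed

text \<open>The two links use different arrows of \<open>W\<close>. Those around \<open>f1\<close>
  and \<open>f2\<close> are made common by \<open>W_meet\<close> and \<open>W_join\<close>; the same
  extensions then also serve \<open>g1\<close> and \<open>g2\<close>, by uniqueness.\<close>

lemma linked_Add:
  assumes "linked x y f1 x' y' g1" "linked x y f2 x' y' g2"
  shows "linked x y (Add D x y f1 f2) x' y' (Add D x' y' g1 g2)"
proof -
  obtain s1 t1 u1 u1' v1 v1' where [simp]: "f1 \<in> Hom D x y" "g1 \<in> Hom D x' y'"
    and u1: "u1 \<in> W s1 x" "u1' \<in> W s1 x'" "v1 \<in> W y t1" "v1' \<in> W y' t1"
    and eq1: "Cmp D s1 y t1 v1 (Cmp D s1 x y f1 u1) = Cmp D s1 y' t1 v1' (Cmp D s1 x' y' g1 u1')"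
    using assms(1) unfolding linked_def by blast
  obtain s2 t2 u2 u2' v2 v2' where [simp]: "f2 \<in> Hom D x y" "g2 \<in> Hom D x' y'"
    and u2: "u2 \<in> W s2 x" "u2' \<in> W s2 x'" "v2 \<in> W y t2" "v2' \<in> W y' t2"
    and eq2: "Cmp D s2 y t2 v2 (Cmp D s2 x y f2 u2) = Cmp D s2 y' t2 v2' (Cmp D s2 x' y' g2 u2')"
    using assms(2) unfolding linked_def by blast
  obtain s a1 a2 where a: "a1 \<in> W s s1" "a2 \<in> W s s2" and aeq: "Cmp D s s1 x u1 a1 = Cmp D s s2 x u2 a2"
    using W_meet [OF u1(1) u2(1)] by blast
  obtain t b1 b2 where b: "b1 \<in> W t1 t" "b2 \<in> W t2 t" and beq: "Cmp D y t1 t b1 v1 = Cmp D y t2 t b2 v2"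
    using W_join [OF u1(3) u2(3)] by blast
  \<comment> \<open>No square was chosen at \<open>x'\<close>: both composites are arrows of
    \<open>W\<close> from \<open>s\<close> to \<open>x'\<close> and hence equal.\<close>
  have aeq': "Cmp D s s1 x' u1' a1 = Cmp D s s2 x' u2' a2"
    using W_unique W_Cmp a u1(2) u2(2) by metis
  have beq': "Cmp D y' t1 t b1 v1' = Cmp D y' t2 t b2 v2'"
    using W_unique W_Cmp b u1(4) u2(4) by metis
  note [simp] = W_Hom [OF u1(1)] W_Hom [OF u1(2)] W_Hom [OF u1(3)] W_Hom [OF u1(4)]
    W_Hom [OF u2(1)] W_Hom [OF u2(2)] W_Hom [OF u2(3)] W_Hom [OF u2(4)]
    W_Hom [OF a(1)] W_Hom [OF a(2)] W_Hom [OF b(1)] W_Hom [OF b(2)]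
  have "Cmp D s y t (Cmp D y t1 t b1 v1) (Cmp D s x y f1 (Cmp D s s1 x u1 a1)) =
      Cmp D s t1 t b1 (Cmp D s s1 t1 (Cmp D s1 y t1 v1 (Cmp D s1 x y f1 u1)) a1)"
    by (simp add: Cmp_assoc_right)
  also have "\<dots> = Cmp D s y' t (Cmp D y' t1 t b1 v1') (Cmp D s x' y' g1 (Cmp D s s1 x' u1' a1))"
    unfolding eq1 by (simp add: Cmp_assoc_right)
  finally have 1: "Cmp D s y t (Cmp D y t1 t b1 v1) (Cmp D s x y f1 (Cmp D s s1 x u1 a1)) =
    Cmp D s y' t (Cmp D y' t1 t b1 v1') (Cmp D s x' y' g1 (Cmp D s s1 x' u1' a1))" .
  have "Cmp D s y t (Cmp D y t1 t b1 v1) (Cmp D s x y f2 (Cmp D s s1 x u1 a1)) =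
      Cmp D s t2 t b2 (Cmp D s s2 t2 (Cmp D s2 y t2 v2 (Cmp D s2 x y f2 u2)) a2)"
    unfolding aeq beq by (simp add: Cmp_assoc_right)
  also have "\<dots> = Cmp D s y' t (Cmp D y' t1 t b1 v1') (Cmp D s x' y' g2 (Cmp D s s1 x' u1' a1))"
    unfolding eq2 aeq' beq' by (simp add: Cmp_assoc_right)
  finally have 2: "Cmp D s y t (Cmp D y t1 t b1 v1) (Cmp D s x y f2 (Cmp D s s1 x u1 a1)) =
    Cmp D s y' t (Cmp D y' t1 t b1 v1') (Cmp D s x' y' g2 (Cmp D s s1 x' u1' a1))" .
  have "Cmp D s y t (Cmp D y t1 t b1 v1) (Cmp D s x y (Add D x y f1 f2) (Cmp D s s1 x u1 a1)) =
    Cmp D s y' t (Cmp D y' t1 t b1 v1') (Cmp D s x' y' (Add D x' y' g1 g2) (Cmp D s s1 x' u1' a1))"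
    using 1 2 by (simp add: Cmp_Add_left Cmp_Add_right)
  then show ?thesis
    unfolding linked_def using W_Cmp [OF a(1) u1(1)] W_Cmp [OF a(1) u1(2)] W_Cmp [OF u1(3) b(1)] W_Cmp [OF u1(4) b(1)]
    by (intro conjI exI bexI) simp_all
qed

end

section \<open>Paths inside pixels\<close>

context screen
begin

lemma pixel_unique: "\<lbrakk>Y \<in> P; Z \<in> P; x \<in> Y; x \<in> Z\<rbrakk> \<Longrightarrow> Y = Z"
  using screen_partition unfolding partition_on_def disjoint_def by blast

lemma path_ends_im [simp]: "\<rho> 0 \<in> im \<rho>" "\<rho> 1 \<in> im \<rho>"
  by (auto simp: im_def)

lemma im_subset_pixel:
  assumes "in_pixel P \<rho>" "Y \<in> P" "\<rho> t \<in> Y" "t \<in> {0..1}"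
  shows "im \<rho> \<subseteq> Y"
  using assms pixel_unique unfolding in_pixel_def im_def by blast

lemma in_pixel_concat:
  assumes "in_pixel P \<rho>" "in_pixel P \<rho>'" "\<rho> 1 = \<rho>' 0"
  shows "in_pixel P (\<rho> \<cdot> \<rho>')"
proof -
  obtain Y where Y: "Y \<in> P" "im \<rho> \<subseteq> Y"
    using assms(1) by (auto simp: in_pixel_def)
  then have "im \<rho>' \<subseteq> Y"
    using im_subset_pixel [OF assms(2) Y(1), of 0] assms(3) path_ends_im(2) [of \<rho>] by auto
  then show ?thesis
    using Y im_pconcat [of \<rho> \<rho>'] assms(3) by (auto simp: in_pixel_def)
qed

lemma in_pixel_const: "x \<in> Pts T \<Longrightarrow> in_pixel P (const_path x)"
  using screen_partition by (auto simp: in_pixel_def partition_on_def)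

lemma in_pixel_Eqv:
  assumes "\<rho> \<in> Paths T" "\<rho>' \<in> Paths T" "in_pixel P \<rho>" "in_pixel P \<rho>'" "\<rho> 0 = \<rho>' 0" "\<rho> 1 = \<rho>' 1"
  shows "(\<rho>, \<rho>') \<in> Eqv T"
proof -
  obtain Y where Y: "Y \<in> P" "im \<rho> \<subseteq> Y"
    using assms(3) by (auto simp: in_pixel_def)
  then have "im \<rho>' \<subseteq> Y"
    using im_subset_pixel [OF assms(4) Y(1), of 0] assms(5) path_ends_im(1) [of \<rho>] by auto
  then show ?thesis
    using S1 [OF assms(1,2,5,6) Y] by simp
qed

lemma in_pixel_Eqv_in_pixel:
  assumes "(\<rho>, \<rho>') \<in> Eqv T" "in_pixel P \<rho>"
  shows "in_pixel P \<rho>'"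
proof -
  obtain Y where Y: "Y \<in> P" "im \<rho> \<subseteq> Y"
    using assms(2) by (auto simp: in_pixel_def)
  then have "im \<rho>' \<subseteq> Y"
    using S1 [OF _ _ _ _ Y] Eqv_in_Paths triple_endpoints assms(1) by blast
  then show ?thesis
    using Y by (auto simp: in_pixel_def)
qed

lemma in_pixel_concatD:
  assumes "in_pixel P (\<rho> \<cdot> \<rho>')" "\<rho> 1 = \<rho>' 0"
  shows "in_pixel P \<rho>" "in_pixel P \<rho>'"
  using assms(1) im_pconcat [of \<rho> \<rho>', OF assms(2)] by (auto simp: in_pixel_def)

text \<open>The identity of the zero object, which is \<open>0\<close>, is added so that every
  object has its identity among these arrows. Nothing joins \<open>None\<close> to a point.\<close>

definition pixel_mor :: "'x option \<Rightarrow> 'x option \<Rightarrow> ('x, 'k::{comm_ring,comm_monoid_mult}) path_mor set" where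
  "pixel_mor x y = {path_morphism T \<rho> | \<rho>. \<rho> \<in> Paths T \<and> in_pixel P \<rho> \<and> x = Some (\<rho> 0) \<and> y = Some (\<rho> 1)} \<union>
    (if x = None \<and> y = None then {0} else {})"

lemma pixel_mor_SomeE:
  assumes "u \<in> pixel_mor x y" "x = Some a \<or> y = Some b"
  obtains \<rho> where "\<rho> \<in> Paths T" "in_pixel P \<rho>" "x = Some (\<rho> 0)" "y = Some (\<rho> 1)" "u = path_morphism T \<rho>"
  using assms by (auto simp: pixel_mor_def split: if_splits)

lemma pixel_morI: "\<lbrakk>\<rho> \<in> Paths T; in_pixel P \<rho>\<rbrakk> \<Longrightarrow> path_morphism T \<rho> \<in> pixel_mor (Some (\<rho> 0)) (Some (\<rho> 1))"
  by (auto simp: pixel_mor_def)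

lemma pixel_mor_hom: "u \<in> pixel_mor x y \<Longrightarrow> x \<in> insert None (Some ` Pts T) \<and> y \<in> insert None (Some ` Pts T) \<and> u \<in> path_hom T x y"
  using path_morphism_hom by (auto simp: pixel_mor_def split: if_splits)

lemma pixel_mor_comp:
  fixes u v :: "('x, 'k::{comm_ring,comm_monoid_mult}) path_mor"
  assumes "u \<in> pixel_mor x y" "v \<in> pixel_mor y z"
  shows "path_comp T v u \<in> pixel_mor x z"
proof (cases y)
  case None
  then show ?thesis
    using assms by (auto simp: pixel_mor_def split: if_splits)
next
  case (Some b)
  obtain \<rho> where \<rho>: "\<rho> \<in> Paths T" "in_pixel P \<rho>" "x = Some (\<rho> 0)" "y = Some (\<rho> 1)" "u = path_morphism T \<rho>"
    using pixel_mor_SomeE [OF assms(1)] Some by metis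
  obtain \<sigma> where \<sigma>: "\<sigma> \<in> Paths T" "in_pixel P \<sigma>" "y = Some (\<sigma> 0)" "z = Some (\<sigma> 1)" "v = path_morphism T \<sigma>"
    using pixel_mor_SomeE [OF assms(2)] Some by metis
  show ?thesis
    using pixel_morI [OF triple_concat in_pixel_concat, of \<rho> \<sigma>] \<rho> \<sigma> by (simp add: path_comp_path_morphism)
qed

lemma pixel_mor_unique:
  assumes "u \<in> pixel_mor x y" "v \<in> pixel_mor x y"
  shows "u = v"
proof (cases x)
  case (Some a)
  obtain \<rho> where \<rho>: "\<rho> \<in> Paths T" "in_pixel P \<rho>" "x = Some (\<rho> 0)" "y = Some (\<rho> 1)" "u = path_morphism T \<rho>"
    using pixel_mor_SomeE [OF assms(1)] Some by metis
  obtain \<sigma> where \<sigma>: "\<sigma> \<in> Paths T" "in_pixel P \<sigma>" "x = Some (\<sigma> 0)" "y = Some (\<sigma> 1)" "v = path_morphism T \<sigma>"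
    using pixel_mor_SomeE [OF assms(2)] Some by metis
  show ?thesis
    using in_pixel_Eqv [of \<rho> \<sigma>] path_morphism_eqI \<rho> \<sigma> by simp
qed (use assms in \<open>auto simp: pixel_mor_def split: if_splits\<close>)

text \<open>\<open>S3\<close> places only \<open>\<rho>'\<close> in a pixel. But
  \<open>\<sigma> \<cdot> \<rho>'\<close> lies in a pixel, hence by \<open>S1\<close> so does the
  equivalent path \<open>\<rho> \<cdot> \<sigma>'\<close>, and with it the part
  \<open>\<sigma>'\<close>.\<close>

lemma pixel_mor_join:
  fixes u v :: "('x, 'k::{comm_ring,comm_monoid_mult}) path_mor"
  assumes "u \<in> pixel_mor x a" "v \<in> pixel_mor x b"
  shows "\<exists>d. \<exists>u'\<in>pixel_mor a d. \<exists>v'\<in>pixel_mor b d. path_comp T u' u = path_comp T v' v"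
proof (cases x)
  case None
  then show ?thesis
    using assms by (auto simp: pixel_mor_def split: if_splits)
next
  case (Some c)
  obtain \<rho> where \<rho>: "\<rho> \<in> Paths T" "in_pixel P \<rho>" "x = Some (\<rho> 0)" "a = Some (\<rho> 1)" "u = path_morphism T \<rho>"
    using pixel_mor_SomeE [OF assms(1)] Some by metis
  obtain \<sigma> where \<sigma>: "\<sigma> \<in> Paths T" "in_pixel P \<sigma>" "x = Some (\<sigma> 0)" "b = Some (\<sigma> 1)" "v = path_morphism T \<sigma>"
    using pixel_mor_SomeE [OF assms(2)] Some by metis
  have "\<rho> 0 = \<sigma> 0"
    using \<rho> \<sigma> by simp
  then obtain \<rho>' \<sigma>' where *: "\<rho>' \<in> Paths T" "\<sigma>' \<in> Paths T" "in_pixel P \<rho>'" "\<sigma> 1 = \<rho>' 0" "\<rho> 1 = \<sigma>' 0"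
    and eqv: "(\<sigma> \<cdot> \<rho>', \<rho> \<cdot> \<sigma>') \<in> Eqv T"
    using S3 [OF \<rho>(1) \<sigma>(1) _ \<rho>(2)] by blast
  have "in_pixel P \<sigma>'"
    using in_pixel_concatD in_pixel_Eqv_in_pixel [OF eqv] in_pixel_concat \<sigma>(2) * by metis
  moreover have "\<sigma>' 1 = \<rho>' 1"
    using triple_endpoints [OF eqv] by simp
  ultimately show ?thesis
    using * \<rho> \<sigma> pixel_morI [of \<rho>'] pixel_morI [of \<sigma>'] path_morphism_eqI [OF eqv]
    by (metis path_comp_path_morphism)
qed

lemma pixel_mor_meet:
  fixes u v :: "('x, 'k::{comm_ring,comm_monoid_mult}) path_mor"
  assumes "u \<in> pixel_mor a x" "v \<in> pixel_mor b x"
  shows "\<exists>d. \<exists>u'\<in>pixel_mor d a. \<exists>v'\<in>pixel_mor d b. path_comp T u u' = path_comp T v v'"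
proof (cases x)
  case None
  then show ?thesis
    using assms by (auto simp: pixel_mor_def split: if_splits)
next
  case (Some c)
  obtain \<rho> where \<rho>: "\<rho> \<in> Paths T" "in_pixel P \<rho>" "a = Some (\<rho> 0)" "x = Some (\<rho> 1)" "u = path_morphism T \<rho>"
    using pixel_mor_SomeE [OF assms(1)] Some by metis
  obtain \<sigma> where \<sigma>: "\<sigma> \<in> Paths T" "in_pixel P \<sigma>" "b = Some (\<sigma> 0)" "x = Some (\<sigma> 1)" "v = path_morphism T \<sigma>"
    using pixel_mor_SomeE [OF assms(2)] Some by metis
  have "\<rho> 1 = \<sigma> 1"
    using \<rho> \<sigma> by simp
  then obtain \<rho>' \<sigma>' where *: "\<rho>' \<in> Paths T" "\<sigma>' \<in> Paths T" "in_pixel P \<rho>'" "\<sigma>' 1 = \<rho> 0" "\<rho>' 1 = \<sigma> 0"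
    and eqv: "(\<sigma>' \<cdot> \<rho>, \<rho>' \<cdot> \<sigma>) \<in> Eqv T"
    using S3_dual [OF \<rho>(1) \<sigma>(1) _ \<rho>(2)] by blast
  have "in_pixel P \<sigma>'"
    using in_pixel_concatD in_pixel_Eqv_in_pixel [OF Eqv_sym [OF eqv]] in_pixel_concat \<sigma>(2) * by metis
  moreover have "\<sigma>' 0 = \<rho>' 0"
    using triple_endpoints [OF eqv] by simp
  ultimately show ?thesis
    using * \<rho> \<sigma> pixel_morI [of \<rho>'] pixel_morI [of \<sigma>'] path_morphism_eqI [OF eqv]
    by (metis path_comp_path_morphism)
qed

lemma pixel_mor_Idn:
  "x \<in> insert None (Some ` Pts T)
    \<Longrightarrow> Idn (path_category T :: (_, ('x, 'k::{comm_ring,comm_monoid_mult}) path_mor, 'k) lcat) x \<in> pixel_mor x x"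
  using pixel_morI [OF triple_const in_pixel_const] by (auto simp: pixel_mor_def)

text \<open>For one path this is \<open>S3\<close>, and scalars pass through. For a sum, the squares
  of the summands are first brought to a common target by \<open>pixel_mor_join\<close>.\<close>

lemma pixel_mor_left:
  fixes u f :: "('x, 'k::{comm_ring,comm_monoid_mult}) path_mor"
  assumes u: "u \<in> pixel_mor x x'" and y: "y \<in> insert None (Some ` Pts T)" and f: "f \<in> path_hom T x y"
  shows "\<exists>y'. \<exists>v\<in>pixel_mor y y'. \<exists>f'\<in>path_hom T x' y'. path_comp T v f = path_comp T f' u"
  using f
proof (induction rule: path_hom_induct)
  case zero
  show ?case
    using pixel_mor_Idn [OF y, where 'k = 'k] by (metis path_comp_0_left path_comp_0_right path_hom_0)
next
  case (add f g)
  obtain y1 v1 f1 where 1: "v1 \<in> pixel_mor y y1" "f1 \<in> path_hom T x' y1" "path_comp T v1 f = path_comp T f1 u"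
    using add.IH(1) by blast
  obtain y2 v2 f2 where 2: "v2 \<in> pixel_mor y y2" "f2 \<in> path_hom T x' y2" "path_comp T v2 g = path_comp T f2 u"
    using add.IH(2) by blast
  obtain d w1 w2 where w: "w1 \<in> pixel_mor y1 d" "w2 \<in> pixel_mor y2 d" "path_comp T w1 v1 = path_comp T w2 v2"
    using pixel_mor_join [OF 1(1) 2(1)] by blast
  have "path_comp T (path_comp T w1 v1) (f + g) = path_comp T w1 (path_comp T v1 f) + path_comp T w2 (path_comp T v2 g)"
    using path_comp_assoc [OF add.hyps(1), of v1 y1 w1 d] path_comp_assoc [OF add.hyps(2), of v2 y2 w2 d]
      pixel_mor_hom [OF 1(1)] pixel_mor_hom [OF 2(1)] pixel_mor_hom [OF w(1)] pixel_mor_hom [OF w(2)] w(3)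
    by (simp add: path_comp_add_right)
  also have "\<dots> = path_comp T (path_comp T w1 f1 + path_comp T w2 f2) u"
    using path_comp_assoc [of u x x' f1 y1 w1 d] path_comp_assoc [of u x x' f2 y2 w2 d]
      pixel_mor_hom [OF u] pixel_mor_hom [OF 1(1)] pixel_mor_hom [OF 2(1)] pixel_mor_hom [OF w(1)] pixel_mor_hom [OF w(2)] 1(2,3) 2(2,3)
    by (simp add: path_comp_add_left)
  finally have "path_comp T (path_comp T w1 v1) (f + g) = path_comp T (path_comp T w1 f1 + path_comp T w2 f2) u" .
  moreover have "path_comp T w1 f1 + path_comp T w2 f2 \<in> path_hom T x' d"
    using pixel_mor_hom [OF w(1)] pixel_mor_hom [OF w(2)]
    by (intro path_hom_add path_comp_hom [OF 1(2)] path_comp_hom [OF 2(2)]) simp_all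
  ultimately show ?case
    using pixel_mor_comp [OF 1(1) w(1)] by blast
next
  case (single \<gamma> c)
  obtain \<rho> where \<rho>: "\<rho> \<in> Paths T" "in_pixel P \<rho>" "x = Some (\<rho> 0)" "x' = Some (\<rho> 1)" "u = path_morphism T \<rho>"
    using pixel_mor_SomeE [OF u] single by metis
  have "\<rho> 0 = \<gamma> 0"
    using \<rho> single by simp
  then obtain \<rho>' \<gamma>' where *: "\<rho>' \<in> Paths T" "\<gamma>' \<in> Paths T" "in_pixel P \<rho>'" "\<gamma> 1 = \<rho>' 0" "\<rho> 1 = \<gamma>' 0"
    and eqv: "(\<gamma> \<cdot> \<rho>', \<rho> \<cdot> \<gamma>') \<in> Eqv T"
    using S3 [OF \<rho>(1) single(1) _ \<rho>(2)] by blast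
  have cls: "path_class T (\<gamma> \<cdot> \<rho>') = path_class T (\<rho> \<cdot> \<gamma>')"
    using eqv path_class_eq_iff Eqv_in_Paths by blast
  have "\<gamma>' 1 = \<rho>' 1"
    using triple_endpoints [OF eqv] by simp
  then have "Poly_Mapping.single (path_class T \<gamma>') c \<in> path_hom T x' (Some (\<rho>' 1))"
    using path_hom_single [OF *(2), of c] * \<rho> by simp
  moreover have "path_comp T (path_morphism T \<rho>') (Poly_Mapping.single (path_class T \<gamma>) c) =
      path_comp T (Poly_Mapping.single (path_class T \<gamma>') c) u"
    using * \<rho> single cls by (simp add: path_morphism_def)
  moreover have "path_morphism T \<rho>' \<in> pixel_mor y (Some (\<rho>' 1))"
    using pixel_morI [OF *(1,3)] * single by simp
  ultimately show ?case
    by blast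
qed

text \<open>The mirror image, with \<open>S3_dual\<close> for one path and
  \<open>pixel_mor_meet\<close> for sums.\<close>

lemma pixel_mor_right:
  fixes u f :: "('x, 'k::{comm_ring,comm_monoid_mult}) path_mor"
  assumes u: "u \<in> pixel_mor y' y" and x: "x \<in> insert None (Some ` Pts T)" and f: "f \<in> path_hom T x y"
  shows "\<exists>x'. \<exists>v\<in>pixel_mor x' x. \<exists>f'\<in>path_hom T x' y'. path_comp T f v = path_comp T u f'"
  using f
proof (induction rule: path_hom_induct)
  case zero
  show ?case
    using pixel_mor_Idn [OF x, where 'k = 'k] by (metis path_comp_0_left path_comp_0_right path_hom_0)
next
  case (add f g)
  obtain x1 v1 f1 where 1: "v1 \<in> pixel_mor x1 x" "f1 \<in> path_hom T x1 y'" "path_comp T f v1 = path_comp T u f1"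
    using add.IH(1) by blast
  obtain x2 v2 f2 where 2: "v2 \<in> pixel_mor x2 x" "f2 \<in> path_hom T x2 y'" "path_comp T g v2 = path_comp T u f2"
    using add.IH(2) by blast
  obtain d w1 w2 where w: "w1 \<in> pixel_mor d x1" "w2 \<in> pixel_mor d x2" "path_comp T v1 w1 = path_comp T v2 w2"
    using pixel_mor_meet [OF 1(1) 2(1)] by blast
  have "path_comp T (f + g) (path_comp T v1 w1) = path_comp T (path_comp T f v1) w1 + path_comp T (path_comp T g v2) w2"
    using path_comp_assoc [of w1 d x1 v1 x f y] path_comp_assoc [of w2 d x2 v2 x g y] add.hyps
      pixel_mor_hom [OF 1(1)] pixel_mor_hom [OF 2(1)] pixel_mor_hom [OF w(1)] pixel_mor_hom [OF w(2)] w(3)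
    by (simp add: path_comp_add_left)
  also have "\<dots> = path_comp T u (path_comp T f1 w1 + path_comp T f2 w2)"
    using path_comp_assoc [of w1 d x1 f1 y' u y] path_comp_assoc [of w2 d x2 f2 y' u y]
      pixel_mor_hom [OF u] pixel_mor_hom [OF 1(1)] pixel_mor_hom [OF 2(1)] pixel_mor_hom [OF w(1)] pixel_mor_hom [OF w(2)] 1(2,3) 2(2,3)
    by (simp add: path_comp_add_right)
  finally have "path_comp T (f + g) (path_comp T v1 w1) = path_comp T u (path_comp T f1 w1 + path_comp T f2 w2)" .
  moreover have "path_comp T f1 w1 + path_comp T f2 w2 \<in> path_hom T d y'"
    using pixel_mor_hom [OF w(1)] pixel_mor_hom [OF w(2)]
    by (intro path_hom_add path_comp_hom [OF _ 1(2)] path_comp_hom [OF _ 2(2)]) simp_all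
  ultimately show ?case
    using pixel_mor_comp [OF w(1) 1(1)] by blast
next
  case (single \<gamma> c)
  obtain \<rho> where \<rho>: "\<rho> \<in> Paths T" "in_pixel P \<rho>" "y' = Some (\<rho> 0)" "y = Some (\<rho> 1)" "u = path_morphism T \<rho>"
    using pixel_mor_SomeE [OF u] single by metis
  have "\<rho> 1 = \<gamma> 1"
    using \<rho> single by simp
  then obtain \<rho>' \<gamma>' where *: "\<rho>' \<in> Paths T" "\<gamma>' \<in> Paths T" "in_pixel P \<rho>'" "\<gamma>' 1 = \<rho> 0" "\<rho>' 1 = \<gamma> 0"
    and eqv: "(\<gamma>' \<cdot> \<rho>, \<rho>' \<cdot> \<gamma>) \<in> Eqv T"
    using S3_dual [OF \<rho>(1) single(1) _ \<rho>(2)] by blast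
  have cls: "path_class T (\<gamma>' \<cdot> \<rho>) = path_class T (\<rho>' \<cdot> \<gamma>)"
    using eqv path_class_eq_iff Eqv_in_Paths by blast
  have "\<gamma>' 0 = \<rho>' 0"
    using triple_endpoints [OF eqv] by simp
  then have "Poly_Mapping.single (path_class T \<gamma>') c \<in> path_hom T (Some (\<rho>' 0)) y'"
    using path_hom_single [OF *(2), of c] * \<rho> by simp
  moreover have "path_comp T (Poly_Mapping.single (path_class T \<gamma>) c) (path_morphism T \<rho>') =
      path_comp T u (Poly_Mapping.single (path_class T \<gamma>') c)"
    using * \<rho> single cls by (simp add: path_morphism_def)
  moreover have "path_morphism T \<rho>' \<in> pixel_mor (Some (\<rho>' 0)) x"
    using pixel_morI [OF *(1,3)] * single by simp
  ultimately show ?case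
    by blast
qed

end

section \<open>Completion, saturation and pre-dead pixels\<close>

locale screen_ideal = screen T P
  for T :: "'x triple" and P +
  fixes I :: "'x option \<Rightarrow> 'x option \<Rightarrow> ('x, 'k::{comm_ring,comm_monoid_mult}) path_mor set"
  assumes ideal_I: "is_ideal (path_category T) I"
begin

abbreviation "\<C> \<equiv> path_category T :: ('x option, ('x, 'k) path_mor, 'k) lcat"

sublocale ore: ore_system \<C> I pixel_mor
proof (intro ore_system.intro category_ideal.intro category_ideal_axioms.intro ore_system_axioms.intro)
  show "linear_category \<C>"
    by (rule linear_category_path)
qed (use ideal_I pixel_mor_hom pixel_mor_Idn pixel_mor_comp pixel_mor_unique pixel_mor_left pixel_mor_right
    pixel_mor_join pixel_mor_meet in simp_all)

lemma linked_single:
  assumes "path_pequiv T P \<gamma> \<gamma>'"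
  shows "ore.linked (Some (\<gamma> 0)) (Some (\<gamma> 1)) (Poly_Mapping.single (path_class T \<gamma>) c)
    (Some (\<gamma>' 0)) (Some (\<gamma>' 1)) (Poly_Mapping.single (path_class T \<gamma>') c)"
proof -
  obtain \<rho>1 \<rho>2 \<rho>3 \<rho>4 where p: "\<gamma> \<in> Paths T" "\<gamma>' \<in> Paths T" "\<rho>1 \<in> Paths T" "\<rho>2 \<in> Paths T" "\<rho>3 \<in> Paths T" "\<rho>4 \<in> Paths T"
    and Y: "\<exists>Y\<in>P. im \<rho>1 \<union> im \<rho>2 \<subseteq> Y" "\<exists>Z\<in>P. im \<rho>3 \<union> im \<rho>4 \<subseteq> Z"
    and ends: "\<rho>1 1 = \<gamma> 0" "\<gamma> 1 = \<rho>3 0" "\<rho>2 1 = \<gamma>' 0" "\<gamma>' 1 = \<rho>4 0"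
    and eqv: "(\<rho>1 \<cdot> \<gamma> \<cdot> \<rho>3, \<rho>2 \<cdot> \<gamma>' \<cdot> \<rho>4) \<in> Eqv T"
    using assms unfolding path_pequiv_def by blast
  have pix: "in_pixel P \<rho>1" "in_pixel P \<rho>2" "in_pixel P \<rho>3" "in_pixel P \<rho>4"
    using Y by (auto simp: in_pixel_def)
  have ends': "\<rho>2 0 = \<rho>1 0" "\<rho>4 1 = \<rho>3 1"
    using triple_endpoints [OF eqv] by simp_all
  have cls: "path_class T (\<rho>1 \<cdot> \<gamma> \<cdot> \<rho>3) = path_class T (\<rho>2 \<cdot> \<gamma>' \<cdot> \<rho>4)"
    using eqv path_class_eq_iff Eqv_in_Paths by blast
  have "path_comp T (path_morphism T \<rho>3) (path_comp T (Poly_Mapping.single (path_class T \<gamma>) c) (path_morphism T \<rho>1)) =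
      path_comp T (path_morphism T \<rho>4) (path_comp T (Poly_Mapping.single (path_class T \<gamma>') c) (path_morphism T \<rho>2))"
    using p ends cls by (simp add: path_morphism_def triple_concat)
  moreover have "path_morphism T \<rho>1 \<in> pixel_mor (Some (\<rho>1 0)) (Some (\<gamma> 0))"
    "path_morphism T \<rho>2 \<in> pixel_mor (Some (\<rho>1 0)) (Some (\<gamma>' 0))"
    "path_morphism T \<rho>3 \<in> pixel_mor (Some (\<gamma> 1)) (Some (\<rho>3 1))"
    "path_morphism T \<rho>4 \<in> pixel_mor (Some (\<gamma>' 1)) (Some (\<rho>3 1))"
    using pixel_morI [OF p(3) pix(1)] pixel_morI [OF p(4) pix(2)] pixel_morI [OF p(5) pix(3)] pixel_morI [OF p(6) pix(4)]
      ends ends' by simp_all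
  ultimately show ?thesis
    unfolding ore.linked_def using path_hom_single p(1,2) by (auto intro!: exI bexI)
qed

text \<open>Empty sums are excluded: they present zero morphisms between unrelated objects, which
  arrows of \<open>W\<close> need not connect. The induction therefore starts with one
  summand.\<close>

lemma linked_path_sum:
  assumes "list_all2 (\<lambda>(c, \<gamma>) (c', \<gamma>'). c = c' \<and> path_pequiv T P \<gamma> \<gamma>') ts ts'" "ts \<noteq> []"
    and "ts \<in> presentations T x y" "ts' \<in> presentations T x' y'"
  shows "ore.linked x y (path_sum T ts) x' y' (path_sum T ts')"
  using assms
proof (induction rule: list_all2_induct)
  case (Cons t ts t' ts')
  obtain c \<gamma> \<gamma>' where t: "t = (c, \<gamma>)" "t' = (c, \<gamma>')" "path_pequiv T P \<gamma> \<gamma>'"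
    using Cons.hyps(1) by (cases t; cases t') auto
  have ends: "x = Some (\<gamma> 0)" "y = Some (\<gamma> 1)" "x' = Some (\<gamma>' 0)" "y' = Some (\<gamma>' 1)"
    using Cons.prems by (auto simp: presentations_def t)
  have 1: "ore.linked x y (Poly_Mapping.single (path_class T \<gamma>) c) x' y' (Poly_Mapping.single (path_class T \<gamma>') c)"
    using linked_single [OF t(3)] ends by simp
  show ?case
  proof (cases "ts = []")
    case True
    then show ?thesis
      using 1 Cons.hyps(2) by (simp add: path_sum_def t)
  next
    case False
    then have "ore.linked x y (path_sum T ts) x' y' (path_sum T ts')"
      using Cons by (simp add: presentations_def)
    from ore.linked_Add [OF 1 this] show ?thesis
      by (simp add: path_sum_def t)
  qed
qed simp

lemma completion_saturation:
  assumes "x \<in> Ob \<C>" "y \<in> Ob \<C>"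
  shows "completion T P I x y \<subseteq> ore.saturation x y"
proof -
  have "f \<in> ore.saturation a b"
    if ab: "a \<in> Ob \<C>" "b \<in> Ob \<C>" and g: "g \<in> I x' y'" and f: "mor_pequiv T P a b f x' y' g" for a b f x' y' g
  proof -
    obtain ts ts' where ts: "ts \<in> presentations T a b" "ts' \<in> presentations T x' y'" "f = path_sum T ts" "g = path_sum T ts'"
      "list_all2 (\<lambda>(c, \<gamma>) (c', \<gamma>'). c = c' \<and> path_pequiv T P \<gamma> \<gamma>') ts ts'"
      using f unfolding mor_pequiv_def by blast
    show ?thesis
    proof (cases "ts = []")
      case True
      then have "f = Zero \<C> a b"
        using ts by (simp add: path_sum_def)
      then show ?thesis
        using ore.is_ideal_saturation ab unfolding is_ideal_def by blast
    next
      case False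
      show ?thesis
        using ore.linked_saturation [OF linked_path_sum [OF ts(5) False ts(1,2)]] g ts by simp
    qed
  qed
  then show ?thesis
    unfolding completion_def ideal_gen_def using ore.is_ideal_saturation by (intro Inter_lower) blast
qed

lemma vanishes_iff: "\<rho> \<in> Paths T \<Longrightarrow> vanishes T I \<rho> \<longleftrightarrow> path_morphism T \<rho> \<in> I (Some (\<rho> 0)) (Some (\<rho> 1))"
  unfolding vanishes_def path_coset_def
  using ore.coset_eq_Zero_iff [of "Some (\<rho> 0)" "Some (\<rho> 1)" "path_morphism T \<rho>"] path_morphism_hom [of \<rho>] by simp

lemma vanishes_completion_pre_dead:
  assumes \<rho>: "\<rho> \<in> Paths T" and Y: "Y \<in> P" "im \<rho> \<subseteq> Y" and vanish: "vanishes T (completion T P I) \<rho>"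
  shows "pre_dead T I Y"
proof -
  let ?J = "completion T P I (Some (\<rho> 0)) (Some (\<rho> 1))"
  have ob: "Some (\<rho> 0) \<in> Ob \<C>" "Some (\<rho> 1) \<in> Ob \<C>"
    using \<rho> by auto
  \<comment> \<open>The completion contains zero, so \<open>[\<rho>]\<close> lies in its own coset.
    By assumption that coset is the coset of zero, which is the completion itself.\<close>
  have "Zero \<C> (Some (\<rho> 0)) (Some (\<rho> 1)) \<in> ?J"
    unfolding completion_def ideal_gen_def using ob by (auto simp only: is_ideal_def)
  then have "path_morphism T \<rho> \<in> path_coset T (completion T P I) \<rho>"
    by (auto simp: path_coset_def coset_def intro!: image_eqI [of _ _ 0])
  then have "path_morphism T \<rho> \<in> ?J"
    using vanish by (auto simp: vanishes_def coset_def)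
  then obtain s t u v where u: "u \<in> pixel_mor s (Some (\<rho> 0))" and v: "v \<in> pixel_mor (Some (\<rho> 1)) t"
    and uv: "path_comp T v (path_comp T (path_morphism T \<rho>) u) \<in> I s t"
    using completion_saturation [OF ob] unfolding ore.saturation_def by auto
  obtain \<alpha> where \<alpha>: "\<alpha> \<in> Paths T" "in_pixel P \<alpha>" "s = Some (\<alpha> 0)" "\<rho> 0 = \<alpha> 1" "u = path_morphism T \<alpha>"
    using pixel_mor_SomeE [OF u] by (metis option.inject)
  obtain \<beta> where \<beta>: "\<beta> \<in> Paths T" "in_pixel P \<beta>" "t = Some (\<beta> 1)" "\<rho> 1 = \<beta> 0" "v = path_morphism T \<beta>"
    using pixel_mor_SomeE [OF v] by (metis option.inject)
  have "path_morphism T (\<alpha> \<cdot> \<rho> \<cdot> \<beta>) \<in> I (Some (\<alpha> 0)) (Some (\<beta> 1))"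
    using uv \<alpha> \<beta> \<rho> by (simp add: path_comp_path_morphism triple_concat)
  then have "vanishes T I (\<alpha> \<cdot> \<rho> \<cdot> \<beta>)"
    using \<alpha> \<beta> \<rho> vanishes_iff [of "\<alpha> \<cdot> \<rho> \<cdot> \<beta>"] by (simp add: triple_concat)
  moreover have "im (\<alpha> \<cdot> \<rho> \<cdot> \<beta>) \<subseteq> Y"
  proof -
    have "\<rho> 0 \<in> Y" "\<rho> 1 \<in> Y"
      using Y by (auto simp: im_def)
    then have "im \<alpha> \<subseteq> Y" "im \<beta> \<subseteq> Y"
      using im_subset_pixel [OF \<alpha>(2) Y(1), of 1] im_subset_pixel [OF \<beta>(2) Y(1), of 0] \<alpha>(4) \<beta>(4) by auto
    then show ?thesis
      using \<alpha>(4) \<beta>(4) Y by (simp add: im_pconcat)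
  qed
  ultimately show ?thesis
    using \<alpha> \<beta> \<rho> triple_concat unfolding pre_dead_def by (metis pconcat_1)
qed

end

section \<open>Pixelated representations\<close>

definition pixel_arrows ::
  "'x triple \<Rightarrow> ('x option \<Rightarrow> 'x option \<Rightarrow> ('x, 'k::{comm_ring,comm_monoid_mult}) path_mor set)
    \<Rightarrow> 'x set set \<Rightarrow> ('x option \<times> 'x option \<times> ('x, 'k) path_mor set) set" where
  "pixel_arrows T I P = {(Some (\<rho> 0), Some (\<rho> 1), path_coset T I \<rho>) | \<rho>. \<rho> \<in> Paths T \<and> in_pixel P \<rho>}"

text \<open>An invertible zero morphism makes the identity of \<open>x\<close> zero, and every
  morphism out of \<open>x\<close> factors through that identity.\<close>

lemma (in linear_category) is_iso_Zero_Hom: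
  assumes "is_iso D x y (Zero D x y)" "x \<in> Ob D" "y \<in> Ob D" "f \<in> Hom D x y"
  shows "f = Zero D x y"
proof -
  have "Idn D x = Zero D x x"
    using assms by (auto simp: is_iso_def)
  then show ?thesis
    using Cmp_Idn [OF assms(2-4)] assms by simp
qed

text \<open>A zero object is recognised by its identity being zero; this passes along isomorphisms, hence along
  the walks of condition S2.\<close>

lemma (in linear_category) Idn_Zero_iso:
  assumes f: "is_iso D x y f" and [simp]: "x \<in> Ob D" "y \<in> Ob D"
  shows "Idn D x = Zero D x x \<longleftrightarrow> Idn D y = Zero D y y"
proof -
  obtain g where g [simp]: "g \<in> Hom D y x" "Cmp D x y x g f = Idn D x" "Cmp D y x y f g = Idn D y"
    using is_isoE [OF f] by metis
  have [simp]: "f \<in> Hom D x y"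
    using f is_iso_in by simp
  show ?thesis
  proof
    assume "Idn D x = Zero D x x"
    then have "f = Zero D x y"
      using Cmp_Idn [of x y f] by simp
    then show "Idn D y = Zero D y y"
      using g(3) by simp
  next
    assume "Idn D y = Zero D y y"
    then have "f = Zero D x y"
      using Idn_Cmp [of x y f] by simp
    then show "Idn D x = Zero D x x"
      using g(2) by simp
  qed
qed

lemma (in screen_ideal) pixelates_iff:
  fixes K :: "('o, 'n, 'k) lcat"
  assumes "linear_category K" and M: "linear_functor (quotient_category \<C> I) K M"
  shows "pixelates T I K P M \<longleftrightarrow> inverts K M (pixel_arrows T I P)"
proof -
  interpret K: linear_category K
    by fact
  let ?A = "quotient_category \<C> I"
  interpret A: linear_category ?A
    by (rule ore.linear_category_quotient)
  have M_Ob [simp]: "FOb M (Some x) \<in> Ob K" if "x \<in> Pts T" for x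
    using linear_functorD(1) [OF M] that by simp
  note M_Zero = FMor_Zero [OF A.linear_category_axioms K.linear_category_axioms M]
  have coset_in: "path_coset T I \<rho> \<in> Hom ?A (Some (\<rho> 0)) (Some (\<rho> 1))" if "\<rho> \<in> Paths T" for \<rho>
    using that by (simp add: path_coset_def path_morphism_hom)
  show ?thesis
  proof
    assume pix: "pixelates T I K P M"
    have "is_iso K (FOb M (Some (\<rho> 0))) (FOb M (Some (\<rho> 1))) (FMor M (Some (\<rho> 0)) (Some (\<rho> 1)) (path_coset T I \<rho>))"
      (is "is_iso K ?x ?y ?f") if \<rho>: "\<rho> \<in> Paths T" "in_pixel P \<rho>" for \<rho>
    proof (cases "vanishes T (completion T P I) \<rho>")
      case False
      then show ?thesis
        using pix \<rho> unfolding pixelates_def Sigma_screen_def by blast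
    next
      case True
      obtain Y where Y: "Y \<in> P" "im \<rho> \<subseteq> Y"
        using \<rho> by (auto simp: in_pixel_def)
      \<comment> \<open>Here \<open>\<Sigma>\<close> contains the zero morphism between the ends of
        \<rho> in place of \<open>[\<rho>]\<close>. Once \<open>M\<close> inverts that zero
        morphism, all morphisms between the two values are zero, so \<open>M([\<rho>])\<close> is
        the same isomorphism.\<close>
      have "pre_dead T I Y" "\<rho> 0 \<in> Y" "\<rho> 1 \<in> Y"
        using vanishes_completion_pre_dead [OF \<rho>(1) Y True] Y by (auto simp: im_def)
      then have "is_iso K ?x ?y (FMor M (Some (\<rho> 0)) (Some (\<rho> 1)) (Zero ?A (Some (\<rho> 0)) (Some (\<rho> 1))))"
        using pix Y(1) unfolding pixelates_def Sigma_screen_def by blast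
      then have zero: "is_iso K ?x ?y (Zero K ?x ?y)"
        using M_Zero [of "Some (\<rho> 0)" "Some (\<rho> 1)"] \<rho> by simp
      have "?f \<in> Hom K ?x ?y"
        using linear_functorD(3) [OF M _ _ coset_in [OF \<rho>(1)]] \<rho>(1) by simp
      then have "?f = Zero K ?x ?y"
        using K.is_iso_Zero_Hom [OF zero] \<rho>(1) by simp
      then show ?thesis
        using zero by simp
    qed
    then show "inverts K M (pixel_arrows T I P)"
      by (auto simp: inverts_def pixel_arrows_def)
  next
    assume inv: "inverts K M (pixel_arrows T I P)"
    have iso: "is_iso K (FOb M (Some (\<rho> 0))) (FOb M (Some (\<rho> 1))) (FMor M (Some (\<rho> 0)) (Some (\<rho> 1)) (path_coset T I \<rho>))"
      if "\<rho> \<in> Paths T" "in_pixel P \<rho>" for \<rho>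
      using inv that unfolding inverts_def pixel_arrows_def by blast
    define dead where "dead = (\<lambda>x. Idn K (FOb M (Some x)) = Zero K (FOb M (Some x)) (FOb M (Some x)))"
    have dead_ends: "dead (\<rho> 0) \<longleftrightarrow> dead (\<rho> 1)" if "\<rho> \<in> Paths T" "in_pixel P \<rho>" for \<rho>
      unfolding dead_def by (rule K.Idn_Zero_iso [OF iso [OF that]]) (use that in simp_all)
    have dead_pixel: "dead x \<longleftrightarrow> dead y" if Y: "Y \<in> P" "x \<in> Y" "y \<in> Y" for x y Y
    proof -
      obtain n :: nat and \<gamma> where \<gamma>: "\<forall>i\<le>2*n. \<gamma> i \<in> Paths T \<and> im (\<gamma> i) \<subseteq> Y" "\<gamma> 0 0 = x" "\<gamma> (2*n) 1 = y"
        and walk: "\<forall>i<n. \<gamma> (2*i) 1 = \<gamma> (2*i+1) 1 \<and> \<gamma> (2*i+1) 0 = \<gamma> (2*i+2) 0"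
        using S2 [OF Y] by blast
      have step: "dead (\<gamma> i 0) \<longleftrightarrow> dead (\<gamma> i 1)" if "i \<le> 2*n" for i
        using dead_ends [of "\<gamma> i"] \<gamma>(1) that Y(1) by (auto simp: in_pixel_def)
      \<comment> \<open>Induction along the even-numbered paths: each step crosses one path
        backwards and the next one forwards. Deadness passes along a path in either
        direction.\<close>
      have "dead x \<longleftrightarrow> dead (\<gamma> (2*i) 1)" if "i \<le> n" for i
        using that
      proof (induction i)
        case 0
        then show ?case
          using step [of 0] \<gamma>(2) by simp
      next
        case (Suc i)
        then show ?case
          using step [of "2*i+1"] step [of "2*i+2"] walk by simp
      qed
      then show ?thesis
        using \<gamma>(3) by blast
    qed
    have zero: "is_iso K (FOb M (Some x)) (FOb M (Some y)) (FMor M (Some x) (Some y) (Zero ?A (Some x) (Some y)))"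
      if Y: "Y \<in> P" "pre_dead T I Y" "x \<in> Y" "y \<in> Y" for x y Y
    proof -
      have pts: "x \<in> Pts T" "y \<in> Pts T"
        using Y screen_partition by (auto simp: partition_on_def)
      obtain \<rho> where \<rho>: "\<rho> \<in> Paths T" "im \<rho> \<subseteq> Y" "path_coset T I \<rho> = Zero ?A (Some (\<rho> 0)) (Some (\<rho> 1))"
        using Y(2) by (auto simp: pre_dead_def vanishes_def)
      have "in_pixel P \<rho>"
        using \<rho> Y(1) by (auto simp: in_pixel_def)
      then have "is_iso K (FOb M (Some (\<rho> 0))) (FOb M (Some (\<rho> 1))) (Zero K (FOb M (Some (\<rho> 0))) (FOb M (Some (\<rho> 1))))"
        using iso [OF \<rho>(1)] \<rho>(1,3) M_Zero [of "Some (\<rho> 0)" "Some (\<rho> 1)"] by simp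
      then have "dead (\<rho> 0)"
        using \<rho>(1) by (auto simp: is_iso_def dead_def)
      moreover have "\<rho> 0 \<in> Y"
        using \<rho>(2) by (auto simp: im_def)
      ultimately have "dead x" "dead y"
        using dead_pixel Y by blast+
      \<comment> \<open>Between objects with zero identities the zero morphisms are inverse to each
        other.\<close>
      then have "is_iso K (FOb M (Some x)) (FOb M (Some y)) (Zero K (FOb M (Some x)) (FOb M (Some y)))"
        using pts unfolding is_iso_def dead_def
        by (intro conjI bexI [of _ "Zero K (FOb M (Some y)) (FOb M (Some x))"]) simp_all
      then show ?thesis
        using M_Zero [of "Some x" "Some y"] pts by simp
    qed
    show "pixelates T I K P M"
      unfolding pixelates_def
    proof clarify
      fix x y \<sigma> assume "(x, y, \<sigma>) \<in> Sigma_screen T I P"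
      then consider \<rho> where "\<rho> \<in> Paths T" "in_pixel P \<rho>" "x = Some (\<rho> 0)" "y = Some (\<rho> 1)" "\<sigma> = path_coset T I \<rho>"
        | a b Y where "Y \<in> P" "pre_dead T I Y" "a \<in> Y" "b \<in> Y" "x = Some a" "y = Some b"
          "\<sigma> = Zero ?A (Some a) (Some b)"
        unfolding Sigma_screen_def by blast
      then show "is_iso K (FOb M x) (FOb M y) (FMor M x y \<sigma>)"
        by cases (use iso zero in \<open>simp_all only:\<close>)
    qed
  qed
qed

theorem theorem2:
  fixes K :: "('o, 'n, 'k::{comm_ring,comm_monoid_mult}) lcat"
    and T :: "'x triple"
    and I :: "'x option \<Rightarrow> 'x option \<Rightarrow> ('x, 'k) path_mor set"
    and L :: "'x set set set"
  assumes K: "abelian_category K"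
    and T: "path_triple T"
    and screens: "screens T \<noteq> {}"
    and I: "path_based T I"
    and L: "L \<subseteq> screens T" "L \<noteq> {}"
    and directed: "\<And>F. finite F \<Longrightarrow> F \<subseteq> L \<Longrightarrow> \<exists>P\<in>L. \<forall>Q\<in>F. refines (Pts T) P Q"
  shows "wide_subcategory (Rep T I K) (pixelated_by T I K L) \<and>
    (\<forall>E. exact_structure (Rep T I K) E \<longrightarrow>
      exact_structure (full_subcategory (Rep T I K) (pixelated_by T I K L))
        (restrict_structure (Rep T I K) (pixelated_by T I K L) E))"
proof -
  have ideal: "is_ideal (path_category T) I"
    using I by (simp add: path_based_def)
  interpret T: path_triple T
    by fact
  interpret C: category_ideal "path_category T" I
    by (intro category_ideal.intro category_ideal_axioms.intro T.linear_category_path ideal)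
  let ?A = "quotient_category (path_category T) I"
  interpret rep: functors ?A K
    by (intro functors.intro C.linear_category_quotient K)
  have screen_ideal: "screen_ideal T P I" if "P \<in> L" for P
    using that L(1) ideal by (auto simp: screens_def intro!: screen_ideal.intro screen_ideal_axioms.intro)
  have "pixelated_by T I K L = {M \<in> Ob (functor_category ?A K). \<exists>P\<in>L. inverts K M (pixel_arrows T I P)}"
    unfolding pixelated_by_def Rep_def
    using screen_ideal.pixelates_iff [OF screen_ideal rep.linear_category_axioms] by auto
  moreover have "wide_subset (functor_category ?A K)
    {M \<in> Ob (functor_category ?A K). \<exists>P\<in>L. inverts K M (pixel_arrows T I P)}"
  proof (rule rep.wide_subset_inverts)
    fix P x y \<sigma> assume "(x, y, \<sigma>) \<in> pixel_arrows T I P"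
    then show "x \<in> Ob ?A \<and> y \<in> Ob ?A \<and> \<sigma> \<in> Hom ?A x y"
      using T.path_morphism_hom by (auto simp: pixel_arrows_def path_coset_def)
  next
    fix P Q assume "P \<in> L" "Q \<in> L"
    then obtain U where "U \<in> L" "refines (Pts T) U P" "refines (Pts T) U Q"
      using directed [of "{P, Q}"] by auto
    \<comment> \<open>A pixel of the finer screen lies inside a pixel of the coarser one, so
      in-pixel paths stay in-pixel.\<close>
    moreover have "pixel_arrows T I U \<subseteq> pixel_arrows T I V" if "refines (Pts T) U V" for V
    proof -
      have "in_pixel V \<rho>" if "in_pixel U \<rho>" for \<rho> :: "'x path"
        using that \<open>refines (Pts T) U V\<close> unfolding refines_def in_pixel_def by (meson subset_trans)
      then show ?thesis
        by (auto simp: pixel_arrows_def)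
    qed
    ultimately show "\<exists>U\<in>L. pixel_arrows T I U \<subseteq> pixel_arrows T I P \<inter> pixel_arrows T I Q"
      by blast
  qed (rule L(2))
  ultimately interpret wide_subset "Rep T I K" "pixelated_by T I K L"
    by (simp add: Rep_def)
  show ?thesis
    using wide_subcategory exact_structure_restrict by blast
qed

end
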